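(* Let $\mathbf{Inv}_{sp}$ be the category of spatial pseudogroups and callitic pseudogroup morphisms, and let $\mathbf{Etale}_{so}$ be the category of sober étale groupoids and continuous covering functors. Then the category $\mathbf{Inv}_{sp}^{op}$ is equivalent to the category $\mathbf{Etale}_{so}$.
   Context: Inverse semigroups carry their natural partial order. Elements $s,t$ are compatible if $s^{-1}t$ and $st^{-1}$ are idempotents; a subset is compatible if its elements are pairwise compatible. A pseudogroup is an inverse monoid in which every compatible subset has a join (so there is a zero, the empty join) and multiplication distributes over arbitrary compatible joins. Pseudogroups have all binary meets. A pseudogroup morphism is a semigroup homomorphism preserving compatible joins; it is a $\wedge$-morphism if it also preserves binary meets. A filter in an inverse semigroup is a non-empty subset $F$ that is upward closed and such that for all $a,b\in F$ there is $c\in F$ with $c\le a,b$; all filters are assumed proper, i.e. $0\notin F$. A filter $F$ in a pseudogroup is completely prime if $\bigvee_i a_i\in F$ implies $a_i\in F$ for some $i$. A function $\theta\colon S\to T$ between pseudogroups is callitic if it is a $\wedge$-morphism of pseudogroups and $F\cap\operatorname{im}(\theta)\ne\emptyset$ for every completely prime filter $F$ of $T$. For a filter $A$ put $\mathbf{d}(A)=(A^{-1}A)^{\uparrow}$, $\mathbf{r}(A)=(AA^{-1})^{\uparrow}$ (upward closures); $A\cdot B=(AB)^{\uparrow}$ is defined iff $\mathbf{d}(A)=\mathbf{r}(B)$. The set $\mathsf{G}(S)$ of completely prime filters of a pseudogroup $S$ is then a groupoid, topologized with basis the sets $X_s=\{F\in\mathsf{G}(S): s\in F\}$, $s\in S$.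 The pseudogroup $S$ is spatial if $X_s=X_t$ implies $s=t$ for all $s,t\in S$. A groupoid $G$ is identified with its set of arrows, $G_o$ is its set of identities, $\mathbf{d}(x)=x^{-1}x$. An étale groupoid is a topological groupoid whose domain map $\mathbf{d}\colon G\to G_o$ is a local homeomorphism. A bisection is a subset $A\subseteq G$ with $A^{-1}A, AA^{-1}\subseteq G_o$; $\mathsf{B}(G)$ is the pseudogroup of open bisections under subset multiplication. For $g\in G$ let $F_g$ be the set of open bisections containing $g$; it is a completely prime filter of $\mathsf{B}(G)$. The étale groupoid $G$ is sober if $\eta\colon G\to\mathsf{G}(\mathsf{B}(G))$, $g\mapsto F_g$, is a homeomorphism. A functor $\alpha\colon G\to H$ of groupoids is a covering functor if (i) $\mathbf{d}(g)=\mathbf{d}(g')$ and $\alpha(g)=\alpha(g')$ imply $g=g'$, and (ii) if $e$ is an identity with $\alpha(e)=\mathbf{d}(h)$ then there is $g\in G$ with $\mathbf{d}(g)=e$ and $\alpha(g)=h$. *)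

theory Defs
  imports
    "HOL-Algebra.Coset"
    "HOL-Algebra.Lattice"
    "HOL-Analysis.Product_Topology"
    "HOL-Library.Equipollence"
begin

section \<open>Categories\<close>

text \<open>Hom-sets of distinct pairs of objects need not be disjoint, so identities, composition and
  the arrow part of a functor are indexed by objects. \<open>Comp C X Y Z g f\<close> is the composite of
  \<open>f : X \<rightarrow> Y\<close> followed by \<open>g : Y \<rightarrow> Z\<close>.\<close>

record ('o, 'm) cat =
  Obj :: "'o set"
  Hom :: "'o \<Rightarrow> 'o \<Rightarrow> 'm set"
  Ident :: "'o \<Rightarrow> 'm"
  Comp :: "'o \<Rightarrow> 'o \<Rightarrow> 'o \<Rightarrow> 'm \<Rightarrow> 'm \<Rightarrow> 'm"

locale category =
  fixes C :: "('o, 'm) cat"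
  assumes Ident_in: "X \<in> Obj C \<Longrightarrow> Ident C X \<in> Hom C X X"
    and Comp_in: "\<lbrakk>X \<in> Obj C; Y \<in> Obj C; Z \<in> Obj C; f \<in> Hom C X Y; g \<in> Hom C Y Z\<rbrakk>
      \<Longrightarrow> Comp C X Y Z g f \<in> Hom C X Z"
    and Comp_Ident_right: "\<lbrakk>X \<in> Obj C; Y \<in> Obj C; f \<in> Hom C X Y\<rbrakk>
      \<Longrightarrow> Comp C X X Y f (Ident C X) = f"
    and Comp_Ident_left: "\<lbrakk>X \<in> Obj C; Y \<in> Obj C; f \<in> Hom C X Y\<rbrakk>
      \<Longrightarrow> Comp C X Y Y (Ident C Y) f = f"
    and Comp_assoc: "\<lbrakk>W \<in> Obj C; X \<in> Obj C; Y \<in> Obj C; Z \<in> Obj C;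
        f \<in> Hom C W X; g \<in> Hom C X Y; h \<in> Hom C Y Z\<rbrakk>
      \<Longrightarrow> Comp C W Y Z h (Comp C W X Y g f) = Comp C W X Z (Comp C X Y Z h g) f"

definition op_cat :: "('o, 'm) cat \<Rightarrow> ('o, 'm) cat" where
  "op_cat C = \<lparr>Obj = Obj C, Hom = (\<lambda>X Y. Hom C Y X), Ident = Ident C,
     Comp = (\<lambda>X Y Z g f. Comp C Z Y X f g)\<rparr>"

definition is_functor ::
  "('o, 'm) cat \<Rightarrow> ('p, 'n) cat \<Rightarrow> ('o \<Rightarrow> 'p) \<Rightarrow> ('o \<Rightarrow> 'o \<Rightarrow> 'm \<Rightarrow> 'n) \<Rightarrow> bool" where
  "is_functor C D F F' \<longleftrightarrow>
     (\<forall>X\<in>Obj C. F X \<in> Obj D) \<and>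
     (\<forall>X\<in>Obj C. \<forall>Y\<in>Obj C. \<forall>f\<in>Hom C X Y. F' X Y f \<in> Hom D (F X) (F Y)) \<and>
     (\<forall>X\<in>Obj C. F' X X (Ident C X) = Ident D (F X)) \<and>
     (\<forall>X\<in>Obj C. \<forall>Y\<in>Obj C. \<forall>Z\<in>Obj C. \<forall>f\<in>Hom C X Y. \<forall>g\<in>Hom C Y Z.
        F' X Z (Comp C X Y Z g f) = Comp D (F X) (F Y) (F Z) (F' Y Z g) (F' X Y f))"

definition is_iso :: "('o, 'm) cat \<Rightarrow> 'o \<Rightarrow> 'o \<Rightarrow> 'm \<Rightarrow> bool" where
  "is_iso C X Y f \<longleftrightarrow> f \<in> Hom C X Y \<and>
     (\<exists>g\<in>Hom C Y X. Comp C X Y X g f = Ident C X \<and> Comp C Y X Y f g = Ident C Y)"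

definition natural_iso ::
  "('o, 'm) cat \<Rightarrow> ('p, 'n) cat \<Rightarrow> ('o \<Rightarrow> 'p) \<Rightarrow> ('o \<Rightarrow> 'o \<Rightarrow> 'm \<Rightarrow> 'n) \<Rightarrow>
   ('o \<Rightarrow> 'p) \<Rightarrow> ('o \<Rightarrow> 'o \<Rightarrow> 'm \<Rightarrow> 'n) \<Rightarrow> ('o \<Rightarrow> 'n) \<Rightarrow> bool" where
  "natural_iso C D F F' G G' \<tau> \<longleftrightarrow>
     (\<forall>X\<in>Obj C. is_iso D (F X) (G X) (\<tau> X)) \<and>
     (\<forall>X\<in>Obj C. \<forall>Y\<in>Obj C. \<forall>f\<in>Hom C X Y.
        Comp D (F X) (F Y) (G Y) (\<tau> Y) (F' X Y f) = Comp D (F X) (G X) (G Y) (G' X Y f) (\<tau> X))"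

definition equivalent_categories :: "('o, 'm) cat \<Rightarrow> ('p, 'n) cat \<Rightarrow> bool" where
  "equivalent_categories C D \<longleftrightarrow> category C \<and> category D \<and>
     (\<exists>F F' G G' \<eta> \<epsilon>. is_functor C D F F' \<and> is_functor D C G G' \<and>
        natural_iso C C (\<lambda>X. X) (\<lambda>X Y f. f) (\<lambda>X. G (F X)) (\<lambda>X Y f. G' (F X) (F Y) (F' X Y f)) \<eta> \<and>
        natural_iso D D (\<lambda>X. F (G X)) (\<lambda>X Y f. F' (G X) (G Y) (G' X Y f)) (\<lambda>X. X) (\<lambda>X Y f. f) \<epsilon>)"


section \<open>Pseudogroups\<close>

definition idempotents :: "('a, 'c) monoid_scheme \<Rightarrow> 'a set" where
  "idempotents S = {e \<in> carrier S. e \<otimes>\<^bsub>S\<^esub> e = e}"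

definition is_pinv :: "('a, 'c) monoid_scheme \<Rightarrow> 'a \<Rightarrow> 'a \<Rightarrow> bool" where
  "is_pinv S s t \<longleftrightarrow> t \<in> carrier S \<and>
     s \<otimes>\<^bsub>S\<^esub> t \<otimes>\<^bsub>S\<^esub> s = s \<and> t \<otimes>\<^bsub>S\<^esub> s \<otimes>\<^bsub>S\<^esub> t = t"

text \<open>The inverse of \<open>s\<close> in the sense of inverse semigroups; \<^const>\<open>m_inv\<close> is only meaningful for
  units.\<close>

definition pinv :: "('a, 'c) monoid_scheme \<Rightarrow> 'a \<Rightarrow> 'a" where
  "pinv S s = (THE t. is_pinv S s t)"

locale inverse_monoid = monoid S for S (structure) +
  assumes unique_pinv: "s \<in> carrier S \<Longrightarrow> \<exists>!t. is_pinv S s t"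

definition nat_order :: "('a, 'c) monoid_scheme \<Rightarrow> 'a gorder" where
  "nat_order S = \<lparr>carrier = carrier S, eq = (=),
     le = (\<lambda>s t. \<exists>e\<in>idempotents S. s = t \<otimes>\<^bsub>S\<^esub> e)\<rparr>"

definition compatible :: "('a, 'c) monoid_scheme \<Rightarrow> 'a set \<Rightarrow> bool" where
  "compatible S A \<longleftrightarrow> A \<subseteq> carrier S \<and>
     (\<forall>s\<in>A. \<forall>t\<in>A. pinv S s \<otimes>\<^bsub>S\<^esub> t \<in> idempotents S \<and> s \<otimes>\<^bsub>S\<^esub> pinv S t \<in> idempotents S)"

locale pseudogroup = inverse_monoid S for S (structure) +
  assumes join_exists: "compatible S A \<Longrightarrow> \<exists>j. least (nat_order S) j (Upper (nat_order S) A)"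
    and distrib_left: "\<lbrakk>compatible S A; s \<in> carrier S\<rbrakk>
      \<Longrightarrow> s \<otimes> \<Squnion>\<^bsub>nat_order S\<^esub> A = \<Squnion>\<^bsub>nat_order S\<^esub> ((\<lambda>a. s \<otimes> a) ` A)"
    and distrib_right: "\<lbrakk>compatible S A; s \<in> carrier S\<rbrakk>
      \<Longrightarrow> \<Squnion>\<^bsub>nat_order S\<^esub> A \<otimes> s = \<Squnion>\<^bsub>nat_order S\<^esub> ((\<lambda>a. a \<otimes> s) ` A)"

definition pzero :: "('a, 'c) monoid_scheme \<Rightarrow> 'a" where
  "pzero S = \<Squnion>\<^bsub>nat_order S\<^esub> {}"

text \<open>Morphisms need not preserve the unit: \<^const>\<open>hom\<close> consists of semigroup homomorphisms.\<close>

definition pseudogroup_morphism ::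
  "('a, 'c) monoid_scheme \<Rightarrow> ('b, 'd) monoid_scheme \<Rightarrow> ('a \<Rightarrow> 'b) \<Rightarrow> bool" where
  "pseudogroup_morphism S T \<theta> \<longleftrightarrow> \<theta> \<in> hom S T \<and>
     (\<forall>A. compatible S A \<longrightarrow> \<theta> (\<Squnion>\<^bsub>nat_order S\<^esub> A) = \<Squnion>\<^bsub>nat_order T\<^esub> (\<theta> ` A))"

definition meet_morphism ::
  "('a, 'c) monoid_scheme \<Rightarrow> ('b, 'd) monoid_scheme \<Rightarrow> ('a \<Rightarrow> 'b) \<Rightarrow> bool" where
  "meet_morphism S T \<theta> \<longleftrightarrow> pseudogroup_morphism S T \<theta> \<and>
     (\<forall>a\<in>carrier S. \<forall>b\<in>carrier S. \<theta> (a \<sqinter>\<^bsub>nat_order S\<^esub> b) = \<theta> a \<sqinter>\<^bsub>nat_order T\<^esub> \<theta> b)"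

definition proper_filter :: "('a, 'c) monoid_scheme \<Rightarrow> 'a set \<Rightarrow> bool" where
  "proper_filter S F \<longleftrightarrow> F \<subseteq> carrier S \<and> F \<noteq> {} \<and>
     (\<forall>a\<in>F. \<forall>b\<in>carrier S. a \<sqsubseteq>\<^bsub>nat_order S\<^esub> b \<longrightarrow> b \<in> F) \<and>
     (\<forall>a\<in>F. \<forall>b\<in>F. \<exists>c\<in>F. c \<sqsubseteq>\<^bsub>nat_order S\<^esub> a \<and> c \<sqsubseteq>\<^bsub>nat_order S\<^esub> b) \<and>
     pzero S \<notin> F"

definition completely_prime :: "('a, 'c) monoid_scheme \<Rightarrow> 'a set \<Rightarrow> bool" where
  "completely_prime S F \<longleftrightarrow>
     (\<forall>A. compatible S A \<and> \<Squnion>\<^bsub>nat_order S\<^esub> A \<in> F \<longrightarrow> (\<exists>a\<in>A. a \<in> F))"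

definition cp_filters :: "('a, 'c) monoid_scheme \<Rightarrow> 'a set set" where
  "cp_filters S = {F. proper_filter S F \<and> completely_prime S F}"

definition callitic ::
  "('a, 'c) monoid_scheme \<Rightarrow> ('b, 'd) monoid_scheme \<Rightarrow> ('a \<Rightarrow> 'b) \<Rightarrow> bool" where
  "callitic S T \<theta> \<longleftrightarrow> meet_morphism S T \<theta> \<and>
     (\<forall>F\<in>cp_filters T. F \<inter> \<theta> ` carrier S \<noteq> {})"

definition X_set :: "('a, 'c) monoid_scheme \<Rightarrow> 'a \<Rightarrow> 'a set set" where
  "X_set S s = {F \<in> cp_filters S. s \<in> F}"

locale spatial_pseudogroup = pseudogroup S for S (structure) +
  assumes spatial: "\<lbrakk>s \<in> carrier S; t \<in> carrier S; X_set S s = X_set S t\<rbrakk> \<Longrightarrow> s = t"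


section \<open>Etale groupoids\<close>

text \<open>A groupoid is identified with its set of arrows, given by \<^const>\<open>carrier\<close>. The product
  \<open>gmult G x y\<close> is meaningful only if \<open>gdom G x = gcod G y\<close>.\<close>

record 'a top_groupoid = "'a partial_object" +
  gdom :: "'a \<Rightarrow> 'a"
  gcod :: "'a \<Rightarrow> 'a"
  gmult :: "'a \<Rightarrow> 'a \<Rightarrow> 'a"
  ginv :: "'a \<Rightarrow> 'a"
  gtop :: "'a topology"

locale groupoid =
  fixes G :: "('a, 'c) top_groupoid_scheme"
  assumes gdom_in: "x \<in> carrier G \<Longrightarrow> gdom G x \<in> carrier G"
    and gcod_in: "x \<in> carrier G \<Longrightarrow> gcod G x \<in> carrier G"
    and gdom_gdom: "x \<in> carrier G \<Longrightarrow> gdom G (gdom G x) = gdom G x"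
    and gcod_gdom: "x \<in> carrier G \<Longrightarrow> gcod G (gdom G x) = gdom G x"
    and gdom_gcod: "x \<in> carrier G \<Longrightarrow> gdom G (gcod G x) = gcod G x"
    and gcod_gcod: "x \<in> carrier G \<Longrightarrow> gcod G (gcod G x) = gcod G x"
    and gmult_in: "\<lbrakk>x \<in> carrier G; y \<in> carrier G; gdom G x = gcod G y\<rbrakk>
      \<Longrightarrow> gmult G x y \<in> carrier G"
    and gdom_gmult: "\<lbrakk>x \<in> carrier G; y \<in> carrier G; gdom G x = gcod G y\<rbrakk>
      \<Longrightarrow> gdom G (gmult G x y) = gdom G y"
    and gcod_gmult: "\<lbrakk>x \<in> carrier G; y \<in> carrier G; gdom G x = gcod G y\<rbrakk>
      \<Longrightarrow> gcod G (gmult G x y) = gcod G x"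
    and gmult_assoc: "\<lbrakk>x \<in> carrier G; y \<in> carrier G; z \<in> carrier G;
        gdom G x = gcod G y; gdom G y = gcod G z\<rbrakk>
      \<Longrightarrow> gmult G (gmult G x y) z = gmult G x (gmult G y z)"
    and gmult_gdom: "x \<in> carrier G \<Longrightarrow> gmult G x (gdom G x) = x"
    and gcod_gmult_left: "x \<in> carrier G \<Longrightarrow> gmult G (gcod G x) x = x"
    and ginv_in: "x \<in> carrier G \<Longrightarrow> ginv G x \<in> carrier G"
    and gdom_ginv: "x \<in> carrier G \<Longrightarrow> gdom G (ginv G x) = gcod G x"
    and gcod_ginv: "x \<in> carrier G \<Longrightarrow> gcod G (ginv G x) = gdom G x"
    and ginv_gmult: "x \<in> carrier G \<Longrightarrow> gmult G (ginv G x) x = gdom G x"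
    and gmult_ginv: "x \<in> carrier G \<Longrightarrow> gmult G x (ginv G x) = gcod G x"

definition identities :: "('a, 'c) top_groupoid_scheme \<Rightarrow> 'a set" where
  "identities G = {e \<in> carrier G. gdom G e = e}"

definition composable :: "('a, 'c) top_groupoid_scheme \<Rightarrow> ('a \<times> 'a) set" where
  "composable G = {(x, y). x \<in> carrier G \<and> y \<in> carrier G \<and> gdom G x = gcod G y}"

locale topological_groupoid = groupoid G for G :: "('a, 'c) top_groupoid_scheme" +
  assumes topspace_gtop: "topspace (gtop G) = carrier G"
    and continuous_gmult: "continuous_map
      (subtopology (prod_topology (gtop G) (gtop G)) (composable G)) (gtop G) (\<lambda>(x, y). gmult G x y)"
    and continuous_ginv: "continuous_map (gtop G) (gtop G) (ginv G)"

definition local_homeomorphism :: "'a topology \<Rightarrow> 'b topology \<Rightarrow> ('a \<Rightarrow> 'b) \<Rightarrow> bool" where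
  "local_homeomorphism X Y f \<longleftrightarrow>
     (\<forall>x\<in>topspace X. \<exists>U. openin X U \<and> x \<in> U \<and> openin Y (f ` U) \<and>
        homeomorphic_map (subtopology X U) (subtopology Y (f ` U)) f)"

locale etale_groupoid = topological_groupoid G for G :: "('a, 'c) top_groupoid_scheme" +
  assumes local_homeo_gdom:
    "local_homeomorphism (gtop G) (subtopology (gtop G) (identities G)) (gdom G)"

definition gset_mult :: "('a, 'c) top_groupoid_scheme \<Rightarrow> 'a set \<Rightarrow> 'a set \<Rightarrow> 'a set" where
  "gset_mult G A B = {gmult G a b |a b. a \<in> A \<and> b \<in> B \<and> (a, b) \<in> composable G}"

definition bisection :: "('a, 'c) top_groupoid_scheme \<Rightarrow> 'a set \<Rightarrow> bool" where
  "bisection G A \<longleftrightarrow> A \<subseteq> carrier G \<and>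
     gset_mult G (ginv G ` A) A \<subseteq> identities G \<and> gset_mult G A (ginv G ` A) \<subseteq> identities G"

definition open_bisections :: "('a, 'c) top_groupoid_scheme \<Rightarrow> 'a set set" where
  "open_bisections G = {A. openin (gtop G) A \<and> bisection G A}"

definition bisection_pseudogroup :: "('a, 'c) top_groupoid_scheme \<Rightarrow> 'a set monoid" where
  "bisection_pseudogroup G =
     \<lparr>carrier = open_bisections G, mult = gset_mult G, one = identities G\<rparr>"

definition up_closure :: "('a, 'c) monoid_scheme \<Rightarrow> 'a set \<Rightarrow> 'a set" where
  "up_closure S A = {t \<in> carrier S. \<exists>s\<in>A. s \<sqsubseteq>\<^bsub>nat_order S\<^esub> t}"

text \<open>The sets \<^const>\<open>X_set\<close> cover the completely prime filters and are closed under finite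
  intersections up to unions, so the topology they generate has them as a basis.\<close>

definition filter_groupoid :: "('a, 'c) monoid_scheme \<Rightarrow> 'a set top_groupoid" where
  "filter_groupoid S =
     \<lparr>carrier = cp_filters S,
      gdom = (\<lambda>A. up_closure S (pinv S ` A <#>\<^bsub>S\<^esub> A)),
      gcod = (\<lambda>A. up_closure S (A <#>\<^bsub>S\<^esub> pinv S ` A)),
      gmult = (\<lambda>A B. up_closure S (A <#>\<^bsub>S\<^esub> B)),
      ginv = (\<lambda>A. pinv S ` A),
      gtop = topology_generated_by (X_set S ` carrier S)\<rparr>"

definition F_filter :: "('a, 'c) top_groupoid_scheme \<Rightarrow> 'a \<Rightarrow> 'a set set" where
  "F_filter G g = {A \<in> open_bisections G. g \<in> A}"

locale sober_etale_groupoid = etale_groupoid G for G :: "('a, 'c) top_groupoid_scheme" +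
  assumes sober:
    "homeomorphic_map (gtop G) (gtop (filter_groupoid (bisection_pseudogroup G))) (F_filter G)"

definition groupoid_functor ::
  "('a, 'c) top_groupoid_scheme \<Rightarrow> ('b, 'd) top_groupoid_scheme \<Rightarrow> ('a \<Rightarrow> 'b) \<Rightarrow> bool" where
  "groupoid_functor G H \<alpha> \<longleftrightarrow> \<alpha> \<in> carrier G \<rightarrow> carrier H \<and>
     (\<forall>x\<in>carrier G. \<alpha> (gdom G x) = gdom H (\<alpha> x) \<and> \<alpha> (gcod G x) = gcod H (\<alpha> x)) \<and>
     (\<forall>(x, y)\<in>composable G. \<alpha> (gmult G x y) = gmult H (\<alpha> x) (\<alpha> y))"

definition covering_functor ::
  "('a, 'c) top_groupoid_scheme \<Rightarrow> ('b, 'd) top_groupoid_scheme \<Rightarrow> ('a \<Rightarrow> 'b) \<Rightarrow> bool" where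
  "covering_functor G H \<alpha> \<longleftrightarrow> groupoid_functor G H \<alpha> \<and>
     (\<forall>g\<in>carrier G. \<forall>g'\<in>carrier G. gdom G g = gdom G g' \<and> \<alpha> g = \<alpha> g' \<longrightarrow> g = g') \<and>
     (\<forall>e\<in>identities G. \<forall>h\<in>carrier H. \<alpha> e = gdom H h \<longrightarrow>
        (\<exists>g\<in>carrier G. gdom G g = e \<and> \<alpha> g = h))"


section \<open>The two categories\<close>

text \<open>The predicate \<open>P\<close> bounds the size of the objects: each category is the full category on all
  structures in the given type that satisfy \<open>P\<close>. Arrows are functions made \<^const>\<open>undefined\<close>
  outside the carrier of their source, so that equality of arrows is equality on the carrier.\<close>

definition Inv_sp :: "('a monoid \<Rightarrow> bool) \<Rightarrow> ('a monoid, 'a \<Rightarrow> 'a) cat" where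
  "Inv_sp P =
     \<lparr>Obj = {S. spatial_pseudogroup S \<and> P S},
      Hom = (\<lambda>S T. {\<theta> \<in> extensional (carrier S). callitic S T \<theta>}),
      Ident = (\<lambda>S. \<lambda>s\<in>carrier S. s),
      Comp = (\<lambda>S T U \<phi> \<theta>. compose (carrier S) \<phi> \<theta>)\<rparr>"

definition Etale_so :: "('a top_groupoid \<Rightarrow> bool) \<Rightarrow> ('a top_groupoid, 'a \<Rightarrow> 'a) cat" where
  "Etale_so P =
     \<lparr>Obj = {G. sober_etale_groupoid G \<and> P G},
      Hom = (\<lambda>G H. {\<alpha> \<in> extensional (carrier G).
        covering_functor G H \<alpha> \<and> continuous_map (gtop G) (gtop H) \<alpha>}),
      Ident = (\<lambda>G. \<lambda>x\<in>carrier G. x),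
      Comp = (\<lambda>G H K \<beta> \<alpha>. compose (carrier G) \<beta> \<alpha>)\<rparr>"

text \<open>A family of sets closed under subsets and, up to bijection, power sets. Its members play the
  role of the small sets, as the members of a Grothendieck universe do in set theory; for a universe
  \<open>\<U>\<close>, the objects of \<open>Inv_sp (\<lambda>S. carrier S \<in> \<U>)\<close> are all small spatial pseudogroups.

  HOL alone does not provide universes with infinite members. A size bound that makes sense for any
  two types \<open>'a\<close> and \<open>'b\<close> is to keep a pseudogroup on \<open>'a\<close> if its completely prime filters can be
  relabelled by elements of \<open>'b\<close>, and a groupoid on \<open>'b\<close> if its open bisections can be relabelled
  by elements of \<open>'a\<close>. For \<open>'a = 'b set\<close> this keeps every groupoid, and for \<open>'b = 'a set\<close> every
  pseudogroup.\<close>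

definition universe :: "'u set set \<Rightarrow> bool" where
  "universe \<U> \<longleftrightarrow> (\<forall>A\<in>\<U>. \<forall>B. B \<subseteq> A \<longrightarrow> B \<in> \<U>) \<and> (\<forall>A\<in>\<U>. \<exists>B\<in>\<U>. Pow A \<approx> B)"

end

theory Submission
  imports Defs
begin

text \<open>Both categories are compared through \<^emph>\<open>dual pairs\<close>: an etale groupoid \<open>G\<close> and a monoid
  \<open>S\<close> with an isomorphism \<open>\<beta>\<close> from \<open>S\<close> onto the open bisections of \<open>G\<close> such that the
  completely prime filters of \<open>S\<close> are exactly the sets \<open>{s. g \<in> \<beta> s}\<close> for a unique arrow \<open>g\<close>.
  Then \<open>S\<close> is spatial and \<open>G\<close> is sober, every spatial \<open>S\<close> is dual to its groupoid of completely
  prime filters, and every sober \<open>G\<close> is dual to its open bisections. A callitic morphism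
  \<open>\<theta> : S \<rightarrow> T\<close> and a continuous covering functor \<open>\<alpha> : H \<rightarrow> G\<close> correspond to each other by
  \<open>\<gamma> (\<theta> s) = \<alpha>\<inverse> (\<beta> s)\<close>: since arrows of \<open>G\<close> are separated by open bisections, all laws for \<open>\<alpha>\<close>
  are read off from the products of open bisections. The equivalence is then formal. Objects are
  relabelled along arbitrary injections, so both size conditions are instances of the same
  statement.\<close>

text \<open>The obstacle is typing: the groupoid of completely prime filters of a monoid on
  \<open>'a\<close> lives on \<open>'a set\<close>, and passing to open bisections climbs a type in
  the same way. So neither construction lands in the other category without renaming, and renaming
  needs choices. Dual pairs presuppose no particular construction; the choices are made only once,
  when the formal argument at the end picks a partner for every object. The two clauses that define
  a covering functor say together that \<alpha> maps the arrows with domain e bijectively onto the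
  arrows with domain \<alpha>(e). Injectivity makes preimages of bisections bisections; surjectivity
  makes preimages commute with products of bisections. Conversely, \<theta> being callitic is what
  makes preimages of completely prime filters completely prime, and these filters are the values of
  \<alpha>.\<close>

section \<open>Inverse monoids\<close>

context inverse_monoid
begin

abbreviation star ("_\<^sup>-" [1000] 1000) where "s\<^sup>- \<equiv> pinv S s"
abbreviation leq (infix "\<preceq>" 50) where "s \<preceq> t \<equiv> s \<sqsubseteq>\<^bsub>nat_order S\<^esub> t"
abbreviation E where "E \<equiv> idempotents S"

lemma is_pinv_pinv: "s \<in> carrier S \<Longrightarrow> is_pinv S s s\<^sup>-"
  unfolding pinv_def by (rule theI') (rule unique_pinv)

lemma pinv_eqI: "s \<in> carrier S \<Longrightarrow> is_pinv S s t \<Longrightarrow> s\<^sup>- = t"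
  unfolding pinv_def by (rule the1_equality [OF unique_pinv])

lemma pinv_closed [simp, intro]: "s \<in> carrier S \<Longrightarrow> s\<^sup>- \<in> carrier S"
  and mult_pinv_mult: "s \<in> carrier S \<Longrightarrow> s \<otimes> s\<^sup>- \<otimes> s = s"
  and pinv_mult_pinv: "s \<in> carrier S \<Longrightarrow> s\<^sup>- \<otimes> s \<otimes> s\<^sup>- = s\<^sup>-"
  using is_pinv_pinv unfolding is_pinv_def by auto

lemma pinv_pinv [simp]: "s \<in> carrier S \<Longrightarrow> (s\<^sup>-)\<^sup>- = s"
  by (rule pinv_eqI) (auto simp: is_pinv_def mult_pinv_mult pinv_mult_pinv)

lemma idem_closed: "e \<in> E \<Longrightarrow> e \<in> carrier S"
  by (simp add: idempotents_def)

lemma idem_idem: "e \<in> E \<Longrightarrow> e \<otimes> e = e"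
  by (simp add: idempotents_def)

lemma idemI: "e \<in> carrier S \<Longrightarrow> e \<otimes> e = e \<Longrightarrow> e \<in> E"
  by (simp add: idempotents_def)

declare idem_closed [simp, dest]

lemma pinv_idem: "e \<in> E \<Longrightarrow> e\<^sup>- = e"
  by (rule pinv_eqI) (auto simp: is_pinv_def idem_idem)

lemma idem_pinv_left [simp, intro]: "s \<in> carrier S \<Longrightarrow> s\<^sup>- \<otimes> s \<in> E"
  by (rule idemI) (simp_all add: pinv_mult_pinv m_assoc [symmetric])

lemma idem_pinv_right [simp, intro]: "s \<in> carrier S \<Longrightarrow> s \<otimes> s\<^sup>- \<in> E"
  by (rule idemI) (simp_all add: mult_pinv_mult m_assoc [symmetric])

lemma idem_one [simp, intro]: "\<one> \<in> E"
  by (rule idemI) auto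

text \<open>For idempotents \<open>e\<close>, \<open>f\<close> the element \<open>f \<otimes> (e \<otimes> f)\<^sup>- \<otimes> e\<close> is an idempotent inverse of
  \<open>e \<otimes> f\<close>.\<close>

lemma idem_mult [simp, intro]:
  assumes e: "e \<in> E" and f: "f \<in> E"
  shows "e \<otimes> f \<in> E"
proof -
  define x where "x = (e \<otimes> f)\<^sup>-"
  note c [simp] = idem_closed [OF e] idem_closed [OF f]
  have x [simp]: "x \<in> carrier S" by (simp add: x_def)
  have ee: "e \<otimes> (e \<otimes> y) = e \<otimes> y" and ff: "f \<otimes> (f \<otimes> y) = f \<otimes> y" if "y \<in> carrier S" for y
    using that e f by (simp_all add: idem_idem flip: m_assoc)
  have 1: "e \<otimes> (f \<otimes> (x \<otimes> (e \<otimes> f))) = e \<otimes> f"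
    using mult_pinv_mult [of "e \<otimes> f"] by (simp add: x_def m_assoc)
  have 2: "x \<otimes> (e \<otimes> (f \<otimes> x)) = x"
    using pinv_mult_pinv [of "e \<otimes> f"] by (simp add: x_def m_assoc)
  have two: "x \<otimes> (e \<otimes> (f \<otimes> (x \<otimes> y))) = x \<otimes> y" if "y \<in> carrier S" for y
    using arg_cong [OF 2, of "\<lambda>z. z \<otimes> y"] that by (simp add: m_assoc)
  have "is_pinv S (e \<otimes> f) (f \<otimes> x \<otimes> e)"
    by (simp add: is_pinv_def m_assoc ee ff 1 two)
  then have fxe: "x = f \<otimes> x \<otimes> e"
    unfolding x_def by (intro pinv_eqI) auto
  have "x \<otimes> x = (f \<otimes> x \<otimes> e) \<otimes> (f \<otimes> x \<otimes> e)"
    by (simp only: fxe [symmetric])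
  also have "\<dots> = f \<otimes> x \<otimes> e"
    by (simp add: m_assoc two)
  finally have "x \<otimes> x = x"
    by (simp only: fxe [symmetric])
  then have "x \<in> E" by (simp add: idemI)
  then have "x\<^sup>- = x" by (rule pinv_idem)
  then show ?thesis using \<open>x \<in> E\<close> by (simp add: x_def)
qed

text \<open>Both products are idempotent by \<open>idem_mult\<close>, so f e satisfies the equations
  of an inverse of e f. But an idempotent is its own inverse, and inverses are unique.\<close>

lemma idem_commute:
  assumes e: "e \<in> E" and f: "f \<in> E"
  shows "e \<otimes> f = f \<otimes> e"
proof -
  note c [simp] = idem_closed [OF e] idem_closed [OF f]
  have ee: "e \<otimes> (e \<otimes> y) = e \<otimes> y" and ff: "f \<otimes> (f \<otimes> y) = f \<otimes> y" if "y \<in> carrier S" for y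
    using that e f by (simp_all add: idem_idem flip: m_assoc)
  have 1: "e \<otimes> (f \<otimes> (e \<otimes> f)) = e \<otimes> f" and 2: "f \<otimes> (e \<otimes> (f \<otimes> e)) = f \<otimes> e"
    using idem_idem [OF idem_mult [OF e f]] idem_idem [OF idem_mult [OF f e]]
    by (simp_all add: m_assoc)
  have "(e \<otimes> f)\<^sup>- = f \<otimes> e"
    by (rule pinv_eqI) (auto simp: is_pinv_def m_assoc ee ff 1 2)
  with pinv_idem [OF idem_mult [OF e f]] show ?thesis by simp
qed

lemma pinv_mult:
  assumes [simp]: "s \<in> carrier S" "t \<in> carrier S"
  shows "(s \<otimes> t)\<^sup>- = t\<^sup>- \<otimes> s\<^sup>-"
proof (rule pinv_eqI)
  \<comment> \<open>After swapping these two idempotents, the factors s s^- s and t t^- t stand next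
    to each other and collapse.\<close>
  have c: "(t \<otimes> t\<^sup>-) \<otimes> (s\<^sup>- \<otimes> s) = (s\<^sup>- \<otimes> s) \<otimes> (t \<otimes> t\<^sup>-)"
    by (intro idem_commute idem_pinv_left idem_pinv_right) auto
  have "s \<otimes> t \<otimes> (t\<^sup>- \<otimes> s\<^sup>-) \<otimes> (s \<otimes> t) = s \<otimes> ((t \<otimes> t\<^sup>-) \<otimes> (s\<^sup>- \<otimes> s)) \<otimes> t"
    by (simp add: m_assoc)
  also have "\<dots> = (s \<otimes> s\<^sup>- \<otimes> s) \<otimes> (t \<otimes> t\<^sup>- \<otimes> t)"
    unfolding c by (simp add: m_assoc)
  finally have 1: "s \<otimes> t \<otimes> (t\<^sup>- \<otimes> s\<^sup>-) \<otimes> (s \<otimes> t) = s \<otimes> t"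
    by (simp add: mult_pinv_mult)
  have "t\<^sup>- \<otimes> s\<^sup>- \<otimes> (s \<otimes> t) \<otimes> (t\<^sup>- \<otimes> s\<^sup>-) = t\<^sup>- \<otimes> ((s\<^sup>- \<otimes> s) \<otimes> (t \<otimes> t\<^sup>-)) \<otimes> s\<^sup>-"
    by (simp add: m_assoc)
  also have "\<dots> = (t\<^sup>- \<otimes> t \<otimes> t\<^sup>-) \<otimes> (s\<^sup>- \<otimes> s \<otimes> s\<^sup>-)"
    unfolding c [symmetric] by (simp add: m_assoc)
  finally have 2: "t\<^sup>- \<otimes> s\<^sup>- \<otimes> (s \<otimes> t) \<otimes> (t\<^sup>- \<otimes> s\<^sup>-) = t\<^sup>- \<otimes> s\<^sup>-"
    by (simp add: pinv_mult_pinv)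
  from 1 2 show "is_pinv S (s \<otimes> t) (t\<^sup>- \<otimes> s\<^sup>-)"
    by (simp add: is_pinv_def)
qed auto

lemma idem_conj:
  assumes "e \<in> E" and [simp]: "s \<in> carrier S"
  shows "s \<otimes> e \<otimes> s\<^sup>- \<in> E"
proof (rule idemI)
  note [simp] = idem_closed [OF assms(1)]
  have "s \<otimes> e \<otimes> s\<^sup>- \<otimes> (s \<otimes> e \<otimes> s\<^sup>-) = s \<otimes> (e \<otimes> (s\<^sup>- \<otimes> s)) \<otimes> e \<otimes> s\<^sup>-"
    by (simp add: m_assoc)
  also have "\<dots> = (s \<otimes> s\<^sup>- \<otimes> s) \<otimes> (e \<otimes> e) \<otimes> s\<^sup>-"
    using idem_commute [OF assms(1) idem_pinv_left [of s]] by (simp add: m_assoc)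
  finally show "s \<otimes> e \<otimes> s\<^sup>- \<otimes> (s \<otimes> e \<otimes> s\<^sup>-) = s \<otimes> e \<otimes> s\<^sup>-"
    by (simp add: mult_pinv_mult idem_idem assms(1))
qed (use assms in auto)

subsection \<open>The natural partial order\<close>

lemma carrier_nat_order [simp]: "carrier (nat_order S) = carrier S"
  by (simp add: nat_order_def)

lemma eq_nat_order [simp]: "eq (nat_order S) = (=)"
  by (simp add: nat_order_def)

lemma leq_def: "s \<preceq> t \<longleftrightarrow> (\<exists>e\<in>E. s = t \<otimes> e)"
  by (simp add: nat_order_def)

lemma leqI: "e \<in> E \<Longrightarrow> s = t \<otimes> e \<Longrightarrow> s \<preceq> t"
  by (auto simp: leq_def)

text \<open>The order is defined by idempotents on the right. Since e t = t (t^- e t), an idempotent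
  can be moved across t; with \<open>leq_left\<close> the order becomes symmetric in the two
  sides.\<close>

lemma leqI_left:
  assumes "e \<in> E" "s = e \<otimes> t" and [simp]: "t \<in> carrier S"
  shows "s \<preceq> t"
proof (rule leqI)
  note [simp] = idem_closed [OF assms(1)]
  show "t\<^sup>- \<otimes> e \<otimes> t \<in> E" using idem_conj [of e "t\<^sup>-"] assms(1) by simp
  have "t \<otimes> (t\<^sup>- \<otimes> e \<otimes> t) = ((t \<otimes> t\<^sup>-) \<otimes> e) \<otimes> t" by (simp add: m_assoc)
  also have "(t \<otimes> t\<^sup>-) \<otimes> e = e \<otimes> (t \<otimes> t\<^sup>-)"
    by (rule idem_commute) (use assms in auto)
  also have "e \<otimes> (t \<otimes> t\<^sup>-) \<otimes> t = e \<otimes> (t \<otimes> t\<^sup>- \<otimes> t)" by (simp add: m_assoc)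
  finally show "s = t \<otimes> (t\<^sup>- \<otimes> e \<otimes> t)" by (simp add: mult_pinv_mult assms(2))
qed

lemma leq_left:
  assumes "s \<preceq> t" and [simp]: "t \<in> carrier S"
  shows "\<exists>e\<in>E. s = e \<otimes> t"
proof -
  from assms obtain e where e: "e \<in> E" "s = t \<otimes> e" by (auto simp: leq_def)
  note [simp] = idem_closed [OF e(1)]
  have "t \<otimes> e \<otimes> t\<^sup>- \<otimes> t = t \<otimes> (e \<otimes> (t\<^sup>- \<otimes> t))" by (simp add: m_assoc)
  also have "\<dots> = (t \<otimes> t\<^sup>- \<otimes> t) \<otimes> e"
    using idem_commute [OF e(1) idem_pinv_left [of t]] by (simp add: m_assoc)
  finally have "s = t \<otimes> e \<otimes> t\<^sup>- \<otimes> t" by (simp add: mult_pinv_mult e)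
  then show ?thesis using idem_conj [OF e(1)] by auto
qed

lemma leq_closed: "s \<preceq> t \<Longrightarrow> t \<in> carrier S \<Longrightarrow> s \<in> carrier S"
  by (auto simp: leq_def)

lemma leq_refl [simp, intro]: "s \<in> carrier S \<Longrightarrow> s \<preceq> s"
  by (rule leqI [of \<one>]) auto

lemma leq_trans:
  assumes "s \<preceq> t" "t \<preceq> u" "u \<in> carrier S"
  shows "s \<preceq> u"
proof -
  obtain e f where "e \<in> E" "s = t \<otimes> e" "f \<in> E" "t = u \<otimes> f"
    using assms by (auto simp: leq_def)
  then show ?thesis using assms(3) by (intro leqI [of "f \<otimes> e"]) (auto simp: m_assoc)
qed

lemma leq_antisym:
  assumes "s \<preceq> t" "t \<preceq> s" "s \<in> carrier S" "t \<in> carrier S"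
  shows "s = t"
proof -
  obtain e where e: "e \<in> E" "s = t \<otimes> e" using assms(1) by (auto simp: leq_def)
  obtain f where f: "f \<in> E" "t = s \<otimes> f" using assms(2) by (auto simp: leq_def)
  have "s \<otimes> e = s" using e assms by (simp add: m_assoc idem_idem)
  have "s = s \<otimes> f \<otimes> e" by (simp only: e(2) [symmetric] f(2) [symmetric])
  also have "\<dots> = s \<otimes> e \<otimes> f"
    using e f assms idem_commute [of e f] by (simp add: m_assoc)
  also have "\<dots> = t" by (simp only: \<open>s \<otimes> e = s\<close> f(2) [symmetric])
  finally show ?thesis .
qed

lemma mult_idem_leq [simp]: "e \<in> E \<Longrightarrow> s \<otimes> e \<preceq> s"
  by (rule leqI) auto

lemma idem_mult_leq [simp]: "e \<in> E \<Longrightarrow> s \<in> carrier S \<Longrightarrow> e \<otimes> s \<preceq> s"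
  by (rule leqI_left) auto

text \<open>Taking the idempotent of s on the left and that of t on the right keeps both at the
  outside of the product.\<close>

lemma mult_mono:
  assumes "s \<preceq> s'" "t \<preceq> t'" and [simp]: "s' \<in> carrier S" "t' \<in> carrier S"
  shows "s \<otimes> t \<preceq> s' \<otimes> t'"
proof -
  obtain e where e: "e \<in> E" "s = e \<otimes> s'" using leq_left [OF assms(1)] by auto
  obtain f where f: "f \<in> E" "t = t' \<otimes> f" using assms(2) by (auto simp: leq_def)
  note [simp] = idem_closed [OF e(1)] idem_closed [OF f(1)]
  have "s \<otimes> t = e \<otimes> (s' \<otimes> t' \<otimes> f)" using e f by (simp add: m_assoc)
  then have "s \<otimes> t \<preceq> s' \<otimes> t' \<otimes> f" using e by simp
  moreover have "s' \<otimes> t' \<otimes> f \<preceq> s' \<otimes> t'" using f by simp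
  ultimately show ?thesis by (rule leq_trans) auto
qed

lemma pinv_mono:
  assumes "s \<preceq> t" and [simp]: "t \<in> carrier S"
  shows "s\<^sup>- \<preceq> t\<^sup>-"
proof -
  obtain e where e: "e \<in> E" "s = t \<otimes> e" using assms(1) by (auto simp: leq_def)
  then show ?thesis using pinv_mult [of t e] by (simp add: pinv_idem)
qed

lemma pinv_leq_iff: "s \<in> carrier S \<Longrightarrow> t \<in> carrier S \<Longrightarrow> s\<^sup>- \<preceq> t\<^sup>- \<longleftrightarrow> s \<preceq> t"
  using pinv_mono [of s t] pinv_mono [of "s\<^sup>-" "t\<^sup>-"] by auto

lemma leq_idem: "s \<preceq> e \<Longrightarrow> e \<in> E \<Longrightarrow> s \<in> E"
  by (auto simp: leq_def)

text \<open>The idempotent in the definition of the order can always be chosen as s^- s. This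
  canonical choice recovers an element below t from its domain.\<close>

lemma leq_eq:
  assumes "s \<preceq> t" and [simp]: "t \<in> carrier S"
  shows "s = t \<otimes> (s\<^sup>- \<otimes> s)"
proof -
  obtain e where e: "e \<in> E" "s = t \<otimes> e" using assms(1) by (auto simp: leq_def)
  note [simp] = idem_closed [OF e(1)]
  have "t \<otimes> (s\<^sup>- \<otimes> s) = t \<otimes> (e \<otimes> (t\<^sup>- \<otimes> t)) \<otimes> e"
    using e by (simp add: pinv_mult pinv_idem m_assoc)
  also have "\<dots> = (t \<otimes> t\<^sup>- \<otimes> t) \<otimes> (e \<otimes> e)"
    using idem_commute [OF e(1) idem_pinv_left [of t]] by (simp add: m_assoc)
  finally show ?thesis using e by (simp add: mult_pinv_mult idem_idem)
qed

text \<open>For s and t below u, the products s^- t and s t^- lie below the idempotents u^- u and u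
  u^-, and everything below an idempotent is idempotent.\<close>

lemma compatible_bounded:
  assumes "\<And>a. a \<in> A \<Longrightarrow> a \<preceq> u" and u [simp]: "u \<in> carrier S"
  shows "compatible S A"
  unfolding compatible_def
proof (intro conjI ballI)
  show A: "A \<subseteq> carrier S" using assms leq_closed by blast
  fix s t assume "s \<in> A" "t \<in> A"
  then have st: "s \<preceq> u" "t \<preceq> u" and [simp]: "s \<in> carrier S" "t \<in> carrier S"
    using assms A by auto
  show "s\<^sup>- \<otimes> t \<in> E"
    using mult_mono [OF pinv_mono [OF st(1)] st(2)] leq_idem [OF _ idem_pinv_left [OF u]] by auto
  show "s \<otimes> t\<^sup>- \<in> E"
    using mult_mono [OF st(1) pinv_mono [OF st(2)]] leq_idem [OF _ idem_pinv_right [OF u]] by auto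
qed

sublocale nat: partial_order "nat_order S"
  by unfold_locales (auto intro: leq_antisym leq_trans)

end

section \<open>Groupoids and their bisections\<close>

lemma mem_gset_mult:
  "z \<in> gset_mult G A B \<longleftrightarrow> (\<exists>a\<in>A. \<exists>b\<in>B. (a, b) \<in> composable G \<and> z = gmult G a b)"
  by (auto simp: gset_mult_def)

lemma gset_multI:
  "\<lbrakk>a \<in> A; b \<in> B; (a, b) \<in> composable G; z = gmult G a b\<rbrakk> \<Longrightarrow> z \<in> gset_mult G A B"
  by (auto simp: gset_mult_def)

lemma gset_mult_mono: "A \<subseteq> A' \<Longrightarrow> B \<subseteq> B' \<Longrightarrow> gset_mult G A B \<subseteq> gset_mult G A' B'"
  by (auto simp: gset_mult_def)

context groupoid
begin

abbreviation mul (infixl "\<cdot>" 70) where "x \<cdot> y \<equiv> gmult G x y"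

lemma composable_iff:
  "(x, y) \<in> composable G \<longleftrightarrow> x \<in> carrier G \<and> y \<in> carrier G \<and> gdom G x = gcod G y"
  by (simp add: composable_def)

lemmas groupoid_simps = gdom_in gcod_in gdom_gdom gcod_gdom gdom_gcod gcod_gcod gmult_in gdom_gmult
  gcod_gmult gmult_gdom gcod_gmult_left ginv_in gdom_ginv gcod_ginv ginv_gmult gmult_ginv

lemma ginv_gmult_cancel:
  "\<lbrakk>x \<in> carrier G; y \<in> carrier G; gdom G x = gcod G y\<rbrakk> \<Longrightarrow> ginv G x \<cdot> (x \<cdot> y) = y"
  using gmult_assoc [of "ginv G x" x y] by (simp add: groupoid_simps)

lemma gmult_ginv_cancel:
  "\<lbrakk>x \<in> carrier G; y \<in> carrier G; gdom G x = gcod G y\<rbrakk> \<Longrightarrow> x \<cdot> y \<cdot> ginv G y = x"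
  using gmult_assoc [of x y "ginv G y"] gmult_gdom [of x] by (simp add: groupoid_simps)

lemma gmult_ginv_cancel':
  "\<lbrakk>x \<in> carrier G; y \<in> carrier G; gdom G x = gdom G y\<rbrakk> \<Longrightarrow> x \<cdot> ginv G y \<cdot> y = x"
  using gmult_assoc [of x "ginv G y" y] gmult_gdom [of x] by (simp add: groupoid_simps)

lemma ginv_gmult_cancel':
  "\<lbrakk>x \<in> carrier G; y \<in> carrier G; gcod G x = gcod G y\<rbrakk> \<Longrightarrow> x \<cdot> (ginv G x \<cdot> y) = y"
  using gmult_assoc [of x "ginv G x" y] by (simp add: groupoid_simps)

lemma ginv_ginv [simp]: "x \<in> carrier G \<Longrightarrow> ginv G (ginv G x) = x"
  using ginv_gmult_cancel [of "ginv G x" x] gmult_gdom [of "ginv G (ginv G x)"]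
  by (simp add: groupoid_simps)

lemma identitiesD:
  assumes "e \<in> identities G"
  shows "e \<in> carrier G" "gdom G e = e" "gcod G e = e" "e \<cdot> e = e" "ginv G e = e"
proof -
  show *: "e \<in> carrier G" "gdom G e = e" using assms by (auto simp: identities_def)
  then show **: "gcod G e = e" using gcod_gdom by metis
  show "e \<cdot> e = e" using gmult_gdom * by metis
  show "ginv G e = e"
    using gmult_ginv [of e] gcod_gmult_left [of "ginv G e"] * ** by (simp add: groupoid_simps)
qed

lemma gdom_identities [simp]: "x \<in> carrier G \<Longrightarrow> gdom G x \<in> identities G"
  and gcod_identities [simp]: "x \<in> carrier G \<Longrightarrow> gcod G x \<in> identities G"
  by (auto simp: identities_def groupoid_simps)

lemma ginv_gmult_eq_iff:
  assumes "x \<in> carrier G" "y \<in> carrier G" "gcod G x = gcod G y"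
  shows "ginv G x \<cdot> y \<in> identities G \<longleftrightarrow> x = y"
proof
  assume "ginv G x \<cdot> y \<in> identities G"
  then have "ginv G x \<cdot> y = gcod G (ginv G x \<cdot> y)" by (simp add: identitiesD)
  also have "\<dots> = gdom G x" using assms by (simp add: groupoid_simps)
  finally have "x \<cdot> (ginv G x \<cdot> y) = x" using assms by (simp add: groupoid_simps)
  then show "x = y" using ginv_gmult_cancel' assms by simp
qed (use assms in \<open>simp add: ginv_gmult\<close>)

lemma gmult_ginv_eq_iff:
  assumes "x \<in> carrier G" "y \<in> carrier G" "gdom G x = gdom G y"
  shows "x \<cdot> ginv G y \<in> identities G \<longleftrightarrow> x = y"
proof
  assume "x \<cdot> ginv G y \<in> identities G"
  then have "x \<cdot> ginv G y = gdom G (x \<cdot> ginv G y)" by (simp add: identitiesD)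
  also have "\<dots> = gcod G y" using assms by (simp add: groupoid_simps)
  finally have "x \<cdot> ginv G y \<cdot> y = y" using assms by (simp add: groupoid_simps)
  then show "x = y" using gmult_ginv_cancel' assms by simp
qed (use assms in \<open>simp add: gmult_ginv\<close>)

text \<open>The elements of A^{-1} A are the products x^{-1} y with r(x) = r(y), and such a product
  is an identity only for x = y; likewise for A A^{-1} with domains. Most arguments about bisections
  use this form.\<close>

lemma bisection_iff:
  "bisection G A \<longleftrightarrow> A \<subseteq> carrier G \<and> inj_on (gdom G) A \<and> inj_on (gcod G) A"
proof (cases "A \<subseteq> carrier G")
  case True
  then have c: "a \<in> carrier G" if "a \<in> A" for a using that by blast
  have "gset_mult G (ginv G ` A) A \<subseteq> identities G \<longleftrightarrow>
      (\<forall>a\<in>A. \<forall>b\<in>A. gcod G a = gcod G b \<longrightarrow> ginv G a \<cdot> b \<in> identities G)"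
    by (auto simp: mem_gset_mult subset_iff composable_iff groupoid_simps c)
  also have "\<dots> \<longleftrightarrow> inj_on (gcod G) A"
    by (simp add: inj_on_def ginv_gmult_eq_iff c cong: imp_cong)
  finally have 1: "gset_mult G (ginv G ` A) A \<subseteq> identities G \<longleftrightarrow> inj_on (gcod G) A" .
  have "gset_mult G A (ginv G ` A) \<subseteq> identities G \<longleftrightarrow>
      (\<forall>a\<in>A. \<forall>b\<in>A. gdom G a = gdom G b \<longrightarrow> a \<cdot> ginv G b \<in> identities G)"
    by (auto simp: mem_gset_mult subset_iff composable_iff groupoid_simps c)
  also have "\<dots> \<longleftrightarrow> inj_on (gdom G) A"
    by (simp add: inj_on_def gmult_ginv_eq_iff c cong: imp_cong)
  finally show ?thesis using 1 True by (auto simp: bisection_def)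
qed (simp add: bisection_def)

lemma bisection_subset: "bisection G A \<Longrightarrow> B \<subseteq> A \<Longrightarrow> bisection G B"
  by (auto simp: bisection_iff intro: inj_on_subset)

lemma bisection_carrier: "bisection G A \<Longrightarrow> a \<in> A \<Longrightarrow> a \<in> carrier G"
  by (auto simp: bisection_iff)

lemma bisection_gdom_eq: "\<lbrakk>bisection G A; a \<in> A; b \<in> A; gdom G a = gdom G b\<rbrakk> \<Longrightarrow> a = b"
  by (auto simp: bisection_iff dest: inj_onD)

lemma bisection_gcod_eq: "\<lbrakk>bisection G A; a \<in> A; b \<in> A; gcod G a = gcod G b\<rbrakk> \<Longrightarrow> a = b"
  by (auto simp: bisection_iff dest: inj_onD)

lemma bisection_identities: "A \<subseteq> identities G \<Longrightarrow> bisection G A"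
  unfolding bisection_iff inj_on_def by (metis identitiesD(1-3) subset_eq)

lemma bisection_ginv: "bisection G A \<Longrightarrow> bisection G (ginv G ` A)"
  unfolding bisection_iff inj_on_def by (auto simp: groupoid_simps subset_iff)

lemma bisection_gset_mult:
  assumes A: "bisection G A" and B: "bisection G B"
  shows "bisection G (gset_mult G A B)"
  unfolding bisection_iff
proof (intro conjI inj_onI)
  show "gset_mult G A B \<subseteq> carrier G"
    by (auto simp: mem_gset_mult composable_iff gmult_in)
next
  fix x y
  assume "x \<in> gset_mult G A B" "y \<in> gset_mult G A B"
  then obtain a b a' b' where ab: "a \<in> A" "b \<in> B" "a' \<in> A" "b' \<in> B"
    "(a, b) \<in> composable G" "(a', b') \<in> composable G" "x = a \<cdot> b" "y = a' \<cdot> b'"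
    by (auto simp: mem_gset_mult)
  then have d: "gdom G x = gdom G b" "gdom G y = gdom G b'" "gdom G a = gcod G b" "gdom G a' = gcod G b'"
    and r: "gcod G x = gcod G a" "gcod G y = gcod G a'"
    by (auto simp: composable_iff groupoid_simps)
  {
    assume "gdom G x = gdom G y"
    then have "b = b'"
      using ab d bisection_gdom_eq [OF B] by metis
    then have "a = a'"
      using ab d bisection_gdom_eq [OF A] by metis
    with \<open>b = b'\<close> ab show "x = y" by simp
  next
    assume "gcod G x = gcod G y"
    then have "a = a'"
      using ab d r bisection_gcod_eq [OF A] by metis
    then have "b = b'"
      using ab d r bisection_gcod_eq [OF B] by metis
    with \<open>a = a'\<close> ab show "x = y" by simp
  }
qed

section \<open>Products of bisections\<close>

lemma gset_mult_assoc:
  "gset_mult G (gset_mult G A B) C = gset_mult G A (gset_mult G B C)"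
proof (intro equalityI subsetI)
  fix z assume "z \<in> gset_mult G (gset_mult G A B) C"
  then obtain a b c where "a \<in> A" "b \<in> B" "c \<in> C" "(a, b) \<in> composable G"
    "(a \<cdot> b, c) \<in> composable G" "z = a \<cdot> b \<cdot> c"
    by (auto simp: mem_gset_mult)
  then show "z \<in> gset_mult G A (gset_mult G B C)"
    by (intro gset_multI [of a A "b \<cdot> c" "gset_mult G B C"])
      (auto simp: composable_iff groupoid_simps gmult_assoc intro: gset_multI [of b B c C])
next
  fix z assume "z \<in> gset_mult G A (gset_mult G B C)"
  then obtain a b c where "a \<in> A" "b \<in> B" "c \<in> C" "(b, c) \<in> composable G"
    "(a, b \<cdot> c) \<in> composable G" "z = a \<cdot> (b \<cdot> c)"
    by (auto simp: mem_gset_mult)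
  then show "z \<in> gset_mult G (gset_mult G A B) C"
    by (intro gset_multI [of "a \<cdot> b" "gset_mult G A B" c C])
      (auto simp: composable_iff groupoid_simps gmult_assoc intro: gset_multI [of a A b B])
qed

lemma gset_mult_identities_right:
  assumes "A \<subseteq> carrier G"
  shows "gset_mult G A (identities G) = A"
proof (intro equalityI subsetI)
  fix a assume "a \<in> A"
  with assms have "a \<in> carrier G" by blast
  with \<open>a \<in> A\<close> show "a \<in> gset_mult G A (identities G)"
    by (intro gset_multI [of a _ "gdom G a"]) (auto simp: composable_iff groupoid_simps)
next
  fix z assume "z \<in> gset_mult G A (identities G)"
  then obtain a e where "a \<in> A" "a \<in> carrier G" "e \<in> identities G" "gdom G a = gcod G e" "z = a \<cdot> e"
    by (auto simp: mem_gset_mult composable_iff)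
  then show "z \<in> A" by (metis gmult_gdom identitiesD(3))
qed

lemma gset_mult_identities_left:
  assumes "A \<subseteq> carrier G"
  shows "gset_mult G (identities G) A = A"
proof (intro equalityI subsetI)
  fix a assume "a \<in> A"
  with assms have "a \<in> carrier G" by blast
  with \<open>a \<in> A\<close> show "a \<in> gset_mult G (identities G) A"
    by (intro gset_multI [of "gcod G a" _ a]) (auto simp: composable_iff groupoid_simps)
next
  fix z assume "z \<in> gset_mult G (identities G) A"
  then obtain a e where "a \<in> A" "a \<in> carrier G" "e \<in> identities G" "gdom G e = gcod G a" "z = e \<cdot> a"
    by (auto simp: mem_gset_mult composable_iff)
  then show "z \<in> A" by (metis gcod_gmult_left identitiesD(2))
qed

text \<open>If g = u a with u in U, then g and u have the same range, so u = g and a = d(g). This is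
  how the domain of an arrow is read off from products of bisections.\<close>

lemma mem_gset_mult_left_bisection:
  assumes "bisection G U" "g \<in> U"
  shows "g \<in> gset_mult G U A \<longleftrightarrow> gdom G g \<in> A"
proof
  have g: "g \<in> carrier G" using assms bisection_carrier by blast
  assume "g \<in> gset_mult G U A"
  then obtain u a where ua: "u \<in> U" "a \<in> A" "(u, a) \<in> composable G" "g = u \<cdot> a"
    by (auto simp: mem_gset_mult)
  then have "g = u"
    using assms(2) bisection_gcod_eq [OF assms(1), of g u]
    by (auto simp: assms composable_iff groupoid_simps)
  moreover have "ginv G u \<cdot> (u \<cdot> a) = a"
    using ua by (intro ginv_gmult_cancel) (auto simp: composable_iff)
  ultimately have "a = gdom G g" using ua(4) g ginv_gmult by metis
  then show "gdom G g \<in> A" using ua(2) by simp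
next
  assume "gdom G g \<in> A"
  then show "g \<in> gset_mult G U A"
    using assms bisection_carrier [OF assms]
    by (intro gset_multI [of g _ "gdom G g"])
      (auto simp: composable_iff groupoid_simps)
qed

lemma mem_gset_mult_right_bisection:
  assumes "bisection G U" "g \<in> U"
  shows "g \<in> gset_mult G A U \<longleftrightarrow> gcod G g \<in> A"
proof
  have g: "g \<in> carrier G" using assms bisection_carrier by blast
  assume "g \<in> gset_mult G A U"
  then obtain u a where ua: "u \<in> U" "a \<in> A" "(a, u) \<in> composable G" "g = a \<cdot> u"
    by (auto simp: mem_gset_mult)
  then have "g = u"
    using assms(2) bisection_gdom_eq [OF assms(1), of g u]
    by (auto simp: assms composable_iff groupoid_simps)
  moreover have "a \<cdot> u \<cdot> ginv G u = a"
    using ua by (intro gmult_ginv_cancel) (auto simp: composable_iff)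
  ultimately have "a = gcod G g" using ua(4) g gmult_ginv by metis
  then show "gcod G g \<in> A" using ua(2) by simp
next
  assume "gcod G g \<in> A"
  then show "g \<in> gset_mult G A U"
    using assms bisection_carrier [OF assms]
    by (intro gset_multI [of "gcod G g" _ g])
      (auto simp: composable_iff groupoid_simps)
qed

text \<open>If k = u^{-1} a with u in U, then d(u) = r(k) = d(g) forces u = g. Membership of a
  product thus becomes a condition on its right factor; this serves both for continuity of
  multiplication and for the multiplicativity of \<alpha>.\<close>

lemma mem_gset_mult_ginv:
  assumes "bisection G U" "g \<in> U" "A \<subseteq> carrier G" "(g, k) \<in> composable G"
  shows "k \<in> gset_mult G (ginv G ` U) A \<longleftrightarrow> g \<cdot> k \<in> A"
proof
  assume "k \<in> gset_mult G (ginv G ` U) A"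
  then obtain u a where ua: "u \<in> U" "a \<in> A" "(ginv G u, a) \<in> composable G" "k = ginv G u \<cdot> a"
    by (auto simp: mem_gset_mult)
  moreover have u: "u \<in> carrier G" using ua assms bisection_carrier by blast
  ultimately have "g = u"
    using assms(4) bisection_gdom_eq [OF assms(1), of g u]
    by (auto simp: assms composable_iff groupoid_simps)
  then have "g \<cdot> k = a"
    using ua u ginv_gmult_cancel' [of u a] by (simp add: composable_iff groupoid_simps)
  with ua show "g \<cdot> k \<in> A" by simp
next
  assume "g \<cdot> k \<in> A"
  then show "k \<in> gset_mult G (ginv G ` U) A"
    using assms
    by (intro gset_multI [of "ginv G g" _ "g \<cdot> k"])
      (auto simp: composable_iff groupoid_simps ginv_gmult_cancel)
qed

lemma gset_mult_ginv_self:
  assumes "bisection G A"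
  shows "gset_mult G (ginv G ` A) A = gdom G ` A" "gset_mult G A (ginv G ` A) = gcod G ` A"
proof -
  have A: "a \<in> carrier G" if "a \<in> A" for a using bisection_carrier assms that by blast
  show "gset_mult G (ginv G ` A) A = gdom G ` A"
  proof (intro equalityI subsetI)
    fix z assume "z \<in> gset_mult G (ginv G ` A) A"
    then obtain a b where ab: "a \<in> A" "b \<in> A" "gcod G a = gcod G b" "z = ginv G a \<cdot> b"
      by (auto simp: mem_gset_mult composable_iff groupoid_simps A)
    with bisection_gcod_eq [OF assms] have "a = b" by blast
    with ab show "z \<in> gdom G ` A" by (simp add: ginv_gmult A)
  qed (auto simp: composable_iff groupoid_simps A intro!: gset_multI)
  show "gset_mult G A (ginv G ` A) = gcod G ` A"
  proof (intro equalityI subsetI)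
    fix z assume "z \<in> gset_mult G A (ginv G ` A)"
    then obtain a b where ab: "a \<in> A" "b \<in> A" "gdom G a = gdom G b" "z = a \<cdot> ginv G b"
      by (auto simp: mem_gset_mult composable_iff groupoid_simps A)
    with bisection_gdom_eq [OF assms] have "a = b" by blast
    with ab show "z \<in> gcod G ` A" by (simp add: gmult_ginv A)
  qed (auto simp: composable_iff groupoid_simps A intro!: gset_multI)
qed

lemma image_ginv_ginv: "A \<subseteq> carrier G \<Longrightarrow> ginv G ` ginv G ` A = A"
  by (force simp: image_iff subset_iff)

text \<open>An element b of B can be multiplied by d(a) only if d(b) = d(a), which means b = a. This
  is the set version of \<open>leq_eq\<close>.\<close>

lemma bisection_times_gdom:
  assumes "bisection G B" "A \<subseteq> B"
  shows "gset_mult G B (gdom G ` A) = A"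
proof (intro equalityI subsetI)
  fix z assume "z \<in> gset_mult G B (gdom G ` A)"
  then obtain b a where z: "b \<in> B" "a \<in> A" "b \<in> carrier G" "gdom G b = gcod G (gdom G a)"
      "z = b \<cdot> gdom G a"
    by (auto simp: mem_gset_mult composable_iff)
  moreover have "a \<in> carrier G" using z assms bisection_carrier by blast
  ultimately have *: "gdom G b = gdom G a" by (simp add: gcod_gdom)
  then have "b = a" using assms z bisection_gdom_eq by blast
  with z * show "z \<in> A" by (simp add: gmult_gdom)
next
  fix a assume a: "a \<in> A"
  then have "a \<in> carrier G" using assms bisection_carrier by blast
  with a show "a \<in> gset_mult G B (gdom G ` A)"
    using assms by (intro gset_multI [of a _ "gdom G a"]) (auto simp: composable_iff groupoid_simps)
qed

section \<open>Inverses and idempotents among bisections\<close>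

lemma gset_mult_cancel:
  assumes "bisection G A"
  shows "gset_mult G (gset_mult G A (ginv G ` A)) A = A"
  unfolding gset_mult_assoc gset_mult_ginv_self(1) [OF assms]
  using assms by (intro bisection_times_gdom) auto

text \<open>Write a in A as b t c. Comparing ranges and domains gives b = a = c, so a t a = a and
  hence t = a^{-1}.\<close>

lemma ginv_image_subset_if_cancel:
  assumes A: "bisection G A" and eq: "gset_mult G (gset_mult G A T) A = A"
  shows "ginv G ` A \<subseteq> T"
proof clarify
  fix a assume a: "a \<in> A"
  then have "a \<in> gset_mult G (gset_mult G A T) A" using eq by simp
  then obtain b t c where b: "b \<in> A" "t \<in> T" "c \<in> A" "(b, t) \<in> composable G"
      "(b \<cdot> t, c) \<in> composable G" "a = b \<cdot> t \<cdot> c"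
    by (auto simp: mem_gset_mult)
  then have bt: "b \<in> carrier G" "t \<in> carrier G" "c \<in> carrier G" "gdom G b = gcod G t" "gdom G t = gcod G c"
    by (auto simp: composable_iff groupoid_simps)
  then have "gcod G a = gcod G b" "gdom G a = gdom G c"
    using b by (auto simp: groupoid_simps)
  then have "a = b" "a = c"
    using a b bisection_gcod_eq [OF A] bisection_gdom_eq [OF A] by metis+
  then have abc: "b = a" "c = a" by simp_all
  have "a \<cdot> t \<cdot> a \<cdot> ginv G a = a \<cdot> t"
    using bt unfolding abc by (intro gmult_ginv_cancel) (simp_all add: groupoid_simps)
  moreover have "a \<cdot> t \<cdot> a = a" using b(6) abc by simp
  ultimately have "a \<cdot> t = gcod G a" using bt(1) abc gmult_ginv by metis
  moreover have "ginv G a \<cdot> (a \<cdot> t) = t" using bt abc by (intro ginv_gmult_cancel) auto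
  moreover have "ginv G a \<cdot> gcod G a = ginv G a"
    using bt(1) abc gmult_gdom [of "ginv G a"] by (simp add: groupoid_simps)
  ultimately show "ginv G a \<in> T" using b(2) by metis
qed

text \<open>Each of the two equations yields one inclusion by the preceding lemma. The inverse in
  the sense of inverse semigroups is therefore the pointwise inverse, which also settles its
  uniqueness.\<close>

lemma eq_ginv_image_iff:
  assumes A: "bisection G A" and T: "bisection G T"
  shows "T = ginv G ` A \<longleftrightarrow>
    gset_mult G (gset_mult G A T) A = A \<and> gset_mult G (gset_mult G T A) T = T"
proof
  have sub: "A \<subseteq> carrier G" "T \<subseteq> carrier G" using A T by (auto simp: bisection_iff)
  {
    assume "T = ginv G ` A"
    then show "gset_mult G (gset_mult G A T) A = A \<and> gset_mult G (gset_mult G T A) T = T"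
      using gset_mult_cancel [OF A] gset_mult_cancel [OF T] image_ginv_ginv [OF sub(1)] by simp
  next
    assume "gset_mult G (gset_mult G A T) A = A \<and> gset_mult G (gset_mult G T A) T = T"
    then have *: "ginv G ` A \<subseteq> T" "ginv G ` T \<subseteq> A"
      using ginv_image_subset_if_cancel [OF A] ginv_image_subset_if_cancel [OF T] by auto
    have "T \<subseteq> ginv G ` A"
      using image_mono [OF *(2), of "ginv G"] by (simp only: image_ginv_ginv [OF sub(2)])
    with *(1) show "T = ginv G ` A" by simp
  }
qed

text \<open>If A A = A, then d(x) lies in A for each x in A; as x and d(x) have the same domain,
  they coincide.\<close>

lemma idempotent_bisection_iff:
  assumes "bisection G A"
  shows "gset_mult G A A = A \<longleftrightarrow> A \<subseteq> identities G"
proof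
  assume eq: "gset_mult G A A = A"
  show "A \<subseteq> identities G"
  proof
    fix x assume x: "x \<in> A"
    then have "gdom G x \<in> A" using mem_gset_mult_left_bisection [OF assms x, of A] eq by simp
    then have "gdom G x = x"
      using bisection_gdom_eq [OF assms _ x] bisection_carrier [OF assms x] by (simp add: gdom_gdom)
    then show "x \<in> identities G" using bisection_carrier [OF assms x] by (simp add: identities_def)
  qed
next
  assume A: "A \<subseteq> identities G"
  then have "gdom G ` A = A" by (force simp: image_iff identitiesD)
  then show "gset_mult G A A = A" using bisection_times_gdom [OF assms, of A] by simp
qed

end

text \<open>A functor is only required to respect d, r and products. Inverses follow by cancelling
  \<alpha>(x) from the image of x x^{-1} = r(x).\<close>

lemma (in groupoid) groupoid_functor_ginv:
  assumes "groupoid H" "groupoid_functor G H \<alpha>" "x \<in> carrier G"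
  shows "\<alpha> (ginv G x) = ginv H (\<alpha> x)"
proof -
  interpret H: groupoid H by fact
  have \<alpha>: "\<alpha> y \<in> carrier H" "gdom H (\<alpha> y) = \<alpha> (gdom G y)" "gcod H (\<alpha> y) = \<alpha> (gcod G y)"
    if "y \<in> carrier G" for y
    using assms(2) that by (auto simp: groupoid_functor_def)
  have "(x, ginv G x) \<in> composable G"
    using assms(3) by (simp add: composable_iff groupoid_simps)
  with assms(2) have "\<alpha> (x \<cdot> ginv G x) = gmult H (\<alpha> x) (\<alpha> (ginv G x))"
    by (auto simp: groupoid_functor_def)
  then have "gmult H (\<alpha> x) (\<alpha> (ginv G x)) = gcod H (\<alpha> x)"
    using assms(3) \<alpha>(3) [of x] by (simp add: gmult_ginv)
  moreover have "gmult H (ginv H (\<alpha> x)) (gmult H (\<alpha> x) (\<alpha> (ginv G x))) = \<alpha> (ginv G x)"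
    using assms(3) by (intro H.ginv_gmult_cancel) (auto simp: groupoid_simps \<alpha>)
  ultimately show ?thesis
    using H.gmult_gdom [of "ginv H (\<alpha> x)"] assms(3) \<alpha>(1)
    by (simp add: H.groupoid_simps)
qed

section \<open>Etale groupoids\<close>

context topological_groupoid
begin

lemma openin_carrier: "openin (gtop G) A \<Longrightarrow> a \<in> A \<Longrightarrow> a \<in> carrier G"
  using openin_subset topspace_gtop by blast

lemma continuous_gmult_comp:
  assumes "continuous_map X (gtop G) f" "continuous_map X (gtop G) g"
    and "\<And>x. x \<in> topspace X \<Longrightarrow> gdom G (f x) = gcod G (g x)"
  shows "continuous_map X (gtop G) (\<lambda>x. f x \<cdot> g x)"
proof -
  have "f x \<in> carrier G" "g x \<in> carrier G" if "x \<in> topspace X" for x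
    using that assms(1,2) by (auto simp: continuous_map_def topspace_gtop)
  then have "continuous_map X (subtopology (prod_topology (gtop G) (gtop G)) (composable G))
      (\<lambda>x. (f x, g x))"
    using assms by (auto simp: continuous_map_in_subtopology composable_iff continuous_map_pairedI)
  from continuous_map_compose [OF this continuous_gmult] show ?thesis
    by (simp add: o_def)
qed

lemma continuous_gdom: "continuous_map (gtop G) (gtop G) (gdom G)"
proof -
  have "continuous_map (gtop G) (gtop G) (\<lambda>x. ginv G x \<cdot> x)"
    by (intro continuous_gmult_comp continuous_ginv)
      (auto simp: topspace_gtop groupoid_simps continuous_map_id [unfolded id_def])
  then show ?thesis
    by (rule continuous_map_eq) (simp add: topspace_gtop ginv_gmult)
qed

lemma openin_ginv_image:
  assumes "openin (gtop G) A"
  shows "openin (gtop G) (ginv G ` A)"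
proof -
  have "ginv G ` A = {x \<in> topspace (gtop G). ginv G x \<in> A}"
    using openin_carrier [OF assms] by (force simp: topspace_gtop image_iff ginv_in)
  then show ?thesis
    using openin_continuous_map_preimage [OF continuous_ginv assms] by simp
qed

end

context etale_groupoid
begin

lemma local_homeo_gdomE:
  assumes "x \<in> carrier G"
  obtains U where "openin (gtop G) U" "x \<in> U"
    "openin (subtopology (gtop G) (identities G)) (gdom G ` U)"
    "homeomorphic_map (subtopology (gtop G) U)
      (subtopology (subtopology (gtop G) (identities G)) (gdom G ` U)) (gdom G)"
  using assms local_homeo_gdom unfolding local_homeomorphism_def topspace_gtop by blast

lemma local_homeo_gdom_inj:
  assumes "openin (gtop G) U"
    "homeomorphic_map (subtopology (gtop G) U)
      (subtopology (subtopology (gtop G) (identities G)) (gdom G ` U)) (gdom G)"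
  shows "inj_on (gdom G) U"
  using homeomorphic_imp_injective_map [OF assms(2)] openin_subset [OF assms(1)]
  by (simp add: Int_absorb1)

text \<open>Near an identity choose an open U on which d is injective. If x and d(x) both lie in U,
  they have the same domain, so x = d(x); and both memberships are open conditions.\<close>

lemma openin_identities: "openin (gtop G) (identities G)"
proof (subst openin_subopen, intro ballI)
  fix e assume e: "e \<in> identities G"
  obtain U where U: "openin (gtop G) U" "e \<in> U"
    "homeomorphic_map (subtopology (gtop G) U)
      (subtopology (subtopology (gtop G) (identities G)) (gdom G ` U)) (gdom G)"
    using local_homeo_gdomE identitiesD(1) [OF e] by metis
  define W where "W = U \<inter> {x \<in> topspace (gtop G). gdom G x \<in> U}"
  have "openin (gtop G) W"
    unfolding W_def using U(1) openin_continuous_map_preimage [OF continuous_gdom] by blast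
  moreover have "e \<in> W"
    using U(2) identitiesD [OF e] by (simp add: W_def topspace_gtop)
  moreover have "W \<subseteq> identities G"
  proof
    fix x assume "x \<in> W"
    then have x: "x \<in> U" "gdom G x \<in> U" "x \<in> carrier G" by (auto simp: W_def topspace_gtop)
    then have "gdom G x = x"
      using inj_onD [OF local_homeo_gdom_inj [OF U(1,3)], of "gdom G x" x] gdom_gdom by simp
    with x show "x \<in> identities G" by (simp add: identities_def)
  qed
  ultimately show "\<exists>T. openin (gtop G) T \<and> e \<in> T \<and> T \<subseteq> identities G" by blast
qed

text \<open>A local homeomorphism is locally open onto the space of identities, and that space is
  itself open in G.\<close>

lemma openin_gdom_image:
  assumes "openin (gtop G) A"
  shows "openin (gtop G) (gdom G ` A)"
proof (subst openin_subopen, intro ballI)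
  fix y assume "y \<in> gdom G ` A"
  then obtain x where x: "x \<in> A" "y = gdom G x" "x \<in> carrier G"
    using openin_carrier [OF assms] by blast
  obtain U where U: "openin (gtop G) U" "x \<in> U"
    "openin (subtopology (gtop G) (identities G)) (gdom G ` U)"
    "homeomorphic_map (subtopology (gtop G) U)
      (subtopology (subtopology (gtop G) (identities G)) (gdom G ` U)) (gdom G)"
    using local_homeo_gdomE x(3) by metis
  have "openin (subtopology (gtop G) U) (A \<inter> U)"
    using assms by (rule openin_subtopology_Int)
  then have "openin (subtopology (subtopology (gtop G) (identities G)) (gdom G ` U)) (gdom G ` (A \<inter> U))"
    using homeomorphic_imp_open_map [OF U(4)] by (simp add: open_map_def)
  then have "openin (gtop G) (gdom G ` (A \<inter> U))"
    using U(3) openin_trans_full openin_identities by blast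
  then show "\<exists>T. openin (gtop G) T \<and> y \<in> T \<and> T \<subseteq> gdom G ` A"
    using x U(2) by (intro exI [of _ "gdom G ` (A \<inter> U)"]) auto
qed

text \<open>The domain map is injective near x. The range map is inversion followed by d, so it is
  injective on the arrows whose inverse lies in a neighbourhood of x^{-1} on which d is
  injective.\<close>

lemma open_bisections_basis:
  assumes "openin (gtop G) U" "x \<in> U"
  obtains A where "A \<in> open_bisections G" "x \<in> A" "A \<subseteq> U"
proof -
  have x: "x \<in> carrier G" using assms openin_carrier by blast
  obtain V where V: "openin (gtop G) V" "x \<in> V" "inj_on (gdom G) V"
    using local_homeo_gdomE [OF x] local_homeo_gdom_inj by metis
  obtain W where W: "openin (gtop G) W" "ginv G x \<in> W" "inj_on (gdom G) W"
    using local_homeo_gdomE [OF ginv_in [OF x]] local_homeo_gdom_inj by metis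
  define A where "A = U \<inter> V \<inter> {y \<in> topspace (gtop G). ginv G y \<in> W}"
  have "openin (gtop G) A"
    unfolding A_def using assms(1) V(1) openin_continuous_map_preimage [OF continuous_ginv W(1)]
    by blast
  moreover have "inj_on (gcod G) A"
  proof (rule inj_onI)
    fix y z assume yz: "y \<in> A" "z \<in> A" "gcod G y = gcod G z"
    then have *: "y \<in> carrier G" "z \<in> carrier G" "ginv G y \<in> W" "ginv G z \<in> W"
      by (auto simp: A_def topspace_gtop)
    then have "ginv G y = ginv G z"
      using inj_onD [OF W(3)] yz(3) by (simp add: gdom_ginv)
    then show "y = z" using * by (metis ginv_ginv)
  qed
  moreover have "inj_on (gdom G) A"
    using V(3) by (rule inj_on_subset) (auto simp: A_def)
  ultimately have "A \<in> open_bisections G"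
    using openin_carrier by (auto simp: open_bisections_def bisection_iff)
  moreover have "x \<in> A" "A \<subseteq> U"
    using assms x V(2) W(2) by (auto simp: A_def topspace_gtop)
  ultimately show thesis using that by blast
qed

text \<open>Near a product \<open>x \<cdot> y\<close> one recovers the left factor of \<open>z\<close> as \<open>z \<cdot> b\<inverse>\<close>, where
  \<open>b\<close> is an element near \<open>y\<close> with the same domain as \<open>z\<close>; such a \<open>b\<close> exists because the domain map
  is open.\<close>

lemma openin_gset_mult:
  assumes A: "openin (gtop G) A" and B: "openin (gtop G) B"
  shows "openin (gtop G) (gset_mult G A B)"
proof (subst openin_subopen, intro ballI)
  fix w assume "w \<in> gset_mult G A B"
  then obtain x y where xy: "x \<in> A" "y \<in> B" "(x, y) \<in> composable G" "w = x \<cdot> y"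
    by (auto simp: mem_gset_mult)
  then have c: "x \<in> carrier G" "y \<in> carrier G" "gdom G x = gcod G y" "w \<in> carrier G" "gdom G w = gdom G y"
    by (auto simp: composable_iff groupoid_simps)
  define K where "K = {(z, b). z \<in> carrier G \<and> b \<in> carrier G \<and> gdom G z = gdom G b}"
  let ?P = "prod_topology (gtop G) (gtop G)"
  have K: "topspace (subtopology ?P K) = K"
    by (auto simp: K_def topspace_gtop)
  have "continuous_map (subtopology ?P K) (gtop G) (\<lambda>p. fst p \<cdot> ginv G (snd p))"
  proof (rule continuous_gmult_comp)
    show "continuous_map (subtopology ?P K) (gtop G) fst"
      by (intro continuous_map_from_subtopology continuous_map_fst)
    have "continuous_map (subtopology ?P K) (gtop G) (ginv G \<circ> snd)"
      by (intro continuous_map_compose [OF _ continuous_ginv]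
          continuous_map_from_subtopology continuous_map_snd)
    then show "continuous_map (subtopology ?P K) (gtop G) (\<lambda>p. ginv G (snd p))"
      by (simp add: o_def)
    show "gdom G (fst p) = gcod G (ginv G (snd p))" if "p \<in> topspace (subtopology ?P K)" for p
      using that unfolding K by (auto simp: K_def groupoid_simps)
  qed
  from openin_continuous_map_preimage [OF this A]
  have "openin (subtopology ?P K) {p \<in> K. fst p \<cdot> ginv G (snd p) \<in> A}"
    unfolding K .
  then obtain W where W: "openin ?P W" "{p \<in> K. fst p \<cdot> ginv G (snd p) \<in> A} = W \<inter> K"
    by (auto simp: openin_subtopology)
  have "w \<cdot> ginv G y = x"
    unfolding xy(4) using c by (intro gmult_ginv_cancel)
  then have "(w, y) \<in> {p \<in> K. fst p \<cdot> ginv G (snd p) \<in> A}"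
    using c(2,4,5) xy(1) by (simp add: K_def)
  then have "(w, y) \<in> W" unfolding W(2) by simp
  then obtain Z Y where ZY: "openin (gtop G) Z" "openin (gtop G) Y" "w \<in> Z" "y \<in> Y" "Z \<times> Y \<subseteq> W"
    using W(1) [unfolded openin_prod_topology_alt] by meson
  define N where "N = Z \<inter> {z \<in> topspace (gtop G). gdom G z \<in> gdom G ` (Y \<inter> B)}"
  have "openin (gtop G) N"
    unfolding N_def
    by (intro openin_Int ZY openin_continuous_map_preimage [OF continuous_gdom] openin_gdom_image B)
  moreover have "w \<in> N"
    using c xy ZY by (auto simp: N_def topspace_gtop)
  moreover have "N \<subseteq> gset_mult G A B"
  proof
    fix z assume "z \<in> N"
    then obtain b where b: "z \<in> Z" "z \<in> carrier G" "b \<in> Y" "b \<in> B" "gdom G z = gdom G b"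
      by (auto simp: N_def topspace_gtop)
    then have b': "b \<in> carrier G" using B openin_carrier by blast
    then have "(z, b) \<in> W \<inter> K" using b ZY(5) by (auto simp: K_def)
    then have "z \<cdot> ginv G b \<in> A" unfolding W(2) [symmetric] by simp
    then show "z \<in> gset_mult G A B"
      using b b' gmult_ginv_cancel' [of z b]
      by (intro gset_multI [of "z \<cdot> ginv G b" _ b]) (auto simp: composable_iff groupoid_simps)
  qed
  ultimately show "\<exists>T. openin (gtop G) T \<and> w \<in> T \<and> T \<subseteq> gset_mult G A B" by blast
qed

lemma open_bisectionsD:
  assumes "A \<in> open_bisections G"
  shows "openin (gtop G) A" "bisection G A" "A \<subseteq> carrier G"
  using assms by (auto simp: open_bisections_def bisection_def)

lemma open_bisections_gset_mult:
  "A \<in> open_bisections G \<Longrightarrow> B \<in> open_bisections G \<Longrightarrow> gset_mult G A B \<in> open_bisections G"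
  by (simp add: open_bisections_def openin_gset_mult bisection_gset_mult)

lemma open_bisections_ginv: "A \<in> open_bisections G \<Longrightarrow> ginv G ` A \<in> open_bisections G"
  by (simp add: open_bisections_def openin_ginv_image bisection_ginv)

lemma open_bisections_subset:
  "A \<in> open_bisections G \<Longrightarrow> openin (gtop G) B \<Longrightarrow> B \<subseteq> A \<Longrightarrow> B \<in> open_bisections G"
  using bisection_subset by (auto simp: open_bisections_def)

lemma open_bisections_Int:
  "A \<in> open_bisections G \<Longrightarrow> B \<in> open_bisections G \<Longrightarrow> A \<inter> B \<in> open_bisections G"
  by (rule open_bisections_subset [of A]) (auto simp: open_bisectionsD)

lemma open_bisections_identities: "identities G \<in> open_bisections G"
  by (simp add: open_bisections_def openin_identities bisection_identities)

end

section \<open>Etale groupoids generated by a basis of bisections\<close>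

lemma openin_topology_generated_by_basis:
  assumes "\<And>A B x. \<lbrakk>A \<in> \<B>; B \<in> \<B>; x \<in> A; x \<in> B\<rbrakk> \<Longrightarrow> \<exists>C\<in>\<B>. x \<in> C \<and> C \<subseteq> A \<inter> B"
  shows "openin (topology_generated_by \<B>) U \<longleftrightarrow> (\<forall>x\<in>U. \<exists>B\<in>\<B>. x \<in> B \<and> B \<subseteq> U)"
proof
  assume "openin (topology_generated_by \<B>) U"
  then have "generate_topology_on \<B> U" by (rule openin_topology_generated_by)
  then show "\<forall>x\<in>U. \<exists>B\<in>\<B>. x \<in> B \<and> B \<subseteq> U"
  proof induction
    case (Int a b)
    show ?case
    proof
      fix x assume "x \<in> a \<inter> b"
      then have "x \<in> a" "x \<in> b" by auto
      with Int.IH obtain A B where "A \<in> \<B>" "x \<in> A" "A \<subseteq> a" "B \<in> \<B>" "x \<in> B" "B \<subseteq> b"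
        by meson
      with assms [of A B x] show "\<exists>B\<in>\<B>. x \<in> B \<and> B \<subseteq> a \<inter> b" by blast
    qed
  next
    case (UN K)
    then show ?case by (meson Union_iff Union_upper subset_trans)
  qed auto
next
  assume "\<forall>x\<in>U. \<exists>B\<in>\<B>. x \<in> B \<and> B \<subseteq> U"
  then show "openin (topology_generated_by \<B>) U"
    by (subst openin_subopen) (meson topology_generated_by_Basis)
qed

text \<open>For x y in C choose a basic A around x: composable pairs with left entry in A and right
  entry in A^{-1} C multiply into C, which gives continuity of multiplication. The domain image d(A)
  = A^{-1} A is again basic, so d is open; being injective on A, it is a local
  homeomorphism.\<close>

lemma (in groupoid) etale_groupoid_basisI:
  assumes top: "gtop G = topology_generated_by \<B>"
    and cover: "\<Union>\<B> = carrier G"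
    and bis: "\<And>A. A \<in> \<B> \<Longrightarrow> bisection G A"
    and mult: "\<And>A B. A \<in> \<B> \<Longrightarrow> B \<in> \<B> \<Longrightarrow> gset_mult G A B \<in> \<B>"
    and inv: "\<And>A. A \<in> \<B> \<Longrightarrow> ginv G ` A \<in> \<B>"
    and one: "identities G \<in> \<B>"
    and basis: "\<And>A B x. \<lbrakk>A \<in> \<B>; B \<in> \<B>; x \<in> A; x \<in> B\<rbrakk> \<Longrightarrow> \<exists>C\<in>\<B>. x \<in> C \<and> C \<subseteq> A \<inter> B"
  shows "etale_groupoid G"
proof -
  have open_iff: "openin (gtop G) U \<longleftrightarrow> (\<forall>x\<in>U. \<exists>B\<in>\<B>. x \<in> B \<and> B \<subseteq> U)" for U
    unfolding top by (rule openin_topology_generated_by_basis) (rule basis)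
  have open_basis: "openin (gtop G) A" if "A \<in> \<B>" for A
    using that open_iff by blast
  have topspace: "topspace (gtop G) = carrier G"
    using cover by (simp add: top)
  have carrier: "A \<subseteq> carrier G" if "A \<in> \<B>" for A
    using that cover by blast
  have ob: "\<exists>A\<in>\<B>. x \<in> A" if "x \<in> carrier G" for x
    using that cover by blast
  let ?P = "subtopology (prod_topology (gtop G) (gtop G)) (composable G)"
  have topP: "topspace ?P = composable G"
    by (auto simp: topspace composable_def)
  have "continuous_map ?P (topology_generated_by \<B>) (\<lambda>(x, y). x \<cdot> y)"
    unfolding continuous_on_generated_topo_iff topP cover
  proof (intro conjI allI impI)
    show "(\<lambda>(x, y). x \<cdot> y) ` composable G \<subseteq> carrier G"
      by (auto simp: composable_iff gmult_in)
    fix C assume C: "C \<in> \<B>"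
    show "openin ?P ((\<lambda>(x, y). x \<cdot> y) -` C \<inter> composable G)"
    proof (subst openin_subopen, clarify)
      fix x y assume xy: "(x, y) \<in> composable G" "x \<cdot> y \<in> C"
      then obtain A where A: "A \<in> \<B>" "x \<in> A" using ob by (auto simp: composable_iff)
      let ?B = "gset_mult G (ginv G ` A) C"
      have "?B \<in> \<B>" by (intro mult inv A C)
      then have "openin (prod_topology (gtop G) (gtop G)) (A \<times> ?B)"
        using A by (simp add: openin_prod_Times_iff open_basis)
      then have "openin ?P (composable G \<inter> A \<times> ?B)"
        by (rule openin_subtopology_Int2)
      moreover have "y \<in> ?B"
        using mem_gset_mult_ginv [OF bis [OF A(1)] A(2) carrier [OF C] xy(1)] xy(2) by simp
      moreover have "composable G \<inter> A \<times> ?B \<subseteq> (\<lambda>(x, y). x \<cdot> y) -` C \<inter> composable G"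
        using mem_gset_mult_ginv [OF bis [OF A(1)] _ carrier [OF C]] by auto
      ultimately show "\<exists>T. openin ?P T \<and> (x, y) \<in> T \<and> T \<subseteq> (\<lambda>(x, y). x \<cdot> y) -` C \<inter> composable G"
        using xy A by (intro exI [of _ "composable G \<inter> A \<times> ?B"]) auto
    qed
  qed
  then have cmult: "continuous_map ?P (gtop G) (\<lambda>(x, y). x \<cdot> y)"
    by (simp only: top)
  have cinv: "continuous_map (gtop G) (gtop G) (ginv G)"
  proof -
    have "ginv G -` A \<inter> carrier G = ginv G ` A" if "A \<in> \<B>" for A
      using carrier [OF that] by (force simp: image_iff ginv_in)
    moreover have "ginv G ` carrier G \<subseteq> carrier G" by (auto simp: ginv_in)
    ultimately have "continuous_map (gtop G) (topology_generated_by \<B>) (ginv G)"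
      unfolding continuous_on_generated_topo_iff topspace cover by (simp add: inv open_basis)
    then show ?thesis by (simp add: top)
  qed
  interpret topological_groupoid G
    by unfold_locales (fact topspace cmult cinv)+
  have open_gdom: "openin (gtop G) (gdom G ` U)" if U: "openin (gtop G) U" for U
    unfolding open_iff
  proof clarify
    fix x assume "x \<in> U"
    then obtain B where B: "B \<in> \<B>" "x \<in> B" "B \<subseteq> U"
      using U unfolding open_iff by auto
    have "gdom G ` B \<in> \<B>"
      using mult [OF inv [OF B(1)] B(1)] by (simp add: gset_mult_ginv_self(1) [OF bis [OF B(1)]])
    then show "\<exists>B\<in>\<B>. gdom G x \<in> B \<and> B \<subseteq> gdom G ` U"
      using B by blast
  qed
  have "local_homeomorphism (gtop G) (subtopology (gtop G) (identities G)) (gdom G)"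
    unfolding local_homeomorphism_def
  proof
    fix x assume "x \<in> topspace (gtop G)"
    then obtain A where A: "A \<in> \<B>" "x \<in> A" using ob topspace by auto
    have sub: "gdom G ` A \<subseteq> identities G" using carrier [OF A(1)] by auto
    have gA: "subtopology (subtopology (gtop G) (identities G)) (gdom G ` A)
        = subtopology (gtop G) (gdom G ` A)"
      using sub by (simp add: subtopology_subtopology Int_absorb1)
    have tA: "topspace (subtopology (gtop G) A) = A"
      and tdA: "topspace (subtopology (gtop G) (gdom G ` A)) = gdom G ` A"
      using carrier [OF A(1)] gdom_in by (auto simp: topspace)
    have "homeomorphic_map (subtopology (gtop G) A) (subtopology (gtop G) (gdom G ` A)) (gdom G)"
    proof (rule bijective_open_imp_homeomorphic_map)
      show "continuous_map (subtopology (gtop G) A) (subtopology (gtop G) (gdom G ` A)) (gdom G)"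
        unfolding continuous_map_in_subtopology tA
        by (auto intro: continuous_map_from_subtopology continuous_gdom)
      show "open_map (subtopology (gtop G) A) (subtopology (gtop G) (gdom G ` A)) (gdom G)"
        unfolding open_map_def openin_open_subtopology [OF open_basis [OF A(1)]]
          openin_open_subtopology [OF open_gdom [OF open_basis [OF A(1)]]]
        by (auto simp: open_gdom)
      show "gdom G ` topspace (subtopology (gtop G) A) = topspace (subtopology (gtop G) (gdom G ` A))"
        unfolding tA tdA ..
      show "inj_on (gdom G) (topspace (subtopology (gtop G) A))"
        unfolding tA using bis [OF A(1)] by (simp add: bisection_iff)
    qed
    moreover have "openin (subtopology (gtop G) (identities G)) (gdom G ` A)"
      using open_gdom [OF open_basis [OF A(1)]] sub openin_open_subtopology [OF open_basis [OF one]]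
      by simp
    ultimately show "\<exists>U. openin (gtop G) U \<and> x \<in> U \<and>
        openin (subtopology (gtop G) (identities G)) (gdom G ` U) \<and>
        homeomorphic_map (subtopology (gtop G) U)
          (subtopology (subtopology (gtop G) (identities G)) (gdom G ` U)) (gdom G)"
      using A open_basis by (intro exI [of _ A]) (simp add: gA)
  qed
  then show ?thesis by unfold_locales
qed

section \<open>Joins and meets\<close>

context inverse_monoid
begin

abbreviation Join ("\<Or>_" [90] 90) where "\<Or>A \<equiv> \<Squnion>\<^bsub>nat_order S\<^esub> A"
abbreviation Meet (infixl "\<sqinter>\<sqinter>" 70) where "a \<sqinter>\<sqinter> b \<equiv> a \<sqinter>\<^bsub>nat_order S\<^esub> b"

text \<open>\<open>sup\<close> is a Hilbert choice of a least upper bound. Exhibiting any least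
  upper bound computes it, since antisymmetry identifies the two.\<close>

lemma join_eqI:
  assumes "j \<in> carrier S" "\<And>a. a \<in> A \<Longrightarrow> a \<preceq> j"
    and "\<And>u. u \<in> carrier S \<Longrightarrow> (\<And>a. a \<in> A \<Longrightarrow> a \<preceq> u) \<Longrightarrow> j \<preceq> u"
  shows "\<Or>A = j"
proof -
  have A: "A \<subseteq> carrier S" using assms(1,2) leq_closed by blast
  have "least (nat_order S) j (Upper (nat_order S) A)"
    unfolding least_def Upper_def
  proof (intro conjI ballI)
    fix u assume "u \<in> {u. \<forall>x. x \<in> A \<inter> carrier (nat_order S) \<longrightarrow> x \<preceq> u} \<inter> carrier (nat_order S)"
    then show "j \<preceq> u" using A by (intro assms(3)) auto
  qed (use assms(1,2) in auto)
  then have "least (nat_order S) (\<Or>A) (Upper (nat_order S) A)"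
    unfolding sup_def by (rule someI)
  with \<open>least (nat_order S) j (Upper (nat_order S) A)\<close> show ?thesis
    by (rule nat.least_unique [symmetric])
qed

lemma meet_eqI:
  assumes "m \<in> carrier S" "m \<preceq> a" "m \<preceq> b" "a \<in> carrier S" "b \<in> carrier S"
    and "\<And>u. u \<in> carrier S \<Longrightarrow> u \<preceq> a \<Longrightarrow> u \<preceq> b \<Longrightarrow> u \<preceq> m"
  shows "a \<sqinter>\<sqinter> b = m"
proof -
  have "greatest (nat_order S) m (Lower (nat_order S) {a, b})"
    unfolding greatest_def Lower_def using assms(1-5) by (auto intro: assms)
  then have "greatest (nat_order S) (a \<sqinter>\<sqinter> b) (Lower (nat_order S) {a, b})"
    unfolding meet_def inf_def by (rule someI)
  with \<open>greatest (nat_order S) m (Lower (nat_order S) {a, b})\<close> show ?thesis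
    by (rule nat.greatest_unique [symmetric])
qed

lemma compatible_carrier: "compatible S A \<Longrightarrow> a \<in> A \<Longrightarrow> a \<in> carrier S"
  by (auto simp: compatible_def)

end

context pseudogroup
begin

lemma
  assumes "compatible S A"
  shows join_closed [simp, intro]: "\<Or>A \<in> carrier S"
    and join_upper: "a \<in> A \<Longrightarrow> a \<preceq> \<Or>A"
    and join_least: "u \<in> carrier S \<Longrightarrow> (\<And>a. a \<in> A \<Longrightarrow> a \<preceq> u) \<Longrightarrow> \<Or>A \<preceq> u"
proof -
  have "least (nat_order S) (\<Or>A) (Upper (nat_order S) A)"
    unfolding sup_def by (rule someI_ex) (rule join_exists [OF assms])
  then have *: "\<Or>A \<in> Upper (nat_order S) A" "\<forall>u\<in>Upper (nat_order S) A. \<Or>A \<preceq> u"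
    by (auto simp: least_def)
  show "\<Or>A \<in> carrier S" using *(1) by (simp add: Upper_def)
  show "a \<preceq> \<Or>A" if "a \<in> A"
    using that * compatible_carrier [OF assms] by (auto simp: Upper_def)
  show "\<Or>A \<preceq> u" if "u \<in> carrier S" "\<And>a. a \<in> A \<Longrightarrow> a \<preceq> u"
    using that * by (auto simp: Upper_def)
qed

text \<open>The common lower bounds of a and b are bounded by a, hence compatible; their join is the
  meet. This is why pseudogroups have binary meets although only joins are postulated.\<close>

lemma
  assumes [simp]: "a \<in> carrier S" "b \<in> carrier S"
  shows meet_closed [simp, intro]: "a \<sqinter>\<sqinter> b \<in> carrier S"
    and meet_le1: "a \<sqinter>\<sqinter> b \<preceq> a"
    and meet_le2: "a \<sqinter>\<sqinter> b \<preceq> b"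
    and meet_greatest: "u \<preceq> a \<Longrightarrow> u \<preceq> b \<Longrightarrow> u \<preceq> a \<sqinter>\<sqinter> b"
proof -
  define A where "A = {c. c \<preceq> a \<and> c \<preceq> b}"
  have A: "compatible S A" by (rule compatible_bounded [of _ a]) (auto simp: A_def)
  have "\<Or>A \<preceq> a" "\<Or>A \<preceq> b" by (rule join_least [OF A]; simp add: A_def)+
  moreover have *: "u \<preceq> \<Or>A" if "u \<preceq> a" "u \<preceq> b" for u
    using that by (intro join_upper A) (simp add: A_def)
  ultimately have "a \<sqinter>\<sqinter> b = \<Or>A" using A by (intro meet_eqI) auto
  with * A \<open>\<Or>A \<preceq> a\<close> \<open>\<Or>A \<preceq> b\<close>
  show "a \<sqinter>\<sqinter> b \<in> carrier S" "a \<sqinter>\<sqinter> b \<preceq> a" "a \<sqinter>\<sqinter> b \<preceq> b"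
    "u \<preceq> a \<Longrightarrow> u \<preceq> b \<Longrightarrow> u \<preceq> a \<sqinter>\<sqinter> b" by auto
qed

lemma compatible_mult_left:
  assumes "compatible S A" "s \<in> carrier S"
  shows "compatible S ((\<lambda>a. s \<otimes> a) ` A)"
  using assms by (intro compatible_bounded [of _ "s \<otimes> \<Or>A"]) (auto intro!: mult_mono join_upper)

lemma
  assumes A: "compatible S A"
  shows compatible_pinv: "compatible S (pinv S ` A)"
    and pinv_join: "(\<Or>A)\<^sup>- = \<Or>(pinv S ` A)"
proof -
  have c: "a \<in> carrier S" if "a \<in> A" for a using compatible_carrier A that .
  show *: "compatible S (pinv S ` A)"
    using A by (intro compatible_bounded [of _ "(\<Or>A)\<^sup>-"]) (auto intro!: pinv_mono join_upper)
  show "(\<Or>A)\<^sup>- = \<Or>(pinv S ` A)"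
  proof (rule join_eqI [symmetric])
    show "a \<preceq> (\<Or>A)\<^sup>-" if "a \<in> pinv S ` A" for a
      using that A by (auto intro!: pinv_mono join_upper)
    show "(\<Or>A)\<^sup>- \<preceq> u" if u: "u \<in> carrier S" "\<And>a. a \<in> pinv S ` A \<Longrightarrow> a \<preceq> u" for u
    proof -
      have "\<Or>A \<preceq> u\<^sup>-"
      proof (rule join_least [OF A])
        show "a \<preceq> u\<^sup>-" if "a \<in> A" for a
          using pinv_mono [OF u(2) u(1), of "a\<^sup>-"] that c by simp
      qed (use u in simp)
      then show ?thesis using pinv_mono [of "\<Or>A" "u\<^sup>-"] u by simp
    qed
  qed (use A in auto)
qed

end

section \<open>Completely prime filters\<close>

lemma compatible_empty: "compatible S {}"
  by (simp add: compatible_def)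

text \<open>Properness comes for free: zero is the join of the empty family, so a completely prime
  set cannot contain it.\<close>

lemma cp_filtersI:
  assumes "F \<subseteq> carrier S" "F \<noteq> {}"
    "\<And>a b. a \<in> F \<Longrightarrow> b \<in> carrier S \<Longrightarrow> a \<sqsubseteq>\<^bsub>nat_order S\<^esub> b \<Longrightarrow> b \<in> F"
    "\<And>a b. a \<in> F \<Longrightarrow> b \<in> F \<Longrightarrow> \<exists>c\<in>F. c \<sqsubseteq>\<^bsub>nat_order S\<^esub> a \<and> c \<sqsubseteq>\<^bsub>nat_order S\<^esub> b"
    "\<And>A. compatible S A \<Longrightarrow> \<Squnion>\<^bsub>nat_order S\<^esub> A \<in> F \<Longrightarrow> \<exists>a\<in>A. a \<in> F"
  shows "F \<in> cp_filters S"
proof -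
  have "pzero S \<notin> F"
    using assms(5) [OF compatible_empty] by (auto simp: pzero_def)
  with assms show ?thesis
    unfolding cp_filters_def proper_filter_def completely_prime_def by blast
qed

lemma
  assumes "F \<in> cp_filters S"
  shows cp_filter_subset: "F \<subseteq> carrier S"
    and cp_filter_nonempty: "F \<noteq> {}"
    and cp_filter_up: "a \<in> F \<Longrightarrow> b \<in> carrier S \<Longrightarrow> a \<sqsubseteq>\<^bsub>nat_order S\<^esub> b \<Longrightarrow> b \<in> F"
    and cp_filter_directed:
      "a \<in> F \<Longrightarrow> b \<in> F \<Longrightarrow> \<exists>c\<in>F. c \<sqsubseteq>\<^bsub>nat_order S\<^esub> a \<and> c \<sqsubseteq>\<^bsub>nat_order S\<^esub> b"
    and cp_filter_prime: "compatible S A \<Longrightarrow> \<Squnion>\<^bsub>nat_order S\<^esub> A \<in> F \<Longrightarrow> \<exists>a\<in>A. a \<in> F"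
  using assms unfolding cp_filters_def proper_filter_def completely_prime_def by blast+

text \<open>With \<open>A \<star> B = (AB)\<up>\<close>, subsets form an involutive semigroup in which filters satisfy
  \<open>A \<star> A\<inverse> \<star> A = A\<close>; the groupoid laws are consequences of this identity.\<close>

context inverse_monoid
begin

abbreviation fmult (infixl "\<star>" 70) where "A \<star> B \<equiv> up_closure S (A <#> B)"
abbreviation fpinv where "fpinv A \<equiv> pinv S ` A"

lemma mem_fmult: "t \<in> A \<star> B \<longleftrightarrow> t \<in> carrier S \<and> (\<exists>a\<in>A. \<exists>b\<in>B. a \<otimes> b \<preceq> t)"
  by (auto simp: up_closure_def set_mult_def)

lemma fmult_subset: "A \<star> B \<subseteq> carrier S"
  by (auto simp: mem_fmult)

lemma mult_in_fmult:
  "\<lbrakk>A \<subseteq> carrier S; B \<subseteq> carrier S; a \<in> A; b \<in> B\<rbrakk> \<Longrightarrow> a \<otimes> b \<in> A \<star> B"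
  unfolding mem_fmult by (blast intro: leq_refl m_closed)

lemma fmult_up: "s \<in> A \<star> B \<Longrightarrow> s \<preceq> t \<Longrightarrow> t \<in> carrier S \<Longrightarrow> t \<in> A \<star> B"
  unfolding mem_fmult using leq_trans by blast

lemma mem_fmult3:
  assumes A: "A \<subseteq> carrier S" and B: "B \<subseteq> carrier S" and C: "C \<subseteq> carrier S"
  shows "t \<in> A \<star> B \<star> C \<longleftrightarrow> t \<in> carrier S \<and> (\<exists>a\<in>A. \<exists>b\<in>B. \<exists>c\<in>C. a \<otimes> b \<otimes> c \<preceq> t)"
proof
  assume "t \<in> A \<star> B \<star> C"
  then obtain x c where xc: "x \<in> A \<star> B" "c \<in> C" "x \<otimes> c \<preceq> t" "t \<in> carrier S"
    by (auto simp: mem_fmult)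
  then obtain a b where ab: "a \<in> A" "b \<in> B" "a \<otimes> b \<preceq> x" "x \<in> carrier S"
    by (auto simp: mem_fmult)
  have "a \<otimes> b \<otimes> c \<preceq> x \<otimes> c" using ab xc C by (intro mult_mono) auto
  then have "a \<otimes> b \<otimes> c \<preceq> t" using xc leq_trans by blast
  then show "t \<in> carrier S \<and> (\<exists>a\<in>A. \<exists>b\<in>B. \<exists>c\<in>C. a \<otimes> b \<otimes> c \<preceq> t)" using ab xc by blast
next
  assume "t \<in> carrier S \<and> (\<exists>a\<in>A. \<exists>b\<in>B. \<exists>c\<in>C. a \<otimes> b \<otimes> c \<preceq> t)"
  then obtain a b c where "a \<in> A" "b \<in> B" "c \<in> C" "a \<otimes> b \<otimes> c \<preceq> t" "t \<in> carrier S" by blast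
  moreover from this have "a \<otimes> b \<in> A \<star> B" using mult_in_fmult A B by blast
  ultimately show "t \<in> A \<star> B \<star> C" unfolding mem_fmult [of t] by blast
qed

lemma fmult_assoc:
  assumes A: "A \<subseteq> carrier S" and B: "B \<subseteq> carrier S" and C: "C \<subseteq> carrier S"
  shows "A \<star> B \<star> C = A \<star> (B \<star> C)"
proof (intro equalityI subsetI)
  fix t assume "t \<in> A \<star> B \<star> C"
  then obtain a b c where abc: "a \<in> A" "b \<in> B" "c \<in> C" "a \<otimes> b \<otimes> c \<preceq> t" "t \<in> carrier S"
    unfolding mem_fmult3 [OF assms] by blast
  moreover have "b \<otimes> c \<in> B \<star> C" using abc mult_in_fmult B C by blast
  moreover have "a \<otimes> (b \<otimes> c) \<preceq> t" using abc A B C m_assoc [of a b c] by (metis subsetD)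
  ultimately show "t \<in> A \<star> (B \<star> C)" unfolding mem_fmult [of t] by blast
next
  fix t assume "t \<in> A \<star> (B \<star> C)"
  then obtain x a where xa: "x \<in> B \<star> C" "a \<in> A" "a \<otimes> x \<preceq> t" "t \<in> carrier S"
    by (auto simp: mem_fmult)
  then obtain b c where bc: "b \<in> B" "c \<in> C" "b \<otimes> c \<preceq> x" "x \<in> carrier S"
    by (auto simp: mem_fmult)
  have "a \<otimes> (b \<otimes> c) \<preceq> a \<otimes> x" using bc xa A by (intro mult_mono) auto
  then have "a \<otimes> (b \<otimes> c) \<preceq> t" using xa leq_trans by blast
  then have "a \<otimes> b \<otimes> c \<preceq> t" using m_assoc [of a b c] xa bc A B C by (metis subsetD)
  then show "t \<in> A \<star> B \<star> C" unfolding mem_fmult3 [OF assms] using xa(2,4) bc(1,2) by blast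
qed

lemma fpinv_fpinv [simp]: "A \<subseteq> carrier S \<Longrightarrow> fpinv (fpinv A) = A"
  by (force simp: image_iff subset_iff)

lemma fpinv_subset [simp]: "A \<subseteq> carrier S \<Longrightarrow> fpinv A \<subseteq> carrier S"
  by auto

lemma mem_fpinv:
  assumes "A \<subseteq> carrier S"
  shows "t \<in> fpinv A \<longleftrightarrow> t \<in> carrier S \<and> t\<^sup>- \<in> A"
proof
  assume "t \<in> carrier S \<and> t\<^sup>- \<in> A"
  then show "t \<in> fpinv A" by (intro image_eqI [of t _ "t\<^sup>-"]) simp_all
qed (use assms in auto)

lemma fpinv_fmult:
  assumes A: "A \<subseteq> carrier S" and B: "B \<subseteq> carrier S"
  shows "fpinv (A \<star> B) = fpinv B \<star> fpinv A"
proof (rule Set.set_eqI)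
  fix t
  have "t\<^sup>- \<in> A \<star> B \<longleftrightarrow> (\<exists>a\<in>A. \<exists>b\<in>B. b\<^sup>- \<otimes> a\<^sup>- \<preceq> t)" if t: "t \<in> carrier S"
  proof -
    have "a \<otimes> b \<preceq> t\<^sup>- \<longleftrightarrow> b\<^sup>- \<otimes> a\<^sup>- \<preceq> t" if "a \<in> A" "b \<in> B" for a b
    proof -
      have "a \<in> carrier S" "b \<in> carrier S" using that A B by auto
      then show ?thesis
        using pinv_leq_iff [of "a \<otimes> b" "t\<^sup>-"] t by (simp add: pinv_mult)
    qed
    then show ?thesis using t by (auto simp: mem_fmult)
  qed
  then show "t \<in> fpinv (A \<star> B) \<longleftrightarrow> t \<in> fpinv B \<star> fpinv A"
    unfolding mem_fpinv [OF fmult_subset] by (auto simp: mem_fmult)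
qed

end

section \<open>The groupoid of completely prime filters\<close>

context pseudogroup
begin

text \<open>If a b^- c \<le> t with a, b, c in A, a common lower bound y of the three in A satisfies
  y = y y^- y \<le> a b^- c \<le> t.\<close>

lemma fmult_cancel:
  assumes "A \<in> cp_filters S"
  shows "A \<star> fpinv A \<star> A = A"
proof (intro equalityI subsetI)
  have sub: "A \<subseteq> carrier S" by (rule cp_filter_subset [OF assms])
  note mem = mem_fmult3 [OF sub fpinv_subset [OF sub] sub]
  {
    fix t assume "t \<in> A \<star> fpinv A \<star> A"
    then obtain a b c where abc: "a \<in> A" "b \<in> A" "c \<in> A" "a \<otimes> b\<^sup>- \<otimes> c \<preceq> t" "t \<in> carrier S"
      unfolding mem by blast
    obtain x where x: "x \<in> A" "x \<preceq> a" "x \<preceq> b"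
      using cp_filter_directed [OF assms abc(1,2)] by blast
    obtain y where y: "y \<in> A" "y \<preceq> x" "y \<preceq> c"
      using cp_filter_directed [OF assms x(1) abc(3)] by blast
    have [simp]: "a \<in> carrier S" "b \<in> carrier S" "c \<in> carrier S" "x \<in> carrier S" "y \<in> carrier S"
      using abc x y sub by auto
    have "y \<preceq> a" "y \<preceq> b" using leq_trans [OF y(2)] x by auto
    then have "y \<otimes> y\<^sup>- \<otimes> y \<preceq> a \<otimes> b\<^sup>- \<otimes> c"
      using y by (intro mult_mono pinv_mono) auto
    then have "y \<preceq> t" using abc(4,5) leq_trans [of y] by (simp add: mult_pinv_mult)
    then show "t \<in> A" using cp_filter_up [OF assms y(1)] abc by blast
  next
    fix t assume "t \<in> A"
    moreover have "t \<otimes> t\<^sup>- \<otimes> t \<preceq> t" using \<open>t \<in> A\<close> sub by (auto simp: mult_pinv_mult)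
    ultimately show "t \<in> A \<star> fpinv A \<star> A" unfolding mem using sub by blast
  }
qed

abbreviation fdom where "fdom A \<equiv> fpinv A \<star> A"
abbreviation fcod where "fcod A \<equiv> A \<star> fpinv A"

lemma fmult_fdom: "A \<in> cp_filters S \<Longrightarrow> A \<star> fdom A = A"
  using fmult_cancel [of A] fmult_assoc [of A "fpinv A" A] cp_filter_subset [of A S] by simp

lemma fcod_fmult: "A \<in> cp_filters S \<Longrightarrow> fcod A \<star> A = A"
  by (rule fmult_cancel)

lemma fpinv_fdom [simp]: "A \<subseteq> carrier S \<Longrightarrow> fpinv (fdom A) = fdom A"
  by (simp add: fpinv_fmult)

lemma fpinv_cp_filters:
  assumes "A \<in> cp_filters S"
  shows "fpinv A \<in> cp_filters S"
proof (rule cp_filtersI)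
  have sub: "A \<subseteq> carrier S" by (rule cp_filter_subset [OF assms])
  note mem = mem_fpinv [OF sub]
  show "fpinv A \<subseteq> carrier S" "fpinv A \<noteq> {}" using sub cp_filter_nonempty [OF assms] by auto
  show "b \<in> fpinv A" if "a \<in> fpinv A" "b \<in> carrier S" "a \<preceq> b" for a b
    using that cp_filter_up [OF assms, of "a\<^sup>-" "b\<^sup>-"] by (auto simp: mem pinv_mono)
  show "\<exists>c\<in>fpinv A. c \<preceq> a \<and> c \<preceq> b" if ab: "a \<in> fpinv A" "b \<in> fpinv A" for a b
  proof -
    from ab have "a\<^sup>- \<in> A" "b\<^sup>- \<in> A" and [simp]: "a \<in> carrier S" "b \<in> carrier S"
      by (simp_all add: mem)
    then obtain c where c: "c \<in> A" "c \<preceq> a\<^sup>-" "c \<preceq> b\<^sup>-"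
      using cp_filter_directed [OF assms] by blast
    then have "c\<^sup>- \<preceq> a" "c\<^sup>- \<preceq> b"
      using pinv_mono [of c "a\<^sup>-"] pinv_mono [of c "b\<^sup>-"] by auto
    with c show ?thesis by blast
  qed
  show "\<exists>c\<in>C. c \<in> fpinv A" if C: "compatible S C" "\<Or>C \<in> fpinv A" for C
  proof -
    have "\<Or>(fpinv C) \<in> A" using C pinv_join [OF C(1)] by (simp add: mem)
    then obtain c where "c \<in> C" "c\<^sup>- \<in> A"
      using cp_filter_prime [OF assms compatible_pinv [OF C(1)]] by blast
    then show ?thesis using compatible_carrier [OF C(1)] mem by blast
  qed
qed

lemma cp_filter_prime_left:
  assumes "B \<in> cp_filters S" "compatible S C" "s \<in> carrier S" "s \<otimes> \<Or>C \<in> B"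
  obtains c where "c \<in> C" "s \<otimes> c \<in> B"
  using cp_filter_prime [OF assms(1) compatible_mult_left [OF assms(2,3)]]
    distrib_left [OF assms(2,3)] assms(4) by auto

text \<open>Primeness is the point. If a b lies below the join of C, then a^- a b lies in B because
  d(A) = r(B), and hence so does the product of a^- with the join. Distributivity and primeness of B
  give c in C with a^- c in B, and a a^- c \<le> c.\<close>

lemma fmult_cp_filters:
  assumes A: "A \<in> cp_filters S" and B: "B \<in> cp_filters S" and eq: "fdom A = fcod B"
  shows "A \<star> B \<in> cp_filters S"
proof (rule cp_filtersI)
  note sub = cp_filter_subset [OF A] cp_filter_subset [OF B]
  show "A \<star> B \<subseteq> carrier S" by (rule fmult_subset)
  show "A \<star> B \<noteq> {}"
    using cp_filter_nonempty [OF A] cp_filter_nonempty [OF B] mult_in_fmult [OF sub] by blast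
  show "t \<in> A \<star> B" if "s \<in> A \<star> B" "t \<in> carrier S" "s \<preceq> t" for s t
    using that fmult_up by blast
  show "\<exists>u\<in>A \<star> B. u \<preceq> s \<and> u \<preceq> t" if st: "s \<in> A \<star> B" "t \<in> A \<star> B" for s t
  proof -
    obtain a b a' b' where ab: "a \<in> A" "b \<in> B" "a \<otimes> b \<preceq> s" "a' \<in> A" "b' \<in> B" "a' \<otimes> b' \<preceq> t"
      using st by (auto simp: mem_fmult)
    obtain x where x: "x \<in> A" "x \<preceq> a" "x \<preceq> a'" using cp_filter_directed [OF A] ab by meson
    obtain y where y: "y \<in> B" "y \<preceq> b" "y \<preceq> b'" using cp_filter_directed [OF B] ab by meson
    have "s \<in> carrier S" "t \<in> carrier S" using st by (auto simp: mem_fmult)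
    moreover have "x \<otimes> y \<preceq> a \<otimes> b" "x \<otimes> y \<preceq> a' \<otimes> b'" using x y ab sub by (auto intro!: mult_mono)
    ultimately have "x \<otimes> y \<preceq> s" "x \<otimes> y \<preceq> t" using ab leq_trans by blast+
    then show ?thesis using mult_in_fmult [OF sub x(1) y(1)] by blast
  qed
  show "\<exists>c\<in>C. c \<in> A \<star> B" if C: "compatible S C" "\<Or>C \<in> A \<star> B" for C
  proof -
    obtain a b where ab: "a \<in> A" "b \<in> B" "a \<otimes> b \<preceq> \<Or>C" using C by (auto simp: mem_fmult)
    then have [simp]: "a \<in> carrier S" "b \<in> carrier S" using sub by auto
    have "a\<^sup>- \<otimes> a \<in> fcod B"
      unfolding eq [symmetric] using ab sub by (intro mult_in_fmult) auto
    then have "a\<^sup>- \<otimes> a \<otimes> b \<in> fcod B \<star> B"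
      by (rule mult_in_fmult [OF fmult_subset sub(2)]) (use ab in auto)
    then have 1: "a\<^sup>- \<otimes> a \<otimes> b \<in> B" by (simp add: fcod_fmult [OF B])
    have "a\<^sup>- \<otimes> (a \<otimes> b) \<preceq> a\<^sup>- \<otimes> \<Or>C" using ab C by (intro mult_mono) auto
    then have "a\<^sup>- \<otimes> \<Or>C \<in> B"
      using 1 C by (intro cp_filter_up [OF B 1]) (auto simp: m_assoc)
    then obtain c where c: "c \<in> C" "a\<^sup>- \<otimes> c \<in> B"
      using cp_filter_prime_left [OF B C(1), of "a\<^sup>-"] by auto
    have [simp]: "c \<in> carrier S" using compatible_carrier C(1) c(1) .
    have "a \<otimes> (a\<^sup>- \<otimes> c) \<in> A \<star> B" using ab c by (intro mult_in_fmult sub)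
    moreover have "a \<otimes> (a\<^sup>- \<otimes> c) \<preceq> c" by (simp flip: m_assoc)
    ultimately have "c \<in> A \<star> B" using fmult_up by simp
    with c show ?thesis by blast
  qed
qed

lemma fdom_cp_filters: "A \<in> cp_filters S \<Longrightarrow> fdom A \<in> cp_filters S"
  and fcod_cp_filters: "A \<in> cp_filters S \<Longrightarrow> fcod A \<in> cp_filters S"
  by (simp_all add: fmult_cp_filters fpinv_cp_filters cp_filter_subset)

lemma fdom_fdom: "A \<in> cp_filters S \<Longrightarrow> fdom A \<star> fdom A = fdom A"
  using fmult_assoc [of "fpinv A" A "fdom A"] fmult_subset cp_filter_subset [of A S]
  by (simp add: fmult_fdom)

lemma fcod_fcod: "A \<in> cp_filters S \<Longrightarrow> fcod A \<star> fcod A = fcod A"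
  using fmult_assoc [of "fcod A" A "fpinv A"] fmult_subset cp_filter_subset [of A S]
  by (simp add: fcod_fmult)

lemma fdom_fmult:
  assumes A: "A \<in> cp_filters S" and B: "B \<in> cp_filters S" and eq: "fdom A = fcod B"
  shows "fdom (A \<star> B) = fdom B" "fcod (A \<star> B) = fcod A"
proof -
  note sub = cp_filter_subset [OF A] cp_filter_subset [OF B]
  have "fdom (A \<star> B) = fpinv B \<star> (fdom A \<star> B)"
    using sub fmult_subset by (simp add: fpinv_fmult fmult_assoc)
  then show "fdom (A \<star> B) = fdom B" unfolding eq by (simp add: fcod_fmult B)
  have "fcod (A \<star> B) = A \<star> fcod B \<star> fpinv A"
    using sub fmult_subset by (simp add: fpinv_fmult fmult_assoc)
  then show "fcod (A \<star> B) = fcod A" unfolding eq [symmetric] by (simp add: fmult_fdom A)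
qed

abbreviation FG where "FG \<equiv> filter_groupoid S"

sublocale FG: groupoid FG
proof
  fix A B C
  assume "A \<in> carrier FG" "B \<in> carrier FG"
    "C \<in> carrier FG"
  then show "gmult FG (gmult FG A B) C =
      gmult FG A (gmult FG B C)"
    by (simp add: filter_groupoid_def fmult_assoc cp_filter_subset)
qed (simp_all add: filter_groupoid_def fdom_cp_filters fcod_cp_filters cp_filter_subset fdom_fdom
      fcod_fcod fmult_cp_filters fdom_fmult fmult_fdom fcod_fmult fpinv_cp_filters)

lemma filter_groupoid_simps [simp]:
  "carrier FG = cp_filters S"
  "gdom FG = fdom"
  "gcod FG = fcod"
  "gmult FG = (\<star>)"
  "ginv FG = fpinv"
  "gtop FG = topology_generated_by (X_set S ` carrier S)"
  by (simp_all add: filter_groupoid_def)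

section \<open>The basic open sets as bisections\<close>

lemma fdom_idem:
  assumes "A \<in> cp_filters S" "a \<in> A"
  shows "a\<^sup>- \<otimes> a \<in> fdom A"
  using assms cp_filter_subset by (intro mult_in_fmult) auto

text \<open>For c in F below s, c = s (c^- c) with c^- c in d(F). So a filter behaves like a coset:
  its domain and any one of its elements determine it.\<close>

lemma eq_fmult_fdom:
  assumes F: "F \<in> cp_filters S" "s \<in> F"
  shows "F = {s} \<star> fdom F"
proof (intro equalityI subsetI)
  have sub: "F \<subseteq> carrier S" by (rule cp_filter_subset [OF F(1)])
  fix t assume "t \<in> F"
  then obtain c where c: "c \<in> F" "c \<preceq> s" "c \<preceq> t" using cp_filter_directed [OF F(1) _ F(2)] by blast
  then have "s \<otimes> (c\<^sup>- \<otimes> c) = c" using leq_eq [of c s] F(2) sub by auto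
  then show "t \<in> {s} \<star> fdom F"
    using fdom_idem [OF F(1) c(1)] c sub \<open>t \<in> F\<close>
    by (auto simp: mem_fmult [of t] intro!: bexI [of _ "c\<^sup>- \<otimes> c"])
next
  fix t assume "t \<in> {s} \<star> fdom F"
  then have "t \<in> F \<star> fdom F" using F(2) by (auto simp: mem_fmult [of t])
  then show "t \<in> F" by (simp add: fmult_fdom F)
qed

lemma bisection_X_set: "bisection FG (X_set S s)"
  unfolding FG.bisection_iff
proof (intro conjI inj_onI)
  show "X_set S s \<subseteq> carrier FG" by (auto simp: X_set_def)
next
  fix F F' assume "F \<in> X_set S s" "F' \<in> X_set S s"
    and "gdom FG F = gdom FG F'"
  then show "F = F'" using eq_fmult_fdom [of F s] eq_fmult_fdom [of F' s] by (simp add: X_set_def)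
next
  fix F F' assume F: "F \<in> X_set S s" "F' \<in> X_set S s"
    and "gcod FG F = gcod FG F'"
  moreover from F have c: "F \<in> cp_filters S" "s \<in> F" "F' \<in> cp_filters S" "s \<in> F'"
    by (auto simp: X_set_def)
  note sub = cp_filter_subset [OF c(1)] cp_filter_subset [OF c(3)]
  \<comment> \<open>The range of F is the domain of its inverse, which contains s^-; so the argument
    for domains applies to the inverses.\<close>
  ultimately have "fdom (fpinv F) = fdom (fpinv F')" by (simp add: sub)
  then have "fpinv F = fpinv F'"
    using eq_fmult_fdom [of "fpinv F" "s\<^sup>-"] eq_fmult_fdom [of "fpinv F'" "s\<^sup>-"] c
    by (simp add: fpinv_cp_filters)
  then show "F = F'" using fpinv_fpinv sub by metis
qed

text \<open>Converse to \<open>eq_fmult_fdom\<close>: an identity filter H and an element t with t^-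
  t in H determine a filter through t with domain H. It supplies the right factor when a filter
  containing s t has to be decomposed.\<close>

lemma translate_cp_filter:
  assumes H: "H \<in> cp_filters S" "fdom H = H" and t: "t \<in> carrier S" "t\<^sup>- \<otimes> t \<in> H"
  shows "{t} \<star> H \<in> cp_filters S" "fdom ({t} \<star> H) = H" "t \<in> {t} \<star> H"
proof -
  have sub: "H \<subseteq> carrier S" by (rule cp_filter_subset [OF H(1)])
  have HH: "H \<star> H = H" using fmult_fdom H by metis
  have inv: "fpinv H = H" using fpinv_fdom [OF sub] H(2) by simp
  have mem: "s \<in> {t} \<star> H \<longleftrightarrow> s \<in> carrier S \<and> (\<exists>h\<in>H. t \<otimes> h \<preceq> s)" for s
    by (simp add: mem_fmult)
  have mult: "h \<otimes> h' \<in> H" if "h \<in> H" "h' \<in> H" for h h'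
    using mult_in_fmult [OF sub sub that] HH by simp
  \<comment> \<open>Every element of an identity filter has an idempotent of that filter below it.
    This puts H inside the domain of the translate, because e (t^- t) e \<le> e for idempotent
    e.\<close>
  have idem: "\<exists>e\<in>H. e \<in> E \<and> e \<preceq> h" if h: "h \<in> H" for h
  proof -
    obtain a b where ab: "a \<in> H" "b \<in> H" "a\<^sup>- \<otimes> b \<preceq> h"
      using h mem_fmult [of h "fpinv H" H] unfolding H(2) by blast
    obtain c where c: "c \<in> H" "c \<preceq> a" "c \<preceq> b" using cp_filter_directed [OF H(1) ab(1,2)] by blast
    have "c\<^sup>- \<otimes> c \<preceq> a\<^sup>- \<otimes> b" using c ab sub by (intro mult_mono pinv_mono) auto
    then have "c\<^sup>- \<otimes> c \<preceq> h" using ab h sub leq_trans by blast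
    moreover have "c\<^sup>- \<otimes> c \<in> H" using fdom_idem [OF H(1) c(1)] H(2) by simp
    ultimately show ?thesis using c sub by blast
  qed
  show t_mem: "t \<in> {t} \<star> H"
    using t by (auto simp: mem intro!: bexI [of _ "t\<^sup>- \<otimes> t"] simp flip: m_assoc simp: mult_pinv_mult)
  show "{t} \<star> H \<in> cp_filters S"
  proof (rule cp_filtersI)
    show "{t} \<star> H \<subseteq> carrier S" by (rule fmult_subset)
    show "{t} \<star> H \<noteq> {}" using t_mem by blast
    show "b \<in> {t} \<star> H" if "a \<in> {t} \<star> H" "b \<in> carrier S" "a \<preceq> b" for a b
      using that fmult_up by blast
    show "\<exists>c\<in>{t} \<star> H. c \<preceq> a \<and> c \<preceq> b" if ab: "a \<in> {t} \<star> H" "b \<in> {t} \<star> H" for a b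
    proof -
      obtain h h' where h: "h \<in> H" "t \<otimes> h \<preceq> a" "h' \<in> H" "t \<otimes> h' \<preceq> b" "a \<in> carrier S" "b \<in> carrier S"
        using ab by (auto simp: mem)
      obtain k where k: "k \<in> H" "k \<preceq> h" "k \<preceq> h'" using cp_filter_directed [OF H(1) h(1,3)] by blast
      have "t \<otimes> k \<preceq> t \<otimes> h" "t \<otimes> k \<preceq> t \<otimes> h'" using k h t sub by (auto intro!: mult_mono)
      then have "t \<otimes> k \<preceq> a" "t \<otimes> k \<preceq> b" using h leq_trans by blast+
      moreover have "t \<otimes> k \<in> {t} \<star> H" using k t sub by (auto simp: mem intro!: bexI [of _ k])
      ultimately show ?thesis by blast
    qed
    show "\<exists>c\<in>C. c \<in> {t} \<star> H" if C: "compatible S C" "\<Or>C \<in> {t} \<star> H" for C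
    proof -
      obtain h where h: "h \<in> H" "t \<otimes> h \<preceq> \<Or>C" using C by (auto simp: mem)
      then have [simp]: "h \<in> carrier S" using sub by auto
      have "t\<^sup>- \<otimes> (t \<otimes> h) \<preceq> t\<^sup>- \<otimes> \<Or>C" using h C t by (intro mult_mono) auto
      moreover have "t\<^sup>- \<otimes> t \<otimes> h \<in> H" using t h mult by blast
      ultimately have "t\<^sup>- \<otimes> \<Or>C \<in> H"
        using C t cp_filter_up [OF H(1), of "t\<^sup>- \<otimes> t \<otimes> h" "t\<^sup>- \<otimes> \<Or>C"] by (simp add: m_assoc)
      then obtain c where c: "c \<in> C" "t\<^sup>- \<otimes> c \<in> H"
        using cp_filter_prime_left [OF H(1) C(1), of "t\<^sup>-"] t by auto
      have "c \<in> carrier S" using compatible_carrier C(1) c(1) .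
      moreover have "t \<otimes> (t\<^sup>- \<otimes> c) \<preceq> c" using t \<open>c \<in> carrier S\<close> by (simp flip: m_assoc)
      ultimately show ?thesis using c by (auto simp: mem)
    qed
  qed
  have "fdom ({t} \<star> H) = H \<star> {t\<^sup>-} \<star> ({t} \<star> H)"
    using t sub fpinv_fmult [of "{t}" H] by (simp add: inv)
  also have "\<dots> = H \<star> ({t\<^sup>-} \<star> {t}) \<star> H"
    using t sub fmult_subset by (simp add: fmult_assoc)
  also have "\<dots> = H"
  proof (intro equalityI subsetI)
    fix x assume "x \<in> H"
    then obtain e where e: "e \<in> H" "e \<in> E" "e \<preceq> x" using idem by blast
    have "e \<otimes> (t\<^sup>- \<otimes> t) \<otimes> e \<preceq> e \<otimes> \<one> \<otimes> e"
      using t e by (intro mult_mono) (auto intro: leqI [of "t\<^sup>- \<otimes> t"])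
    then have "e \<otimes> (t\<^sup>- \<otimes> t) \<otimes> e \<preceq> x"
      using e \<open>x \<in> H\<close> sub leq_trans [of _ e x] by (auto simp: idem_idem)
    moreover have "t\<^sup>- \<otimes> t \<in> {t\<^sup>-} \<star> {t}" using t by (auto intro: mult_in_fmult)
    ultimately show "x \<in> H \<star> ({t\<^sup>-} \<star> {t}) \<star> H"
      using e sub \<open>x \<in> H\<close> unfolding mem_fmult3 [OF sub fmult_subset sub] by blast
  next
    fix x assume "x \<in> H \<star> ({t\<^sup>-} \<star> {t}) \<star> H"
    then obtain a b c where abc: "a \<in> H" "b \<in> {t\<^sup>-} \<star> {t}" "c \<in> H" "a \<otimes> b \<otimes> c \<preceq> x" "x \<in> carrier S"
      unfolding mem_fmult3 [OF sub fmult_subset sub] by blast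
    then have "b \<in> H" using t cp_filter_up [OF H(1)] by (auto simp: mem_fmult)
    then have "a \<otimes> b \<otimes> c \<in> H" using abc mult by blast
    then show "x \<in> H" using abc cp_filter_up [OF H(1)] by blast
  qed
  finally show "fdom ({t} \<star> H) = H" .
qed

text \<open>For F containing s t, let B be the translate of d(F) by t, which exists since (s t)^- (s
  t) \<le> t^- t, and let A = F B^{-1}. Then A B = F since d(B) = d(F), and s lies in A since s t
  t^- \<le> s.\<close>

lemma X_set_mult:
  assumes [simp]: "s \<in> carrier S" "t \<in> carrier S"
  shows "gset_mult FG (X_set S s) (X_set S t) = X_set S (s \<otimes> t)"
proof (intro equalityI subsetI)
  fix F assume "F \<in> gset_mult FG (X_set S s) (X_set S t)"
  then obtain A B where AB: "A \<in> cp_filters S" "B \<in> cp_filters S" "s \<in> A" "t \<in> B" "fdom A = fcod B"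
      "F = A \<star> B"
    by (auto simp: mem_gset_mult FG.composable_iff X_set_def)
  then show "F \<in> X_set S (s \<otimes> t)"
    using fmult_cp_filters [OF AB(1,2,5)] cp_filter_subset
    by (auto simp: X_set_def intro!: mult_in_fmult)
next
  fix F assume "F \<in> X_set S (s \<otimes> t)"
  then have F: "F \<in> cp_filters S" "s \<otimes> t \<in> F" by (auto simp: X_set_def)
  have sub: "F \<subseteq> carrier S" by (rule cp_filter_subset [OF F(1)])
  let ?D = "fdom F"
  have D: "?D \<in> cp_filters S" by (rule fdom_cp_filters [OF F(1)])
  have "(s \<otimes> t)\<^sup>- \<otimes> (s \<otimes> t) = t\<^sup>- \<otimes> ((s\<^sup>- \<otimes> s) \<otimes> t)" by (simp add: pinv_mult m_assoc)
  also have "\<dots> \<preceq> t\<^sup>- \<otimes> t" by (intro mult_mono) auto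
  finally have "t\<^sup>- \<otimes> t \<in> ?D" using cp_filter_up [OF D fdom_idem [OF F]] by simp
  moreover have "fdom ?D = ?D" using sub F by (simp add: fdom_fdom)
  ultimately have B: "{t} \<star> ?D \<in> cp_filters S" "fdom ({t} \<star> ?D) = ?D" "t \<in> {t} \<star> ?D"
    using translate_cp_filter [OF D] by auto
  define B where "B = {t} \<star> ?D"
  note B = B [folded B_def]
  have subB: "B \<subseteq> carrier S" by (rule cp_filter_subset [OF B(1)])
  have A: "F \<star> fpinv B \<in> cp_filters S"
    using F B subB by (intro fmult_cp_filters fpinv_cp_filters) auto
  have "s \<otimes> t \<otimes> t\<^sup>- \<in> F \<star> fpinv B" using F B subB sub by (intro mult_in_fmult) auto
  moreover have "s \<otimes> t \<otimes> t\<^sup>- \<preceq> s" by (simp add: m_assoc)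
  ultimately have "s \<in> F \<star> fpinv B" using fmult_up by auto
  moreover have "fdom (F \<star> fpinv B) = fcod B"
    using fdom_fmult(1) [OF F(1) fpinv_cp_filters [OF B(1)]] B subB by simp
  moreover have "F \<star> fpinv B \<star> B = F"
    using sub subB by (simp add: fmult_assoc B(2) fmult_fdom F)
  ultimately show "F \<in> gset_mult FG (X_set S s) (X_set S t)"
    using A B by (intro gset_multI [of "F \<star> fpinv B" _ B]) (auto simp: FG.composable_iff X_set_def)
qed

lemma X_set_pinv:
  assumes "s \<in> carrier S"
  shows "fpinv ` X_set S s = X_set S s\<^sup>-"
proof (intro equalityI subsetI)
  fix F assume "F \<in> X_set S s\<^sup>-"
  then have "fpinv F \<in> X_set S s" "F = fpinv (fpinv F)"
    using assms cp_filter_subset [of F S] by (auto simp: X_set_def fpinv_cp_filters mem_fpinv)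
  then show "F \<in> fpinv ` X_set S s" by blast
qed (auto simp: X_set_def fpinv_cp_filters)

text \<open>A filter F containing the unit equals d(F) by \<open>eq_fmult_fdom\<close> with s the
  unit. Conversely, an identity filter contains some a^- a, which lies below the unit.\<close>

lemma X_set_one: "X_set S \<one> = identities FG"
proof (intro equalityI subsetI)
  fix F assume "F \<in> X_set S \<one>"
  then have F: "F \<in> cp_filters S" "\<one> \<in> F" by (auto simp: X_set_def)
  have sub: "F \<subseteq> carrier S" by (rule cp_filter_subset [OF F(1)])
  have "F = {\<one>} \<star> fdom F" by (rule eq_fmult_fdom [OF F])
  also have "\<dots> = fdom F"
  proof (rule Set.set_eqI)
    note D = fdom_cp_filters [OF F(1)]
    fix t
    have "t \<in> {\<one>} \<star> fdom F \<longleftrightarrow> t \<in> carrier S \<and> (\<exists>d\<in>fdom F. d \<preceq> t)"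
      using cp_filter_subset [OF D] by (auto simp: mem_fmult [of t "{\<one>}"] subset_iff)
    also have "\<dots> \<longleftrightarrow> t \<in> fdom F"
      using cp_filter_up [OF D] cp_filter_subset [OF D] leq_refl by blast
    finally show "t \<in> {\<one>} \<star> fdom F \<longleftrightarrow> t \<in> fdom F" .
  qed
  finally show "F \<in> identities FG" using F by (simp add: identities_def)
next
  fix F assume "F \<in> identities FG"
  then have F: "F \<in> cp_filters S" "fdom F = F" by (auto simp: identities_def)
  obtain a where a: "a \<in> F" using cp_filter_nonempty [OF F(1)] by blast
  then have "a \<in> carrier S" using cp_filter_subset [OF F(1)] by blast
  then have "a\<^sup>- \<otimes> a \<preceq> \<one>" by (intro leqI [of "a\<^sup>- \<otimes> a"]) auto
  moreover have "a\<^sup>- \<otimes> a \<in> F" using fdom_idem [OF F(1) a] F(2) by simp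
  ultimately show "F \<in> X_set S \<one>" using F cp_filter_up [OF F(1)] by (simp add: X_set_def)
qed

lemma X_set_meet:
  assumes "s \<in> carrier S" "t \<in> carrier S"
  shows "X_set S (s \<sqinter>\<sqinter> t) = X_set S s \<inter> X_set S t"
proof -
  have "s \<sqinter>\<sqinter> t \<in> F \<longleftrightarrow> s \<in> F \<and> t \<in> F" if F: "F \<in> cp_filters S" for F
  proof
    assume "s \<sqinter>\<sqinter> t \<in> F"
    with assms show "s \<in> F \<and> t \<in> F"
      using cp_filter_up [OF F _ _ meet_le1 [OF assms]] cp_filter_up [OF F _ _ meet_le2 [OF assms]]
      by simp
  next
    assume "s \<in> F \<and> t \<in> F"
    then obtain c where "c \<in> F" "c \<preceq> s" "c \<preceq> t" using cp_filter_directed [OF F] by blast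
    then show "s \<sqinter>\<sqinter> t \<in> F" using assms by (blast intro: cp_filter_up [OF F] meet_greatest)
  qed
  then show ?thesis by (auto simp: X_set_def)
qed

lemma X_set_join:
  assumes "compatible S A"
  shows "X_set S (\<Or>A) = (\<Union>a\<in>A. X_set S a)"
  using assms cp_filter_prime [OF _ assms] join_upper [OF assms]
  by (auto simp: X_set_def intro: cp_filter_up)

end

text \<open>Spatiality is injectivity of s \<mapsto> X_s. Because meets go to intersections,
  injectivity already implies that the order is reflected.\<close>

lemma (in spatial_pseudogroup) X_set_subset_iff:
  assumes [simp]: "s \<in> carrier S" "t \<in> carrier S"
  shows "X_set S s \<subseteq> X_set S t \<longleftrightarrow> s \<preceq> t"
proof
  assume "X_set S s \<subseteq> X_set S t"
  then have "X_set S (s \<sqinter>\<sqinter> t) = X_set S s" by (auto simp: X_set_meet)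
  then have "s \<sqinter>\<sqinter> t = s" by (intro spatial) auto
  then show "s \<preceq> t" using meet_le2 [of s t] by simp
qed (auto simp: X_set_def intro: cp_filter_up)

section \<open>Monoids represented by open bisections\<close>

text \<open>Only the product and the unit are assumed to be represented; associativity, inverses and
  joins are transported along \<beta>. The element type of S is arbitrary, so the results apply
  alike to the open bisections themselves, to their relabellings, and to a spatial pseudogroup
  represented on its spectrum.\<close>

locale bisection_model = etale_groupoid G for G :: "('b, 'd) top_groupoid_scheme" +
  fixes S :: "('a, 'c) monoid_scheme" (structure) and \<beta> :: "'a \<Rightarrow> 'b set"
  assumes bij: "bij_betw \<beta> (carrier S) (open_bisections G)"
    and mult_closed: "\<lbrakk>s \<in> carrier S; t \<in> carrier S\<rbrakk> \<Longrightarrow> s \<otimes> t \<in> carrier S"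
    and rep_mult: "\<lbrakk>s \<in> carrier S; t \<in> carrier S\<rbrakk> \<Longrightarrow> \<beta> (s \<otimes> t) = gset_mult G (\<beta> s) (\<beta> t)"
    and one_carrier: "\<one> \<in> carrier S"
    and rep_one: "\<beta> \<one> = identities G"
begin

lemma rep_open: "s \<in> carrier S \<Longrightarrow> \<beta> s \<in> open_bisections G"
  using bij by (auto simp: bij_betw_def)

lemma rep_eq_iff: "\<lbrakk>s \<in> carrier S; t \<in> carrier S\<rbrakk> \<Longrightarrow> \<beta> s = \<beta> t \<longleftrightarrow> s = t"
  using bij by (auto simp: bij_betw_def inj_on_def)

lemma rep_bisection: "s \<in> carrier S \<Longrightarrow> bisection G (\<beta> s)"
  and rep_subset: "s \<in> carrier S \<Longrightarrow> \<beta> s \<subseteq> carrier G"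
  and rep_openin: "s \<in> carrier S \<Longrightarrow> openin (gtop G) (\<beta> s)"
  using rep_open open_bisectionsD by blast+

lemma rep_surj:
  assumes "A \<in> open_bisections G"
  obtains s where "s \<in> carrier S" "\<beta> s = A"
  using assms bij unfolding bij_betw_def by (metis imageE)

lemma rep_cover:
  assumes "openin (gtop G) U" "g \<in> U"
  obtains s where "s \<in> carrier S" "g \<in> \<beta> s" "\<beta> s \<subseteq> U"
  using open_bisections_basis [OF assms] rep_surj by metis

lemma is_pinv_iff:
  assumes "s \<in> carrier S"
  shows "is_pinv S s t \<longleftrightarrow> t \<in> carrier S \<and> \<beta> t = ginv G ` \<beta> s"
proof (cases "t \<in> carrier S")
  case True
  with assms show ?thesis
    by (simp add: is_pinv_def eq_ginv_image_iff rep_bisection mult_closed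
        flip: rep_eq_iff rep_mult)
qed (simp add: is_pinv_def)

sublocale inverse_monoid S
proof
  fix x y z assume "x \<in> carrier S" "y \<in> carrier S" "z \<in> carrier S"
  then show "x \<otimes> y \<otimes> z = x \<otimes> (y \<otimes> z)"
    by (simp add: mult_closed rep_mult gset_mult_assoc flip: rep_eq_iff)
next
  fix x assume "x \<in> carrier S"
  then show "\<one> \<otimes> x = x" "x \<otimes> \<one> = x"
    by (simp_all add: mult_closed one_carrier rep_mult rep_one rep_subset
        gset_mult_identities_left gset_mult_identities_right flip: rep_eq_iff)
next
  fix s assume s: "s \<in> carrier S"
  have "ginv G ` \<beta> s \<in> open_bisections G" by (intro open_bisections_ginv rep_open s)
  then obtain t where "t \<in> carrier S" "\<beta> t = ginv G ` \<beta> s" by (rule rep_surj)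
  then show "\<exists>!t. is_pinv S s t"
    using rep_eq_iff unfolding is_pinv_iff [OF s] by metis
qed (auto simp: mult_closed one_carrier)

lemma rep_pinv: "s \<in> carrier S \<Longrightarrow> \<beta> s\<^sup>- = ginv G ` \<beta> s"
  using is_pinv_pinv is_pinv_iff by blast

lemma rep_idem:
  assumes s: "s \<in> carrier S"
  shows "s \<in> E \<longleftrightarrow> \<beta> s \<subseteq> identities G"
proof -
  have "s \<in> E \<longleftrightarrow> s \<otimes> s = s" using s idemI idem_idem by blast
  also have "\<dots> \<longleftrightarrow> \<beta> (s \<otimes> s) = \<beta> s" by (rule rep_eq_iff [symmetric]) (use s in auto)
  also have "\<dots> \<longleftrightarrow> \<beta> s \<subseteq> identities G"
    unfolding rep_mult [OF s s] by (rule idempotent_bisection_iff [OF rep_bisection [OF s]])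
  finally show ?thesis .
qed

text \<open>If \<beta> s is contained in \<beta> t, restricting \<beta> t to the domain of \<beta> s
  gives back \<beta> s, and this restriction represents t (s^- s).\<close>

lemma rep_leq:
  assumes [simp]: "s \<in> carrier S" "t \<in> carrier S"
  shows "s \<preceq> t \<longleftrightarrow> \<beta> s \<subseteq> \<beta> t"
proof
  assume "s \<preceq> t"
  then obtain e where e: "e \<in> E" "s = t \<otimes> e" by (auto simp: leq_def)
  then have "\<beta> s = gset_mult G (\<beta> t) (\<beta> e)" by (simp add: rep_mult)
  also have "\<dots> \<subseteq> gset_mult G (\<beta> t) (identities G)"
    using e(1) rep_idem by (intro gset_mult_mono) auto
  finally show "\<beta> s \<subseteq> \<beta> t" by (simp add: gset_mult_identities_right rep_subset)
next
  assume sub: "\<beta> s \<subseteq> \<beta> t"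
  have "\<beta> (t \<otimes> (s\<^sup>- \<otimes> s)) = gset_mult G (\<beta> t) (gdom G ` \<beta> s)"
    by (simp add: rep_mult rep_pinv gset_mult_ginv_self rep_bisection)
  also have "\<dots> = \<beta> s" by (rule bisection_times_gdom [OF rep_bisection sub]) simp
  finally have "s = t \<otimes> (s\<^sup>- \<otimes> s)" by (simp add: rep_eq_iff)
  then show "s \<preceq> t" using leqI idem_pinv_left assms(1) by metis
qed

lemma least_if_rep_UN:
  assumes "A \<subseteq> carrier S" "j \<in> carrier S" "\<beta> j = (\<Union>a\<in>A. \<beta> a)"
  shows "least (nat_order S) j (Upper (nat_order S) A)"
  using assms by (auto simp: least_def Upper_def rep_leq subset_iff)

lemma join_if_rep_UN:
  assumes "A \<subseteq> carrier S" "j \<in> carrier S" "\<beta> j = (\<Union>a\<in>A. \<beta> a)"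
  shows "\<Or>A = j"
  using assms by (intro join_eqI) (auto simp: rep_leq subset_iff)

text \<open>Idempotence of s t^- says that d is injective across the bisections of s and t, and
  idempotence of s^- t says the same of r. So compatible families are those whose union is a
  bisection, and joins are unions.\<close>

lemma compatible_iff:
  assumes A: "A \<subseteq> carrier S"
  shows "compatible S A \<longleftrightarrow> (\<exists>j\<in>carrier S. \<beta> j = (\<Union>a\<in>A. \<beta> a))"
proof
  assume comp: "compatible S A"
  have "bisection G (\<Union>a\<in>A. \<beta> a)"
    unfolding bisection_iff
  proof (intro conjI inj_onI)
    show "(\<Union>a\<in>A. \<beta> a) \<subseteq> carrier G" using A rep_subset by blast
  next
    fix x y assume "x \<in> (\<Union>a\<in>A. \<beta> a)" "y \<in> (\<Union>a\<in>A. \<beta> a)"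
    then obtain s t where st: "s \<in> A" "t \<in> A" "x \<in> \<beta> s" "y \<in> \<beta> t" by auto
    then have c: "s \<in> carrier S" "t \<in> carrier S" using A by auto
    then have xy: "x \<in> carrier G" "y \<in> carrier G" using st rep_subset by blast+
    have "s \<otimes> t\<^sup>- \<in> E" "s\<^sup>- \<otimes> t \<in> E" using comp st by (auto simp: compatible_def)
    then have *: "gset_mult G (\<beta> s) (ginv G ` \<beta> t) \<subseteq> identities G"
      "gset_mult G (ginv G ` \<beta> s) (\<beta> t) \<subseteq> identities G"
      using rep_idem c by (simp_all add: rep_mult rep_pinv)
    {
      assume eq: "gdom G x = gdom G y"
      then have "x \<cdot> ginv G y \<in> gset_mult G (\<beta> s) (ginv G ` \<beta> t)"
        using st xy by (intro gset_multI [of x _ "ginv G y"]) (auto simp: composable_iff groupoid_simps)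
      then show "x = y" using * gmult_ginv_eq_iff [OF xy eq] by blast
    next
      assume eq: "gcod G x = gcod G y"
      then have "ginv G x \<cdot> y \<in> gset_mult G (ginv G ` \<beta> s) (\<beta> t)"
        using st xy by (intro gset_multI [of "ginv G x" _ y]) (auto simp: composable_iff groupoid_simps)
      then show "x = y" using * ginv_gmult_eq_iff [OF xy eq] by blast
    }
  qed
  moreover have "openin (gtop G) (\<Union>a\<in>A. \<beta> a)" using A rep_openin by blast
  ultimately have "(\<Union>a\<in>A. \<beta> a) \<in> open_bisections G" by (simp add: open_bisections_def)
  then show "\<exists>j\<in>carrier S. \<beta> j = (\<Union>a\<in>A. \<beta> a)" by (metis rep_surj)
next
  assume "\<exists>j\<in>carrier S. \<beta> j = (\<Union>a\<in>A. \<beta> a)"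
  then obtain j where j: "j \<in> carrier S" "\<beta> j = (\<Union>a\<in>A. \<beta> a)" by blast
  then show "compatible S A"
    using A by (intro compatible_bounded [of _ j]) (auto simp: rep_leq subset_iff)
qed

lemma
  assumes A: "compatible S A"
  shows join_carrier: "\<Or>A \<in> carrier S" and rep_join: "\<beta> (\<Or>A) = (\<Union>a\<in>A. \<beta> a)"
proof -
  have c: "A \<subseteq> carrier S" using A by (simp add: compatible_def)
  then obtain j where "j \<in> carrier S" "\<beta> j = (\<Union>a\<in>A. \<beta> a)" using A compatible_iff [OF c] by metis
  with join_if_rep_UN [OF c this] show "\<Or>A \<in> carrier S" "\<beta> (\<Or>A) = (\<Union>a\<in>A. \<beta> a)" by simp_all
qed

lemma rep_meet:
  assumes [simp]: "s \<in> carrier S" "t \<in> carrier S"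
  shows "s \<sqinter>\<sqinter> t \<in> carrier S" "\<beta> (s \<sqinter>\<sqinter> t) = \<beta> s \<inter> \<beta> t"
proof -
  have "\<beta> s \<inter> \<beta> t \<in> open_bisections G" by (simp add: open_bisections_Int rep_open)
  then obtain m where m: "m \<in> carrier S" "\<beta> m = \<beta> s \<inter> \<beta> t" by (rule rep_surj)
  then have "s \<sqinter>\<sqinter> t = m" by (intro meet_eqI) (auto simp: rep_leq)
  with m show "s \<sqinter>\<sqinter> t \<in> carrier S" "\<beta> (s \<sqinter>\<sqinter> t) = \<beta> s \<inter> \<beta> t" by simp_all
qed

sublocale pseudogroup S
proof
  fix A assume A: "compatible S A"
  then have c: "A \<subseteq> carrier S" by (simp add: compatible_def)
  show "\<exists>j. least (nat_order S) j (Upper (nat_order S) A)"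
    using least_if_rep_UN [OF c join_carrier [OF A] rep_join [OF A]] by blast
  fix s assume s: "s \<in> carrier S"
  show "s \<otimes> \<Or>A = \<Or>((\<lambda>a. s \<otimes> a) ` A)"
  proof (rule join_if_rep_UN [symmetric])
    have "\<beta> (s \<otimes> \<Or>A) = (\<Union>a\<in>A. gset_mult G (\<beta> s) (\<beta> a))"
      using s by (simp add: rep_mult rep_join join_carrier A) (auto simp: gset_mult_def)
    also have "\<dots> = (\<Union>a\<in>A. \<beta> (s \<otimes> a))"
      using s c by (intro SUP_cong) (auto simp: rep_mult)
    finally show "\<beta> (s \<otimes> \<Or>A) = (\<Union>a\<in>(\<lambda>a. s \<otimes> a) ` A. \<beta> a)" by simp
  qed (use s c A join_carrier in auto)
  show "\<Or>A \<otimes> s = \<Or>((\<lambda>a. a \<otimes> s) ` A)"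
  proof (rule join_if_rep_UN [symmetric])
    have "\<beta> (\<Or>A \<otimes> s) = (\<Union>a\<in>A. gset_mult G (\<beta> a) (\<beta> s))"
      using s by (simp add: rep_mult rep_join join_carrier A) (auto simp: gset_mult_def)
    also have "\<dots> = (\<Union>a\<in>A. \<beta> (a \<otimes> s))"
      using s c by (intro SUP_cong) (auto simp: rep_mult)
    finally show "\<beta> (\<Or>A \<otimes> s) = (\<Union>a\<in>(\<lambda>a. a \<otimes> s) ` A. \<beta> a)" by simp
  qed (use s c A join_carrier in auto)
qed

text \<open>For the open bisections themselves this is \<open>F_filter\<close>; in general it is
  that filter pulled back along \<beta>.\<close>

definition point :: "'b \<Rightarrow> 'a set" where
  "point g = {s \<in> carrier S. g \<in> \<beta> s}"

lemma mem_point [simp]: "s \<in> point g \<longleftrightarrow> s \<in> carrier S \<and> g \<in> \<beta> s"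
  by (simp add: point_def)

lemma point_cp_filter:
  assumes "g \<in> carrier G"
  shows "point g \<in> cp_filters S"
proof (rule cp_filtersI)
  show "point g \<noteq> {}"
    using rep_cover [of "carrier G" g] assms topspace_gtop openin_topspace
    by (metis empty_iff mem_point)
  show "b \<in> point g" if "a \<in> point g" "b \<in> carrier S" "a \<preceq> b" for a b
    using that by (auto simp: rep_leq)
  show "\<exists>c\<in>point g. c \<preceq> a \<and> c \<preceq> b" if "a \<in> point g" "b \<in> point g" for a b
    using that by (intro bexI [of _ "a \<sqinter>\<sqinter> b"]) (auto simp: rep_meet rep_leq)
  show "\<exists>a\<in>A. a \<in> point g" if "compatible S A" "\<Or>A \<in> point g" for A
    using that by (auto simp: rep_join dest: compatible_carrier)
qed auto

text \<open>The filters of arrows already separate elements: the filter of g belongs to X_s exactly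
  if g lies in \<beta> s.\<close>

sublocale spatial_pseudogroup S
proof
  fix s t assume st: "s \<in> carrier S" "t \<in> carrier S" "X_set S s = X_set S t"
  have "g \<in> \<beta> s \<longleftrightarrow> g \<in> \<beta> t" if "g \<in> carrier G" for g
  proof -
    have "point g \<in> X_set S s \<longleftrightarrow> point g \<in> X_set S t" using st(3) by simp
    then show ?thesis using st(1,2) point_cp_filter [OF that] by (simp add: X_set_def)
  qed
  then have "\<beta> s = \<beta> t" using rep_subset st by blast
  then show "s = t" using st rep_eq_iff by simp
qed

text \<open>The description uses only inclusions and unions of represented bisections. It has the
  same form for S and for the open bisections themselves, so passing between their filters is mere
  renaming.\<close>

lemma cp_filters_iff:
  "F \<in> cp_filters S \<longleftrightarrow> F \<subseteq> carrier S \<and> F \<noteq> {} \<and>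
    (\<forall>a\<in>F. \<forall>b\<in>carrier S. \<beta> a \<subseteq> \<beta> b \<longrightarrow> b \<in> F) \<and>
    (\<forall>a\<in>F. \<forall>b\<in>F. \<exists>c\<in>F. \<beta> c \<subseteq> \<beta> a \<and> \<beta> c \<subseteq> \<beta> b) \<and>
    (\<forall>A\<subseteq>carrier S. \<forall>j\<in>F. \<beta> j = (\<Union>a\<in>A. \<beta> a) \<longrightarrow> (\<exists>a\<in>A. a \<in> F))"
  (is "_ \<longleftrightarrow> ?R")
proof
  assume F: "F \<in> cp_filters S"
  have sub: "F \<subseteq> carrier S" by (rule cp_filter_subset [OF F])
  show ?R
  proof (intro conjI ballI allI impI)
    fix a b assume "a \<in> F" "b \<in> carrier S" "\<beta> a \<subseteq> \<beta> b"
    then show "b \<in> F" using cp_filter_up [OF F] sub by (auto simp: rep_leq)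
  next
    fix a b assume ab: "a \<in> F" "b \<in> F"
    then obtain c where "c \<in> F" "c \<preceq> a" "c \<preceq> b" using cp_filter_directed [OF F] by blast
    moreover from this sub ab have "a \<in> carrier S" "b \<in> carrier S" "c \<in> carrier S" by auto
    ultimately show "\<exists>c\<in>F. \<beta> c \<subseteq> \<beta> a \<and> \<beta> c \<subseteq> \<beta> b"
      using rep_leq by blast
  next
    fix A j assume A: "A \<subseteq> carrier S" "j \<in> F" "\<beta> j = (\<Union>a\<in>A. \<beta> a)"
    then have j: "j \<in> carrier S" using sub by blast
    have "compatible S A" using compatible_iff [OF A(1)] j A(3) by blast
    moreover have "\<Or>A \<in> F" using join_if_rep_UN [OF A(1) j A(3)] A(2) by simp
    ultimately show "\<exists>a\<in>A. a \<in> F" by (rule cp_filter_prime [OF F])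
  qed (use sub cp_filter_nonempty [OF F] in auto)
next
  assume R: ?R
  then have sub: "F \<subseteq> carrier S" by blast
  show "F \<in> cp_filters S"
  proof (rule cp_filtersI)
    show "b \<in> F" if "a \<in> F" "b \<in> carrier S" "a \<preceq> b" for a b
    proof -
      have "\<beta> a \<subseteq> \<beta> b" using that sub by (simp add: rep_leq [symmetric] subsetD)
      with R that show ?thesis by blast
    qed
    show "\<exists>c\<in>F. c \<preceq> a \<and> c \<preceq> b" if ab: "a \<in> F" "b \<in> F" for a b
    proof -
      have "\<forall>a\<in>F. \<forall>b\<in>F. \<exists>c\<in>F. \<beta> c \<subseteq> \<beta> a \<and> \<beta> c \<subseteq> \<beta> b" using R by (elim conjE)
      with ab obtain c where "c \<in> F" "\<beta> c \<subseteq> \<beta> a" "\<beta> c \<subseteq> \<beta> b" by metis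
      moreover from this sub ab have "a \<in> carrier S" "b \<in> carrier S" "c \<in> carrier S" by auto
      ultimately have "c \<preceq> a" "c \<preceq> b" by (simp_all add: rep_leq)
      with \<open>c \<in> F\<close> show ?thesis by blast
    qed
    show "\<exists>a\<in>A. a \<in> F" if A: "compatible S A" "\<Or>A \<in> F" for A
    proof -
      have "A \<subseteq> carrier S" using A(1) by (simp add: compatible_def)
      with R A(2) rep_join [OF A(1)] show ?thesis by blast
    qed
  qed (use R in auto)
qed

end

section \<open>The open bisections as a model of themselves, and sobriety\<close>

context etale_groupoid
begin

sublocale BP: bisection_model G "bisection_pseudogroup G" "\<lambda>A. A"
  by unfold_locales
    (auto simp: bisection_pseudogroup_def open_bisections_gset_mult open_bisections_identities bij_betw_def)

abbreviation BG where "BG \<equiv> bisection_pseudogroup G"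

lemma carrier_bisection_pseudogroup [simp]: "carrier BG = open_bisections G"
  by (simp add: bisection_pseudogroup_def)

lemma F_filter_eq_point: "F_filter G = BP.point"
  by (auto simp: F_filter_def fun_eq_iff)

lemma topspace_filter_groupoid_bisection_pseudogroup:
  "topspace (gtop (filter_groupoid BG)) = cp_filters BG"
  using cp_filter_nonempty cp_filter_subset by (fastforce simp: X_set_def)

text \<open>The preimage of X_A under \<open>F_filter\<close> is A itself, which gives continuity.
  Once every completely prime filter comes from an arrow, X_A is the image of A, which gives
  openness. Bijectivity is thus all that sobriety asks for.\<close>

lemma sober_iff:
  "homeomorphic_map (gtop G) (gtop (filter_groupoid BG)) (F_filter G) \<longleftrightarrow>
    bij_betw (F_filter G) (carrier G) (cp_filters BG)"
  (is "homeomorphic_map _ ?T _ \<longleftrightarrow> _")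
proof
  assume "homeomorphic_map (gtop G) ?T (F_filter G)"
  from homeomorphic_imp_injective_map [OF this] homeomorphic_imp_surjective_map [OF this]
  show "bij_betw (F_filter G) (carrier G) (cp_filters BG)"
    by (simp only: bij_betw_def topspace_gtop topspace_filter_groupoid_bisection_pseudogroup)
next
  assume bij: "bij_betw (F_filter G) (carrier G) (cp_filters BG)"
  show "homeomorphic_map (gtop G) ?T (F_filter G)"
  proof (rule bijective_open_imp_homeomorphic_map)
    have "F_filter G -` X_set BG A \<inter> carrier G = A"
      if "A \<in> open_bisections G" for A
      using that BP.point_cp_filter open_bisectionsD(3) [OF that]
      by (auto simp: X_set_def F_filter_eq_point)
    moreover have "F_filter G ` carrier G \<subseteq> topspace ?T"
      unfolding topspace_filter_groupoid_bisection_pseudogroup using bij by (simp add: bij_betw_def)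
    ultimately show "continuous_map (gtop G) ?T (F_filter G)"
      by (auto simp: continuous_on_generated_topo_iff topspace_gtop open_bisectionsD)
    show "open_map (gtop G) ?T (F_filter G)"
      unfolding open_map_def
    proof (intro allI impI)
      fix U assume U: "openin (gtop G) U"
      show "openin ?T (F_filter G ` U)"
      proof (subst openin_subopen, clarify)
        fix g assume "g \<in> U"
        with U obtain A where A: "A \<in> open_bisections G" "g \<in> A" "A \<subseteq> U"
          by (rule open_bisections_basis)
        have "X_set BG A \<subseteq> F_filter G ` U"
        proof
          fix F assume F: "F \<in> X_set BG A"
          then obtain h where "h \<in> carrier G" "F = F_filter G h"
            using bij by (auto simp: X_set_def bij_betw_def)
          with F A show "F \<in> F_filter G ` U" by (auto simp: X_set_def F_filter_def)
        qed
        moreover have "F_filter G g \<in> X_set BG A"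
          using A BP.point_cp_filter open_bisectionsD(3) by (auto simp: X_set_def F_filter_eq_point)
        moreover have "openin ?T (X_set BG A)"
          using A by (auto intro: topology_generated_by_Basis)
        ultimately show "\<exists>T. openin ?T T \<and> F_filter G g \<in> T \<and> T \<subseteq> F_filter G ` U" by blast
      qed
    qed
  qed (use bij in \<open>simp_all only: bij_betw_def topspace_gtop topspace_filter_groupoid_bisection_pseudogroup\<close>)
qed

end

context bisection_model
begin

lemma image_cp_filters_iff:
  assumes "F \<subseteq> carrier S"
  shows "\<beta> ` F \<in> cp_filters BG \<longleftrightarrow> F \<in> cp_filters S"
proof -
  have img: "\<beta> ` carrier S = open_bisections G" using bij by (simp add: bij_betw_def)
  have mem: "\<beta> b \<in> \<beta> ` F \<longleftrightarrow> b \<in> F" if "b \<in> carrier S" for b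
    using assms that rep_eq_iff by blast
  \<comment> \<open>Families of open bisections are the images of families in S; this rewrites the
    quantifier in the primeness clause.\<close>
  have sub: "(\<forall>A\<subseteq>open_bisections G. P A) \<longleftrightarrow> (\<forall>A\<subseteq>carrier S. P (\<beta> ` A))" for P
    unfolding img [symmetric] by (metis image_mono subset_imageE)
  have "\<beta> ` F \<in> cp_filters BG \<longleftrightarrow> F \<noteq> {} \<and>
      (\<forall>a\<in>F. \<forall>b\<in>carrier S. \<beta> a \<subseteq> \<beta> b \<longrightarrow> \<beta> b \<in> \<beta> ` F) \<and>
      (\<forall>a\<in>F. \<forall>b\<in>F. \<exists>c\<in>F. \<beta> c \<subseteq> \<beta> a \<and> \<beta> c \<subseteq> \<beta> b) \<and>
      (\<forall>A\<subseteq>carrier S. \<forall>j\<in>F. \<beta> j = (\<Union>a\<in>A. \<beta> a) \<longrightarrow> (\<exists>a\<in>A. \<beta> a \<in> \<beta> ` F))"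
    using assms unfolding BP.cp_filters_iff carrier_bisection_pseudogroup sub
    unfolding img [symmetric] by (simp add: image_mono image_iff eq_commute)
  also have "\<dots> \<longleftrightarrow> F \<in> cp_filters S"
    using assms mem unfolding cp_filters_iff by (smt (verit, ccfv_threshold) subsetD)
  finally show ?thesis .
qed

text \<open>Taking images under \<beta> is a bijection between the completely prime filters on the
  two sides, and its composite with \<open>point\<close> is \<open>F_filter\<close>.\<close>

lemma bij_betw_point_iff:
  "bij_betw point (carrier G) (cp_filters S) \<longleftrightarrow>
    bij_betw (F_filter G) (carrier G) (cp_filters BG)"
proof -
  have img: "\<beta> ` carrier S = open_bisections G" using bij by (simp add: bij_betw_def)
  have "bij_betw ((`) \<beta>) (cp_filters S) (cp_filters BG)"
    unfolding bij_betw_def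
  proof (intro conjI equalityI subsetI)
    show "inj_on ((`) \<beta>) (cp_filters S)"
    proof (rule inj_onI)
      fix F F' assume F: "F \<in> cp_filters S" "F' \<in> cp_filters S" "\<beta> ` F = \<beta> ` F'"
      have "inj_on \<beta> (carrier S)" using bij by (simp add: bij_betw_def)
      with F(3) cp_filter_subset [OF F(1)] cp_filter_subset [OF F(2)] show "F = F'"
        by (simp add: inj_on_image_eq_iff)
    qed
    show "F \<in> cp_filters BG" if "F \<in> (`) \<beta> ` cp_filters S" for F
      using that image_cp_filters_iff cp_filter_subset by blast
    show "F \<in> (`) \<beta> ` cp_filters S" if F: "F \<in> cp_filters BG" for F
    proof -
      obtain F' where "F' \<subseteq> carrier S" "F = \<beta> ` F'"
        using cp_filter_subset [OF F] by (auto simp: subset_image_iff simp flip: img)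
      with F show ?thesis using image_cp_filters_iff by blast
    qed
  qed
  moreover have "point ` carrier G \<subseteq> cp_filters S" using point_cp_filter by blast
  ultimately have "bij_betw point (carrier G) (cp_filters S) \<longleftrightarrow>
      bij_betw ((`) \<beta> \<circ> point) (carrier G) (cp_filters BG)"
    by (rule bij_betw_comp_iff2)
  moreover have "((`) \<beta> \<circ> point) = F_filter G"
  proof (rule ext, rule Set.set_eqI)
    fix g A
    have "A \<in> \<beta> ` point g \<longleftrightarrow> A \<in> \<beta> ` carrier S \<and> g \<in> A" by auto
    then show "A \<in> ((`) \<beta> \<circ> point) g \<longleftrightarrow> A \<in> F_filter G g" by (simp add: F_filter_def img)
  qed
  ultimately show ?thesis by simp
qed

end

text \<open>For a model this bijection is equivalent to sobriety of G, by
  \<open>bij_betw_point_iff\<close> and \<open>sober_iff\<close>. It is stated for S because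
  morphisms of monoids act on filters of S.\<close>

locale duality = bisection_model +
  assumes points: "bij_betw point (carrier G) (cp_filters S)"
begin

sublocale sober_etale_groupoid G
  by unfold_locales (use points sober_iff bij_betw_point_iff in blast)

lemma point_eq_iff: "\<lbrakk>g \<in> carrier G; h \<in> carrier G\<rbrakk> \<Longrightarrow> point g = point h \<longleftrightarrow> g = h"
  using points by (auto simp: bij_betw_def inj_on_def)

end

section \<open>Relabelled spectra\<close>

definition spectrum :: "('a set \<Rightarrow> 'b) \<Rightarrow> ('a, 'c) monoid_scheme \<Rightarrow> 'b top_groupoid" where
  "spectrum f S =
     (let G = filter_groupoid S; g = the_inv_into (cp_filters S) f in
      \<lparr>carrier = f ` cp_filters S,
       gdom = (\<lambda>x. f (gdom G (g x))),
       gcod = (\<lambda>x. f (gcod G (g x))),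
       gmult = (\<lambda>x y. f (gmult G (g x) (g y))),
       ginv = (\<lambda>x. f (ginv G (g x))),
       gtop = topology_generated_by ((\<lambda>s. f ` X_set S s) ` carrier S)\<rparr>)"

locale labelled_spectrum = spatial_pseudogroup S
  for S :: "('a, 'c) monoid_scheme" (structure) +
  fixes f :: "'a set \<Rightarrow> 'b"
  assumes inj: "inj_on f (cp_filters S)"
begin

lemma f_eq_iff: "\<lbrakk>A \<in> cp_filters S; B \<in> cp_filters S\<rbrakk> \<Longrightarrow> f A = f B \<longleftrightarrow> A = B"
  using inj by (auto simp: inj_on_def)

abbreviation K where "K \<equiv> spectrum f S"

lemma spectrum_simps:
  "carrier K = f ` cp_filters S"
  "gtop K = topology_generated_by ((\<lambda>s. f ` X_set S s) ` carrier S)"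
  "A \<in> cp_filters S \<Longrightarrow> gdom K (f A) = f (fdom A)"
  "A \<in> cp_filters S \<Longrightarrow> gcod K (f A) = f (fcod A)"
  "A \<in> cp_filters S \<Longrightarrow> ginv K (f A) = f (fpinv A)"
  "\<lbrakk>A \<in> cp_filters S; B \<in> cp_filters S\<rbrakk> \<Longrightarrow> gmult K (f A) (f B) = f (A \<star> B)"
  by (simp_all add: spectrum_def Let_def the_inv_into_f_f [OF inj])

lemma mem_image_X_set:
  "F \<in> cp_filters S \<Longrightarrow> f F \<in> f ` X_set S s \<longleftrightarrow> s \<in> F"
  using f_eq_iff by (auto simp: X_set_def)

sublocale K: groupoid K
proof
  fix x y z
  assume "x \<in> carrier K" "y \<in> carrier K" "z \<in> carrier K"
    "gdom K x = gcod K y" "gdom K y = gcod K z"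
  then obtain A B C where "A \<in> cp_filters S" "B \<in> cp_filters S" "C \<in> cp_filters S"
    "x = f A" "y = f B" "z = f C" "fdom A = fcod B" "fdom B = fcod C"
    by (auto simp: spectrum_simps f_eq_iff fdom_cp_filters fcod_cp_filters)
  then show "gmult K (gmult K x y) z =
      gmult K x (gmult K y z)"
    by (simp add: spectrum_simps fmult_cp_filters fdom_fmult fmult_assoc cp_filter_subset)
qed (auto simp: spectrum_simps f_eq_iff fdom_cp_filters fcod_cp_filters cp_filter_subset fdom_fdom
      fcod_fcod fmult_cp_filters fdom_fmult fmult_fdom fcod_fmult fpinv_cp_filters)

lemma gset_mult_spectrum:
  assumes "U \<subseteq> cp_filters S" "V \<subseteq> cp_filters S"
  shows "gset_mult K (f ` U) (f ` V) = f ` gset_mult FG U V"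
proof -
  have "(f A, f B) \<in> composable K \<longleftrightarrow> (A, B) \<in> composable FG"
    if "A \<in> U" "B \<in> V" for A B
  proof -
    have "A \<in> cp_filters S" "B \<in> cp_filters S" using assms that by auto
    then show ?thesis
      by (simp add: K.composable_iff FG.composable_iff spectrum_simps f_eq_iff
          fdom_cp_filters fcod_cp_filters)
  qed
  moreover have "gmult K (f A) (f B) = f (A \<star> B)" if "A \<in> U" "B \<in> V" for A B
    using assms that by (intro spectrum_simps) auto
  ultimately have *: "f A \<in> f ` U \<and> f B \<in> f ` V \<and> (f A, f B) \<in> composable K \<and>
      z = gmult K (f A) (f B) \<longleftrightarrow>
      (A, B) \<in> composable FG \<and> z = f (A \<star> B)"
    if "A \<in> U" "B \<in> V" for A B z
    using that by auto
  show ?thesis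
  proof (intro equalityI subsetI)
    fix z assume "z \<in> gset_mult K (f ` U) (f ` V)"
    then obtain A B where "A \<in> U" "B \<in> V" "(f A, f B) \<in> composable K"
      "z = gmult K (f A) (f B)"
      by (auto simp: mem_gset_mult)
    with * [of A B z] show "z \<in> f ` gset_mult FG U V"
      by (auto intro!: imageI gset_multI)
  next
    fix z assume "z \<in> f ` gset_mult FG U V"
    then obtain A B where "A \<in> U" "B \<in> V" "(A, B) \<in> composable FG" "z = f (A \<star> B)"
      by (auto simp: mem_gset_mult)
    with * [of A B z] show "z \<in> gset_mult K (f ` U) (f ` V)"
      by (intro gset_multI [of "f A" _ "f B"]) auto
  qed
qed

lemma identities_spectrum: "identities K = f ` X_set S \<one>"
  unfolding X_set_one by (auto simp: identities_def spectrum_simps f_eq_iff fdom_cp_filters)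

lemma X_set_cp: "X_set S s \<subseteq> cp_filters S"
  by (auto simp: X_set_def)

lemma image_X_set_mult:
  "\<lbrakk>s \<in> carrier S; t \<in> carrier S\<rbrakk> \<Longrightarrow>
    gset_mult K (f ` X_set S s) (f ` X_set S t) = f ` X_set S (s \<otimes> t)"
  by (simp add: gset_mult_spectrum X_set_cp X_set_mult)

lemma image_X_set_pinv:
  assumes "s \<in> carrier S"
  shows "ginv K ` f ` X_set S s = f ` X_set S s\<^sup>-"
proof -
  have "ginv K ` f ` X_set S s = f ` fpinv ` X_set S s"
    by (auto simp: image_image spectrum_simps X_set_def intro!: image_cong)
  then show ?thesis by (simp add: X_set_pinv assms)
qed

lemma bisection_image_X_set: "bisection K (f ` X_set S s)"
proof -
  have inj: "inj_on fdom (X_set S s)" "inj_on fcod (X_set S s)"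
    using bisection_X_set [of s] by (simp_all add: FG.bisection_iff)
  have "gdom K (f A) = gdom K (f B) \<longleftrightarrow> fdom A = fdom B"
    "gcod K (f A) = gcod K (f B) \<longleftrightarrow> fcod A = fcod B"
    if "A \<in> X_set S s" "B \<in> X_set S s" for A B
    using that by (simp_all add: X_set_def spectrum_simps f_eq_iff fdom_cp_filters fcod_cp_filters)
  then have "inj_on (gdom K) (f ` X_set S s)"
    "inj_on (gcod K) (f ` X_set S s)"
    using inj unfolding inj_on_def by auto
  then show ?thesis using X_set_cp by (auto simp: K.bisection_iff spectrum_simps)
qed

lemma UN_image_X_set: "\<Union>((\<lambda>s. f ` X_set S s) ` carrier S) = f ` cp_filters S"
proof -
  have "\<exists>s\<in>carrier S. F \<in> X_set S s" if "F \<in> cp_filters S" for F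
    using cp_filter_nonempty [OF that] cp_filter_subset [OF that] that by (auto simp: X_set_def)
  then have "(\<Union>s\<in>carrier S. X_set S s) = cp_filters S" using X_set_cp by blast
  then show ?thesis by (simp flip: image_UN)
qed

lemma image_X_set_meet:
  assumes "s \<in> carrier S" "t \<in> carrier S"
  shows "f ` X_set S (s \<sqinter>\<sqinter> t) = f ` X_set S s \<inter> f ` X_set S t"
  using inj_on_image_Int [OF inj X_set_cp X_set_cp] by (simp add: X_set_meet assms)

lemma image_X_set_basis:
  assumes "U \<in> (\<lambda>s. f ` X_set S s) ` carrier S" "V \<in> (\<lambda>s. f ` X_set S s) ` carrier S" "x \<in> U" "x \<in> V"
  shows "\<exists>W\<in>(\<lambda>s. f ` X_set S s) ` carrier S. x \<in> W \<and> W \<subseteq> U \<inter> V"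
proof -
  obtain s t where "s \<in> carrier S" "t \<in> carrier S" "U = f ` X_set S s" "V = f ` X_set S t"
    using assms(1,2) by auto
  moreover from this have "f ` X_set S (s \<sqinter>\<sqinter> t) \<in> (\<lambda>s. f ` X_set S s) ` carrier S"
    by (intro imageI) auto
  ultimately show ?thesis
    using assms(3,4) by (intro bexI [of _ "f ` X_set S (s \<sqinter>\<sqinter> t)"]) (simp_all add: image_X_set_meet)
qed

sublocale K: etale_groupoid K
  using image_X_set_basis
  by (intro K.etale_groupoid_basisI [OF spectrum_simps(2)])
    (auto simp: UN_image_X_set spectrum_simps bisection_image_X_set image_X_set_mult
      image_X_set_pinv identities_spectrum)

text \<open>An open bisection \<open>A\<close> is the union of the sets \<open>X_set S s\<close> it contains, and spatiality
  turns \<open>A\<inverse>A\<close> and \<open>AA\<inverse>\<close> consisting of identities into compatibility of these \<open>s\<close>.\<close>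

lemma open_bisection_eq_image_X_set:
  assumes "A \<in> open_bisections K"
  shows "\<exists>s\<in>carrier S. A = f ` X_set S s"
proof -
  define T where "T = {s \<in> carrier S. f ` X_set S s \<subseteq> A}"
  have "openin (gtop K) A" and bis: "bisection K A"
    using assms by (auto simp: open_bisections_def)
  then have "\<forall>x\<in>A. \<exists>B\<in>(\<lambda>s. f ` X_set S s) ` carrier S. x \<in> B \<and> B \<subseteq> A"
    using openin_topology_generated_by_basis [OF image_X_set_basis] by (simp only: spectrum_simps)
  then have A: "A = (\<Union>s\<in>T. f ` X_set S s)" by (fastforce simp: T_def)
  have idem: "s \<in> E" if "s \<in> carrier S" "f ` X_set S s \<subseteq> identities K" for s
  proof -
    have "X_set S s \<subseteq> X_set S \<one>"
    proof
      fix F assume F: "F \<in> X_set S s"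
      then have "f F \<in> f ` X_set S \<one>" using that(2) unfolding identities_spectrum by blast
      with F show "F \<in> X_set S \<one>" using mem_image_X_set [of F \<one>] by (simp add: X_set_def)
    qed
    then have "s \<preceq> \<one>" using that(1) by (simp add: X_set_subset_iff)
    then show ?thesis by (rule leq_idem) simp
  qed
  have "compatible S T"
    unfolding compatible_def
  proof (intro conjI ballI)
    show "T \<subseteq> carrier S" by (auto simp: T_def)
    fix s t assume st: "s \<in> T" "t \<in> T"
    then have [simp]: "s \<in> carrier S" "t \<in> carrier S" by (auto simp: T_def)
    have sub: "f ` X_set S s \<subseteq> A" "f ` X_set S t \<subseteq> A" using st by (auto simp: T_def)
    have "f ` X_set S (s\<^sup>- \<otimes> t) \<subseteq> gset_mult K (ginv K ` A) A"
      using gset_mult_mono [OF image_mono [OF sub(1), of "ginv K"] sub(2), of K]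
      by (simp add: image_X_set_pinv image_X_set_mult)
    also have "\<dots> \<subseteq> identities K" using bis by (simp add: bisection_def)
    finally show "s\<^sup>- \<otimes> t \<in> E" by (intro idem) auto
    have "f ` X_set S (s \<otimes> t\<^sup>-) \<subseteq> gset_mult K A (ginv K ` A)"
      using gset_mult_mono [OF sub(1) image_mono [OF sub(2), of "ginv K"], of K]
      by (simp add: image_X_set_pinv image_X_set_mult)
    also have "\<dots> \<subseteq> identities K" using bis by (simp add: bisection_def)
    finally show "s \<otimes> t\<^sup>- \<in> E" by (intro idem) auto
  qed
  then have "A = f ` X_set S (\<Or>T)" "\<Or>T \<in> carrier S"
    unfolding A by (simp_all add: X_set_join image_UN)
  then show ?thesis by blast
qed

sublocale K: bisection_model K S "\<lambda>s. f ` X_set S s"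
proof
  have "inj_on (\<lambda>s. f ` X_set S s) (carrier S)"
  proof (rule inj_onI)
    fix s t assume "s \<in> carrier S" "t \<in> carrier S" "f ` X_set S s = f ` X_set S t"
    then show "s = t" using spatial inj_on_image_eq_iff [OF inj X_set_cp X_set_cp] by metis
  qed
  moreover have "f ` X_set S s \<in> open_bisections K" if "s \<in> carrier S" for s
    using that bisection_image_X_set
    by (auto simp: open_bisections_def spectrum_simps intro!: topology_generated_by_Basis)
  ultimately show "bij_betw (\<lambda>s. f ` X_set S s) (carrier S) (open_bisections K)"
    unfolding bij_betw_def using open_bisection_eq_image_X_set by (auto simp: image_iff)
qed (simp_all add: image_X_set_mult identities_spectrum)

text \<open>The filter attached to the arrow f F is F itself, so \<open>point\<close> is inverse to
  the relabelling.\<close>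

sublocale K: duality K S "\<lambda>s. f ` X_set S s"
proof
  have "K.point (f F) = F" if "F \<in> cp_filters S" for F
    using that cp_filter_subset [OF that] by (auto simp: mem_image_X_set)
  then show "bij_betw K.point (carrier K) (cp_filters S)"
    by (intro bij_betw_byWitness [where f' = f]) (auto simp: spectrum_simps)
qed

end

lemma (in spatial_pseudogroup) ex_dual_groupoid:
  fixes f :: "'a set \<Rightarrow> 'e"
  assumes "inj_on f (cp_filters S)"
  obtains G :: "'e top_groupoid" and \<beta> where "duality G S \<beta>" "carrier G = f ` cp_filters S"
proof -
  interpret labelled_spectrum S f by unfold_locales (fact assms)
  show thesis using that [OF K.duality_axioms] by (simp add: spectrum_simps)
qed

section \<open>Relabelled monoids of open bisections\<close>

definition relabelled_bisections :: "('b set \<Rightarrow> 'a) \<Rightarrow> ('b, 'd) top_groupoid_scheme \<Rightarrow> 'a monoid" where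
  "relabelled_bisections h G =
     (let k = the_inv_into (open_bisections G) h in
      \<lparr>carrier = h ` open_bisections G,
       mult = (\<lambda>x y. h (gset_mult G (k x) (k y))),
       one = h (identities G)\<rparr>)"

text \<open>By \<open>bij_betw_point_iff\<close>, sobriety of G carries over to the relabelled
  monoid: its completely prime filters correspond bijectively to the arrows of G.\<close>

lemma (in sober_etale_groupoid) ex_dual_monoid:
  fixes h :: "'a set \<Rightarrow> 'e"
  assumes h: "inj_on h (open_bisections G)"
  obtains S :: "'e monoid" and \<beta> where "duality G S \<beta>" "carrier S = h ` open_bisections G"
proof -
  let ?S = "relabelled_bisections h G" and ?k = "the_inv_into (open_bisections G) h"
  have k: "?k (h A) = A" if "A \<in> open_bisections G" for A
    by (rule the_inv_into_f_f [OF h that])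
  interpret M: bisection_model G ?S ?k
    by unfold_locales
      (auto simp: relabelled_bisections_def Let_def k open_bisections_gset_mult
        open_bisections_identities intro!: bij_betw_the_inv_into inj_on_imp_bij_betw h)
  have "duality G ?S ?k"
    by unfold_locales (use sober sober_iff M.bij_betw_point_iff in blast)
  then show thesis by (rule that) (simp add: relabelled_bisections_def Let_def)
qed

section \<open>Callitic morphisms\<close>

text \<open>Inverses are characterised by equations in products, so a semigroup homomorphism
  preserves them even if it moves the unit; idempotents, order and compatibility follow.\<close>

lemma
  assumes S: "inverse_monoid S" and T: "inverse_monoid T" and \<theta>: "\<theta> \<in> hom S T"
  shows hom_pinv: "s \<in> carrier S \<Longrightarrow> \<theta> (pinv S s) = pinv T (\<theta> s)"
    and hom_le: "\<lbrakk>s \<sqsubseteq>\<^bsub>nat_order S\<^esub> t; t \<in> carrier S\<rbrakk> \<Longrightarrow> \<theta> s \<sqsubseteq>\<^bsub>nat_order T\<^esub> \<theta> t"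
    and hom_compatible: "compatible S A \<Longrightarrow> compatible T (\<theta> ` A)"
proof -
  interpret S: inverse_monoid S by fact
  interpret T: inverse_monoid T by fact
  have c: "\<theta> s \<in> carrier T" if "s \<in> carrier S" for s using \<theta> that by (auto simp: hom_def)
  have m: "\<theta> (s \<otimes>\<^bsub>S\<^esub> t) = \<theta> s \<otimes>\<^bsub>T\<^esub> \<theta> t" if "s \<in> carrier S" "t \<in> carrier S" for s t
    using \<theta> that by (auto simp: hom_def)
  have idem: "\<theta> e \<in> idempotents T" if e: "e \<in> idempotents S" for e
    using S.idem_idem [OF e] m [of e e] S.idem_closed [OF e] c by (intro T.idemI) auto
  show pinv: "\<theta> (pinv S s) = pinv T (\<theta> s)" if s: "s \<in> carrier S" for s
  proof (rule T.pinv_eqI [symmetric])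
    show "is_pinv T (\<theta> s) (\<theta> (pinv S s))"
      using s S.mult_pinv_mult [OF s] S.pinv_mult_pinv [OF s]
      by (simp add: is_pinv_def c flip: m)
  qed (rule c [OF s])
  show "\<theta> s \<sqsubseteq>\<^bsub>nat_order T\<^esub> \<theta> t" if "s \<sqsubseteq>\<^bsub>nat_order S\<^esub> t" "t \<in> carrier S"
    using that idem m by (auto simp: S.leq_def T.leq_def)
  show "compatible T (\<theta> ` A)" if A: "compatible S A"
    unfolding compatible_def
  proof (intro conjI ballI)
    show "\<theta> ` A \<subseteq> carrier T" using A c by (auto simp: compatible_def)
    fix x y assume "x \<in> \<theta> ` A" "y \<in> \<theta> ` A"
    then obtain a b where ab: "a \<in> A" "b \<in> A" "x = \<theta> a" "y = \<theta> b" by blast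
    then have ab': "a \<in> carrier S" "b \<in> carrier S"
      "pinv S a \<otimes>\<^bsub>S\<^esub> b \<in> idempotents S" "a \<otimes>\<^bsub>S\<^esub> pinv S b \<in> idempotents S"
      using A by (auto simp: compatible_def)
    show "pinv T x \<otimes>\<^bsub>T\<^esub> y \<in> idempotents T" "x \<otimes>\<^bsub>T\<^esub> pinv T y \<in> idempotents T"
      using idem [OF ab'(3)] idem [OF ab'(4)] ab ab'(1,2) by (simp_all add: m pinv)
  qed
qed

lemma
  assumes "callitic S T \<theta>"
  shows callitic_hom: "\<theta> \<in> hom S T"
    and callitic_join: "compatible S A \<Longrightarrow> \<theta> (\<Squnion>\<^bsub>nat_order S\<^esub> A) = \<Squnion>\<^bsub>nat_order T\<^esub> (\<theta> ` A)"
    and callitic_meet: "\<lbrakk>a \<in> carrier S; b \<in> carrier S\<rbrakk>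
      \<Longrightarrow> \<theta> (a \<sqinter>\<^bsub>nat_order S\<^esub> b) = \<theta> a \<sqinter>\<^bsub>nat_order T\<^esub> \<theta> b"
    and callitic_meets_filter: "F \<in> cp_filters T \<Longrightarrow> \<exists>s\<in>carrier S. \<theta> s \<in> F"
    and callitic_closed: "s \<in> carrier S \<Longrightarrow> \<theta> s \<in> carrier T"
    and callitic_mult: "\<lbrakk>a \<in> carrier S; b \<in> carrier S\<rbrakk> \<Longrightarrow> \<theta> (a \<otimes>\<^bsub>S\<^esub> b) = \<theta> a \<otimes>\<^bsub>T\<^esub> \<theta> b"
  using assms unfolding callitic_def meet_morphism_def pseudogroup_morphism_def hom_def by blast+

text \<open>Each clause of the definition does one job: the preimage is nonempty because F meets the
  image of \<theta>, directed because \<theta> preserves meets, and completely prime because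
  \<theta> preserves compatible joins.\<close>

lemma callitic_preimage:
  assumes S: "pseudogroup S" and T: "pseudogroup T" and \<theta>: "callitic S T \<theta>" and F: "F \<in> cp_filters T"
  shows "{s \<in> carrier S. \<theta> s \<in> F} \<in> cp_filters S"
proof -
  interpret S: pseudogroup S by fact
  interpret T: pseudogroup T by fact
  note hom = callitic_hom [OF \<theta>] and closed = callitic_closed [OF \<theta>]
  note ST = S.inverse_monoid_axioms T.inverse_monoid_axioms
  let ?A = "{s \<in> carrier S. \<theta> s \<in> F}"
  show ?thesis
  proof (rule cp_filtersI)
    show "?A \<noteq> {}" using callitic_meets_filter [OF \<theta> F] by blast
    show "b \<in> ?A"
      if "a \<in> ?A" "b \<in> carrier S" "a \<sqsubseteq>\<^bsub>nat_order S\<^esub> b" for a b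
      using that cp_filter_up [OF F _ closed hom_le [OF ST hom]] by blast
    show "\<exists>c\<in>?A. c \<sqsubseteq>\<^bsub>nat_order S\<^esub> a \<and> c \<sqsubseteq>\<^bsub>nat_order S\<^esub> b"
      if "a \<in> ?A" "b \<in> ?A" for a b
    proof -
      from that have ab: "a \<in> carrier S" "b \<in> carrier S" "\<theta> a \<in> F" "\<theta> b \<in> F" by auto
      then obtain c where c: "c \<in> F" "c \<sqsubseteq>\<^bsub>nat_order T\<^esub> \<theta> a" "c \<sqsubseteq>\<^bsub>nat_order T\<^esub> \<theta> b"
        using cp_filter_directed [OF F] by blast
      have "c \<sqsubseteq>\<^bsub>nat_order T\<^esub> \<theta> a \<sqinter>\<^bsub>nat_order T\<^esub> \<theta> b"
        using c ab closed by (intro T.meet_greatest) auto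
      then have "\<theta> (a \<sqinter>\<^bsub>nat_order S\<^esub> b) \<in> F"
        using cp_filter_up [OF F c(1)] ab closed by (simp add: callitic_meet [OF \<theta>])
      then show ?thesis
        using ab S.meet_le1 S.meet_le2 by (intro bexI [of _ "a \<sqinter>\<^bsub>nat_order S\<^esub> b"]) auto
    qed
    show "\<exists>a\<in>A. a \<in> ?A"
      if A: "compatible S A" "\<Squnion>\<^bsub>nat_order S\<^esub> A \<in> ?A" for A
    proof -
      have "\<Squnion>\<^bsub>nat_order T\<^esub> (\<theta> ` A) \<in> F" using A callitic_join [OF \<theta> A(1)] by simp
      then have "\<exists>t\<in>\<theta> ` A. t \<in> F"
        using cp_filter_prime [OF F hom_compatible [OF ST hom A(1)]] by blast
      then show ?thesis using S.compatible_carrier [OF A(1)] by auto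
    qed
  qed auto
qed

text \<open>Arrows are made \<open>undefined\<close> outside the carrier, so the defining property
  must depend only on values on the carrier. \<open>covering_functor_cong\<close> plays the same
  role for groupoids.\<close>

lemma callitic_cong:
  assumes S: "pseudogroup S" and \<theta>: "callitic S T \<theta>" and eq: "\<And>s. s \<in> carrier S \<Longrightarrow> \<phi> s = \<theta> s"
  shows "callitic S T \<phi>"
proof -
  interpret S: pseudogroup S by fact
  have "\<phi> ` A = \<theta> ` A" if "A \<subseteq> carrier S" for A using that eq by (intro image_cong) auto
  moreover from this have "\<phi> ` carrier S = \<theta> ` carrier S" by blast
  ultimately show ?thesis
    using \<theta> eq
    by (auto simp: callitic_def meet_morphism_def pseudogroup_morphism_def hom_def compatible_def)
qed

lemma callitic_id: "callitic S S (\<lambda>s. s)" if "pseudogroup S"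
proof -
  have "F \<inter> carrier S \<noteq> {}" if "F \<in> cp_filters S" for F
    using cp_filter_subset [OF that] cp_filter_nonempty [OF that] by blast
  then show ?thesis by (simp add: callitic_def meet_morphism_def pseudogroup_morphism_def hom_def)
qed

lemma callitic_comp:
  assumes S: "pseudogroup S" and T: "pseudogroup T" and U: "pseudogroup U"
    and \<theta>: "callitic S T \<theta>" and \<phi>: "callitic T U \<phi>"
  shows "callitic S U (\<phi> \<circ> \<theta>)"
proof -
  interpret S: pseudogroup S by fact
  interpret T: pseudogroup T by fact
  note c = callitic_closed [OF \<theta>] callitic_closed [OF \<phi>]
  have comp: "compatible T (\<theta> ` A)" if "compatible S A" for A
    using hom_compatible [OF S.inverse_monoid_axioms T.inverse_monoid_axioms callitic_hom [OF \<theta>] that] .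
  \<comment> \<open>The preimage of F under \<phi> is a completely prime filter of T, so the
    callitic condition on \<theta> applies to it.\<close>
  have "F \<inter> (\<phi> \<circ> \<theta>) ` carrier S \<noteq> {}" if F: "F \<in> cp_filters U" for F
    using callitic_meets_filter [OF \<theta> callitic_preimage [OF T U \<phi> F]] by auto
  then show ?thesis
    unfolding callitic_def meet_morphism_def pseudogroup_morphism_def
    by (auto simp: hom_def c callitic_mult [OF \<theta>] callitic_mult [OF \<phi>] callitic_meet [OF \<theta>]
        callitic_meet [OF \<phi>] callitic_join [OF \<theta>] callitic_join [OF \<phi>] comp image_comp)
qed

section \<open>Covering functors\<close>

lemma
  assumes "covering_functor G H \<alpha>"
  shows covering_functor_functor: "groupoid_functor G H \<alpha>"
    and covering_closed: "x \<in> carrier G \<Longrightarrow> \<alpha> x \<in> carrier H"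
    and covering_gdom: "x \<in> carrier G \<Longrightarrow> \<alpha> (gdom G x) = gdom H (\<alpha> x)"
    and covering_gcod: "x \<in> carrier G \<Longrightarrow> \<alpha> (gcod G x) = gcod H (\<alpha> x)"
    and covering_gmult: "(x, y) \<in> composable G \<Longrightarrow> \<alpha> (gmult G x y) = gmult H (\<alpha> x) (\<alpha> y)"
    and covering_inj: "\<lbrakk>x \<in> carrier G; y \<in> carrier G; gdom G x = gdom G y; \<alpha> x = \<alpha> y\<rbrakk> \<Longrightarrow> x = y"
    and covering_lift: "\<lbrakk>e \<in> identities G; h \<in> carrier H; \<alpha> e = gdom H h\<rbrakk>
      \<Longrightarrow> \<exists>g\<in>carrier G. gdom G g = e \<and> \<alpha> g = h"
  using assms unfolding covering_functor_def groupoid_functor_def by blast+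

lemma covering_functor_id: "covering_functor G G (\<lambda>x. x)" if "groupoid G"
  using that by (auto simp: covering_functor_def groupoid_functor_def identities_def)

lemma covering_functor_comp:
  assumes G: "groupoid G" and \<alpha>: "covering_functor G H \<alpha>" and \<alpha>': "covering_functor H K \<alpha>'"
  shows "covering_functor G K (\<alpha>' \<circ> \<alpha>)"
proof -
  interpret groupoid G by fact
  note c = covering_closed [OF \<alpha>] covering_closed [OF \<alpha>']
  have comp: "(\<alpha> x, \<alpha> y) \<in> composable H" if "(x, y) \<in> composable G" for x y
    using that c covering_gdom [OF \<alpha>, of x] covering_gcod [OF \<alpha>, of y] by (simp add: composable_def)
  have "groupoid_functor G K (\<alpha>' \<circ> \<alpha>)"
    unfolding groupoid_functor_def
    by (auto simp: c comp covering_gdom [OF \<alpha>] covering_gdom [OF \<alpha>'] covering_gcod [OF \<alpha>]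
        covering_gcod [OF \<alpha>'] covering_gmult [OF \<alpha>] covering_gmult [OF \<alpha>'])
  moreover have "x = y" if xy: "x \<in> carrier G" "y \<in> carrier G" "gdom G x = gdom G y" "\<alpha>' (\<alpha> x) = \<alpha>' (\<alpha> y)"
    for x y
  proof -
    have "gdom H (\<alpha> x) = gdom H (\<alpha> y)" using xy covering_gdom [OF \<alpha>] by metis
    then have "\<alpha> x = \<alpha> y" using xy c covering_inj [OF \<alpha>'] by blast
    then show ?thesis using xy covering_inj [OF \<alpha>] by blast
  qed
  moreover have "\<exists>g\<in>carrier G. gdom G g = e \<and> \<alpha>' (\<alpha> g) = k"
    if e: "e \<in> identities G" "k \<in> carrier K" "\<alpha>' (\<alpha> e) = gdom K k" for e k
  proof -
    have "\<alpha> e \<in> identities H"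
      using e(1) c covering_gdom [OF \<alpha>, of e] by (simp add: identities_def)
    then obtain h where h: "h \<in> carrier H" "gdom H h = \<alpha> e" "\<alpha>' h = k"
      using covering_lift [OF \<alpha>' _ e(2,3)] by blast
    then obtain g where "g \<in> carrier G" "gdom G g = e" "\<alpha> g = h"
      using covering_lift [OF \<alpha> e(1) h(1)] by auto
    with h show ?thesis by blast
  qed
  ultimately show ?thesis by (simp add: covering_functor_def)
qed

lemma covering_functor_cong:
  assumes G: "groupoid G" and \<alpha>: "covering_functor G H \<alpha>" and eq: "\<And>x. x \<in> carrier G \<Longrightarrow> \<alpha>' x = \<alpha> x"
  shows "covering_functor G H \<alpha>'"
proof -
  interpret groupoid G by fact
  have comp: "\<alpha>' x = \<alpha> x" "\<alpha>' y = \<alpha> y" "\<alpha>' (gmult G x y) = \<alpha> (gmult G x y)"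
    if "(x, y) \<in> composable G" for x y
    using that eq by (auto simp: composable_def gmult_in)
  have ids: "\<alpha>' e = \<alpha> e" if "e \<in> identities G" for e using that eq by (simp add: identities_def)
  have "\<exists>g\<in>carrier G. gdom G g = e \<and> \<alpha>' g = h"
    if "e \<in> identities G" "h \<in> carrier H" "\<alpha> e = gdom H h" for e h
    using covering_lift [OF \<alpha> that] eq by auto
  then show ?thesis
    using covering_inj [OF \<alpha>]
    by (auto simp: covering_functor_def groupoid_functor_def eq ids comp gdom_in gcod_in
        covering_closed [OF \<alpha>] covering_gdom [OF \<alpha>] covering_gcod [OF \<alpha>] covering_gmult [OF \<alpha>])
qed

text \<open>A covering functor has unique lifts from a given domain: uniqueness gives the first
  claim and existence gives the factorisation in the second.\<close>

lemma
  assumes G: "groupoid G" and H: "groupoid H" and \<alpha>: "covering_functor G H \<alpha>"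
  shows covering_preimage_bisection:
      "bisection H A \<Longrightarrow> bisection G {x \<in> carrier G. \<alpha> x \<in> A}"
    and covering_preimage_gset_mult: "\<lbrakk>A \<subseteq> carrier H; B \<subseteq> carrier H\<rbrakk> \<Longrightarrow>
      {x \<in> carrier G. \<alpha> x \<in> gset_mult H A B} =
      gset_mult G {x \<in> carrier G. \<alpha> x \<in> A} {x \<in> carrier G. \<alpha> x \<in> B}"
proof -
  interpret G: groupoid G by fact
  interpret H: groupoid H by fact
  let ?P = "\<lambda>A. {x \<in> carrier G. \<alpha> x \<in> A}"
  note c = covering_closed [OF \<alpha>]
  have comp: "(\<alpha> x, \<alpha> y) \<in> composable H" if "(x, y) \<in> composable G" for x y
    using that c covering_gdom [OF \<alpha>, of x] covering_gcod [OF \<alpha>, of y] by (simp add: composable_def)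
  have inv: "\<alpha> (ginv G x) = ginv H (\<alpha> x)" if "x \<in> carrier G" for x
    by (rule G.groupoid_functor_ginv [OF H covering_functor_functor [OF \<alpha>] that])
  show "bisection G (?P A)" if A: "bisection H A"
    unfolding G.bisection_iff
  proof (intro conjI inj_onI)
    fix x y assume x: "x \<in> ?P A" and y: "y \<in> ?P A"
    then have xy: "x \<in> carrier G" "y \<in> carrier G" "\<alpha> x \<in> A" "\<alpha> y \<in> A" by auto
    {
      assume eq: "gdom G x = gdom G y"
      then have "gdom H (\<alpha> x) = gdom H (\<alpha> y)" using xy covering_gdom [OF \<alpha>] by metis
      then have "\<alpha> x = \<alpha> y" using xy H.bisection_gdom_eq [OF A] by blast
      with xy eq show "x = y" using covering_inj [OF \<alpha>] by blast
    next
      assume eq: "gcod G x = gcod G y"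
      then have "gcod H (\<alpha> x) = gcod H (\<alpha> y)" using xy covering_gcod [OF \<alpha>] by metis
      then have "\<alpha> x = \<alpha> y" using xy H.bisection_gcod_eq [OF A] by blast
      \<comment> \<open>Uniqueness of lifts concerns arrows with a common domain, so it is applied
        to the inverses, whose domains are the ranges of x and y.\<close>
      have "ginv G x = ginv G y"
        by (rule covering_inj [OF \<alpha>])
          (use xy eq \<open>\<alpha> x = \<alpha> y\<close> in \<open>simp_all add: inv G.groupoid_simps\<close>)
      with xy show "x = y" by (metis G.ginv_ginv)
    }
  qed auto
  show "?P (gset_mult H A B) = gset_mult G (?P A) (?P B)"
    if "A \<subseteq> carrier H" "B \<subseteq> carrier H"
  proof (intro equalityI subsetI)
    fix z assume "z \<in> gset_mult G (?P A) (?P B)"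
    then obtain x y where "x \<in> carrier G" "\<alpha> x \<in> A" "y \<in> carrier G" "\<alpha> y \<in> B"
      "(x, y) \<in> composable G" "z = gmult G x y"
      by (auto simp: mem_gset_mult)
    then show "z \<in> ?P (gset_mult H A B)"
      using comp
      by (auto simp: covering_gmult [OF \<alpha>] G.composable_iff G.gmult_in intro!: gset_multI)
  next
    fix z assume "z \<in> ?P (gset_mult H A B)"
    then obtain a b where z: "z \<in> carrier G" and ab: "a \<in> A" "b \<in> B" "(a, b) \<in> composable H"
      "\<alpha> z = gmult H a b"
      by (auto simp: mem_gset_mult)
    then have ab': "a \<in> carrier H" "b \<in> carrier H" "gdom H a = gcod H b"
      by (auto simp: H.composable_iff)
    have "\<alpha> (gdom G z) = gdom H b"
      using z ab' by (simp add: covering_gdom [OF \<alpha>] ab(4) H.groupoid_simps)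
    \<comment> \<open>The right factor is a lift of b starting at the domain of z; the left factor
      is then forced to be z y^{-1}.\<close>
    then obtain y where y: "y \<in> carrier G" "gdom G y = gdom G z" "\<alpha> y = b"
      using covering_lift [OF \<alpha> G.gdom_identities [OF z] ab'(2)] by blast
    define x where "x = gmult G z (ginv G y)"
    have zy: "(z, ginv G y) \<in> composable G"
      using z y by (simp add: G.composable_iff G.groupoid_simps)
    then have x: "x \<in> carrier G" "gdom G x = gcod G y"
      using y by (simp_all add: x_def G.composable_iff G.groupoid_simps)
    have "\<alpha> x = gmult H (gmult H a b) (ginv H b)"
      using zy y by (simp add: x_def covering_gmult [OF \<alpha>] inv ab(4))
    also have "\<dots> = a" using ab' by (rule H.gmult_ginv_cancel)
    finally have "\<alpha> x = a" .
    moreover have "z = gmult G x y"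
      using G.gmult_ginv_cancel' [of z y] z y by (simp add: x_def)
    ultimately show "z \<in> gset_mult G (?P A) (?P B)"
      using x y ab by (intro gset_multI [of x _ y]) (auto simp: G.composable_iff)
  qed
qed

section \<open>Duality for arrows\<close>

definition dual_arrow ::
  "('a, 'c) monoid_scheme \<Rightarrow> ('a \<Rightarrow> 'b set) \<Rightarrow> ('f, 'g) top_groupoid_scheme \<Rightarrow> ('e \<Rightarrow> 'f set) \<Rightarrow>
   ('a \<Rightarrow> 'e) \<Rightarrow> ('f \<Rightarrow> 'b) \<Rightarrow> bool" where
  "dual_arrow S \<beta> H \<gamma> \<theta> \<alpha> \<longleftrightarrow> (\<forall>s\<in>carrier S. \<gamma> (\<theta> s) = {h \<in> carrier H. \<alpha> h \<in> \<beta> s})"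

context
  fixes G :: "('b, 'd) top_groupoid_scheme" and S :: "('a, 'c) monoid_scheme" and \<beta>
    and H :: "('f, 'g) top_groupoid_scheme" and T :: "('e, 'h) monoid_scheme" and \<gamma>
  assumes GS: "duality G S \<beta>" and HT: "duality H T \<gamma>"
begin

interpretation X: duality G S \<beta> by (fact GS)
interpretation Y: duality H T \<gamma> by (fact HT)

lemma X_point_eqI:
  assumes "g \<in> carrier G" "g' \<in> carrier G" "\<And>s. s \<in> carrier S \<Longrightarrow> g \<in> \<beta> s \<longleftrightarrow> g' \<in> \<beta> s"
  shows "g = g'"
proof -
  have "X.point g = X.point g'" using assms(3) by (auto simp: set_eq_iff)
  then show ?thesis using X.point_eq_iff assms by blast
qed

lemma X_cover:
  assumes "g \<in> carrier G"
  obtains s where "s \<in> carrier S" "g \<in> \<beta> s"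
  using X.rep_cover [of "carrier G" g] assms X.topspace_gtop openin_topspace by metis

lemma covering_functor_if_dual_arrow:
  assumes \<theta>: "\<theta> \<in> hom S T" and \<alpha>: "\<alpha> \<in> carrier H \<rightarrow> carrier G"
    and dual: "dual_arrow S \<beta> H \<gamma> \<theta> \<alpha>"
  shows "covering_functor H G \<alpha>" "continuous_map (gtop H) (gtop G) \<alpha>"
proof -
  have a [simp]: "\<alpha> x \<in> carrier G" if "x \<in> carrier H" for x using \<alpha> that by auto
  have t [simp]: "\<theta> s \<in> carrier T" if "s \<in> carrier S" for s using \<theta> that by (auto simp: hom_def)
  have m [simp]: "\<theta> (s \<otimes>\<^bsub>S\<^esub> s') = \<theta> s \<otimes>\<^bsub>T\<^esub> \<theta> s'" if "s \<in> carrier S" "s' \<in> carrier S" for s s'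
    using \<theta> that by (auto simp: hom_def)
  have p [simp]: "\<theta> (pinv S s) = pinv T (\<theta> s)" if "s \<in> carrier S" for s
    using hom_pinv [OF X.inverse_monoid_axioms Y.inverse_monoid_axioms \<theta> that] .
  have mem: "\<alpha> x \<in> \<beta> s \<longleftrightarrow> x \<in> \<gamma> (\<theta> s)" if "x \<in> carrier H" "s \<in> carrier S" for x s
    using dual that by (auto simp: dual_arrow_def)
  have dom: "\<alpha> (gdom H x) = gdom G (\<alpha> x)" if x: "x \<in> carrier H" for x
  proof (rule X_point_eqI)
    fix s assume s: "s \<in> carrier S"
    obtain u where u: "u \<in> carrier S" "\<alpha> x \<in> \<beta> u" using X_cover a [OF x] by blast
    then have xu: "x \<in> \<gamma> (\<theta> u)" using mem x by blast
    \<comment> \<open>A bisection U through x turns a condition on d(x) into one on x: d(x) lies in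
      B exactly if x lies in U B. In this form the condition passes through \<alpha>. The range is
      treated in the same way.\<close>
    have "\<alpha> (gdom H x) \<in> \<beta> s \<longleftrightarrow> x \<in> \<gamma> (\<theta> u \<otimes>\<^bsub>T\<^esub> \<theta> s)"
      using Y.mem_gset_mult_left_bisection [OF Y.rep_bisection xu] s u x
      by (simp add: mem Y.gdom_in Y.rep_mult)
    also have "\<dots> \<longleftrightarrow> \<alpha> x \<in> \<beta> (u \<otimes>\<^bsub>S\<^esub> s)" using x u s by (simp add: mem)
    also have "\<dots> \<longleftrightarrow> gdom G (\<alpha> x) \<in> \<beta> s"
      using X.mem_gset_mult_left_bisection [OF X.rep_bisection u(2)] s u by (simp add: X.rep_mult)
    finally show "\<alpha> (gdom H x) \<in> \<beta> s \<longleftrightarrow> gdom G (\<alpha> x) \<in> \<beta> s" .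
  qed (use x in \<open>simp_all add: X.gdom_in Y.gdom_in\<close>)
  have cod: "\<alpha> (gcod H x) = gcod G (\<alpha> x)" if x: "x \<in> carrier H" for x
  proof (rule X_point_eqI)
    fix s assume s: "s \<in> carrier S"
    obtain u where u: "u \<in> carrier S" "\<alpha> x \<in> \<beta> u" using X_cover a [OF x] by blast
    then have xu: "x \<in> \<gamma> (\<theta> u)" using mem x by blast
    have "\<alpha> (gcod H x) \<in> \<beta> s \<longleftrightarrow> x \<in> \<gamma> (\<theta> s \<otimes>\<^bsub>T\<^esub> \<theta> u)"
      using Y.mem_gset_mult_right_bisection [OF Y.rep_bisection xu] s u x
      by (simp add: mem Y.gcod_in Y.rep_mult)
    also have "\<dots> \<longleftrightarrow> \<alpha> x \<in> \<beta> (s \<otimes>\<^bsub>S\<^esub> u)" using x u s by (simp add: mem)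
    also have "\<dots> \<longleftrightarrow> gcod G (\<alpha> x) \<in> \<beta> s"
      using X.mem_gset_mult_right_bisection [OF X.rep_bisection u(2)] s u by (simp add: X.rep_mult)
    finally show "\<alpha> (gcod H x) \<in> \<beta> s \<longleftrightarrow> gcod G (\<alpha> x) \<in> \<beta> s" .
  qed (use x in \<open>simp_all add: X.gcod_in Y.gcod_in\<close>)
  have mult: "\<alpha> (gmult H x y) = gmult G (\<alpha> x) (\<alpha> y)" if xy: "(x, y) \<in> composable H" for x y
  proof (rule X_point_eqI)
    have c: "x \<in> carrier H" "y \<in> carrier H" "gdom H x = gcod H y" using xy by (auto simp: composable_def)
    have axy: "(\<alpha> x, \<alpha> y) \<in> composable G"
      using c dom [of x] cod [of y] by (simp add: composable_def)
    show "\<alpha> (gmult H x y) \<in> carrier G" using c by (simp add: Y.gmult_in)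
    show "gmult G (\<alpha> x) (\<alpha> y) \<in> carrier G" using axy by (simp add: X.composable_iff X.gmult_in)
    fix s assume s: "s \<in> carrier S"
    obtain u where u: "u \<in> carrier S" "\<alpha> x \<in> \<beta> u" using X_cover a c by blast
    then have xu: "x \<in> \<gamma> (\<theta> u)" using mem c by blast
    \<comment> \<open>Multiplying by the inverse of a bisection through x replaces the condition on
      x y by one on y alone, which passes through \<alpha>.\<close>
    have "\<alpha> (gmult H x y) \<in> \<beta> s \<longleftrightarrow> y \<in> \<gamma> (pinv T (\<theta> u) \<otimes>\<^bsub>T\<^esub> \<theta> s)"
      using Y.mem_gset_mult_ginv [OF Y.rep_bisection xu Y.rep_subset xy] c s u
      by (simp add: mem Y.gmult_in Y.rep_mult Y.rep_pinv)
    also have "\<dots> \<longleftrightarrow> \<alpha> y \<in> \<beta> (pinv S u \<otimes>\<^bsub>S\<^esub> s)" using c u s by (simp add: mem)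
    also have "\<dots> \<longleftrightarrow> gmult G (\<alpha> x) (\<alpha> y) \<in> \<beta> s"
      using X.mem_gset_mult_ginv [OF X.rep_bisection u(2) X.rep_subset axy] s u
      by (simp add: X.rep_mult X.rep_pinv)
    finally show "\<alpha> (gmult H x y) \<in> \<beta> s \<longleftrightarrow> gmult G (\<alpha> x) (\<alpha> y) \<in> \<beta> s" .
  qed
  have "groupoid_functor H G \<alpha>"
    using \<alpha> dom cod mult by (auto simp: groupoid_functor_def)
  moreover have "x = y" if xy: "x \<in> carrier H" "y \<in> carrier H" "gdom H x = gdom H y" "\<alpha> x = \<alpha> y" for x y
  proof -
    \<comment> \<open>An open bisection around the common value pulls back to a bisection containing
      both x and y.\<close>
    obtain s where s: "s \<in> carrier S" "\<alpha> x \<in> \<beta> s" using X_cover a xy by blast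
    then have "x \<in> \<gamma> (\<theta> s)" "y \<in> \<gamma> (\<theta> s)"
      using xy(4) mem [OF xy(1) s(1)] mem [OF xy(2) s(1)] by simp_all
    then show ?thesis using Y.bisection_gdom_eq [OF Y.rep_bisection] s(1) xy(3) t by blast
  qed
  moreover have "\<exists>x\<in>carrier H. gdom H x = e \<and> \<alpha> x = k"
    if e: "e \<in> identities H" "k \<in> carrier G" "\<alpha> e = gdom G k" for e k
  proof -
    have e': "e \<in> carrier H" using e(1) by (rule Y.identitiesD)
    obtain s where s: "s \<in> carrier S" "k \<in> \<beta> s" using X_cover e(2) by blast
    \<comment> \<open>The domain of a bisection \<beta> s around k is represented by s^- s, so e
      lies in the domain of the pulled-back bisection. That gives x with domain e, and injectivity
      of d on \<beta> s gives \<alpha> x = k.\<close>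
    have "gdom G k \<in> \<beta> (pinv S s \<otimes>\<^bsub>S\<^esub> s)"
      using s by (simp add: X.rep_mult X.rep_pinv X.gset_mult_ginv_self X.rep_bisection)
    then have "e \<in> \<gamma> (pinv T (\<theta> s) \<otimes>\<^bsub>T\<^esub> \<theta> s)"
      using mem [OF e', of "pinv S s \<otimes>\<^bsub>S\<^esub> s"] s e(3) by simp
    then have "e \<in> gdom H ` \<gamma> (\<theta> s)"
      using s by (simp add: Y.rep_mult Y.rep_pinv Y.gset_mult_ginv_self Y.rep_bisection)
    then obtain x where x: "x \<in> \<gamma> (\<theta> s)" "e = gdom H x" by blast
    have xH: "x \<in> carrier H" using x(1) Y.rep_subset s t by blast
    then have "\<alpha> x \<in> \<beta> s" "gdom G (\<alpha> x) = gdom G k" using mem x s dom e(3) by auto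
    then have "\<alpha> x = k" using X.bisection_gdom_eq [OF X.rep_bisection] s by blast
    with x xH show ?thesis by blast
  qed
  ultimately show "covering_functor H G \<alpha>" by (simp add: covering_functor_def)
  show "continuous_map (gtop H) (gtop G) \<alpha>"
    unfolding continuous_map_def
  proof (intro conjI allI impI)
    show "\<alpha> \<in> topspace (gtop H) \<rightarrow> topspace (gtop G)"
      using \<alpha> by (simp add: X.topspace_gtop Y.topspace_gtop)
    fix U assume U: "openin (gtop G) U"
    show "openin (gtop H) {x \<in> topspace (gtop H). \<alpha> x \<in> U}"
      unfolding Y.topspace_gtop
    proof (subst openin_subopen, clarify)
      fix x assume x: "x \<in> carrier H" "\<alpha> x \<in> U"
      then obtain s where s: "s \<in> carrier S" "\<alpha> x \<in> \<beta> s" "\<beta> s \<subseteq> U" using X.rep_cover [OF U] by blast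
      have "\<gamma> (\<theta> s) = {x \<in> carrier H. \<alpha> x \<in> \<beta> s}"
        using dual s(1) by (simp add: dual_arrow_def)
      then have "openin (gtop H) (\<gamma> (\<theta> s))" "x \<in> \<gamma> (\<theta> s)" "\<gamma> (\<theta> s) \<subseteq> {x \<in> carrier H. \<alpha> x \<in> U}"
        using x s Y.rep_openin [of "\<theta> s"] by auto
      then show "\<exists>V. openin (gtop H) V \<and> x \<in> V \<and> V \<subseteq> {x \<in> carrier H. \<alpha> x \<in> U}" by blast
    qed
  qed
qed

text \<open>The value at h is the arrow whose filter is the preimage under \<theta> of the filter of
  h; \<open>callitic_preimage\<close> and the bijection \<open>point\<close> provide it.\<close>

lemma ex_dual_covering_functor:
  assumes \<theta>: "callitic S T \<theta>"
  obtains \<alpha> where "\<alpha> \<in> extensional (carrier H)" "covering_functor H G \<alpha>"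
    "continuous_map (gtop H) (gtop G) \<alpha>" "dual_arrow S \<beta> H \<gamma> \<theta> \<alpha>"
proof -
  have "\<exists>g\<in>carrier G. \<forall>s\<in>carrier S. g \<in> \<beta> s \<longleftrightarrow> h \<in> \<gamma> (\<theta> s)" if h: "h \<in> carrier H" for h
  proof -
    have "{s \<in> carrier S. \<theta> s \<in> Y.point h} \<in> cp_filters S"
      by (rule callitic_preimage [OF X.pseudogroup_axioms Y.pseudogroup_axioms \<theta> Y.point_cp_filter [OF h]])
    then obtain g where g: "g \<in> carrier G" "{s \<in> carrier S. \<theta> s \<in> Y.point h} = X.point g"
      using X.points by (auto simp: bij_betw_def)
    have "g \<in> \<beta> s \<longleftrightarrow> h \<in> \<gamma> (\<theta> s)" if s: "s \<in> carrier S" for s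
    proof -
      have "s \<in> {s \<in> carrier S. \<theta> s \<in> Y.point h} \<longleftrightarrow> s \<in> X.point g" by (simp only: g(2))
      then show ?thesis using s callitic_closed [OF \<theta> s] by simp
    qed
    with g show ?thesis by blast
  qed
  then obtain \<alpha> where \<alpha>: "h \<in> carrier H \<Longrightarrow> \<alpha> h \<in> carrier G"
    "\<lbrakk>h \<in> carrier H; s \<in> carrier S\<rbrakk> \<Longrightarrow> \<alpha> h \<in> \<beta> s \<longleftrightarrow> h \<in> \<gamma> (\<theta> s)" for h s
    by metis
  have "dual_arrow S \<beta> H \<gamma> \<theta> (restrict \<alpha> (carrier H))"
    using \<alpha> Y.rep_subset [OF callitic_closed [OF \<theta>]] by (auto simp: dual_arrow_def subset_iff)
  moreover have "restrict \<alpha> (carrier H) \<in> carrier H \<rightarrow> carrier G" using \<alpha> by auto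
  ultimately show thesis
    using that [of "restrict \<alpha> (carrier H)"] covering_functor_if_dual_arrow [OF callitic_hom [OF \<theta>]]
    by simp
qed

text \<open>In terms of bisections \<theta> is the preimage map of \<alpha>. Preimages commute with
  unions and intersections for any map, and with products because \<alpha> is a covering
  functor.\<close>

lemma callitic_if_dual_arrow:
  assumes \<alpha>: "covering_functor H G \<alpha>" and \<theta>: "\<theta> \<in> carrier S \<rightarrow> carrier T"
    and dual: "dual_arrow S \<beta> H \<gamma> \<theta> \<alpha>"
  shows "callitic S T \<theta>"
proof -
  have t [simp]: "\<theta> s \<in> carrier T" if "s \<in> carrier S" for s using \<theta> that by auto
  have rep: "\<gamma> (\<theta> s) = {h \<in> carrier H. \<alpha> h \<in> \<beta> s}" if "s \<in> carrier S" for s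
    using dual that by (simp add: dual_arrow_def)
  have "\<theta> (s \<otimes>\<^bsub>S\<^esub> s') = \<theta> s \<otimes>\<^bsub>T\<^esub> \<theta> s'" if "s \<in> carrier S" "s' \<in> carrier S" for s s'
  proof -
    have "\<gamma> (\<theta> (s \<otimes>\<^bsub>S\<^esub> s')) = \<gamma> (\<theta> s \<otimes>\<^bsub>T\<^esub> \<theta> s')"
      using that
      by (simp add: rep X.rep_mult Y.rep_mult X.rep_subset
          covering_preimage_gset_mult [OF Y.groupoid_axioms X.groupoid_axioms \<alpha>])
    then show ?thesis using that by (simp add: Y.rep_eq_iff)
  qed
  then have "\<theta> \<in> hom S T" by (simp add: hom_def \<theta>)
  moreover have "\<theta> (\<Squnion>\<^bsub>nat_order S\<^esub> A) = \<Squnion>\<^bsub>nat_order T\<^esub> (\<theta> ` A)" if A: "compatible S A" for A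
  proof (rule Y.join_if_rep_UN [symmetric])
    have A': "a \<in> carrier S" if "a \<in> A" for a using X.compatible_carrier [OF A that] .
    then show "\<theta> ` A \<subseteq> carrier T" by auto
    show "\<theta> (\<Squnion>\<^bsub>nat_order S\<^esub> A) \<in> carrier T" using X.join_carrier [OF A] by simp
    have "\<gamma> (\<theta> (\<Squnion>\<^bsub>nat_order S\<^esub> A)) = (\<Union>a\<in>A. {h \<in> carrier H. \<alpha> h \<in> \<beta> a})"
      using X.join_carrier [OF A] by (auto simp: rep X.rep_join [OF A])
    also have "\<dots> = (\<Union>a\<in>A. \<gamma> (\<theta> a))" by (intro SUP_cong) (simp_all add: rep A')
    finally show "\<gamma> (\<theta> (\<Squnion>\<^bsub>nat_order S\<^esub> A)) = (\<Union>t\<in>\<theta> ` A. \<gamma> t)" by simp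
  qed
  moreover have "\<theta> (a \<sqinter>\<^bsub>nat_order S\<^esub> b) = \<theta> a \<sqinter>\<^bsub>nat_order T\<^esub> \<theta> b"
    if ab: "a \<in> carrier S" "b \<in> carrier S" for a b
  proof -
    have "\<gamma> (\<theta> (a \<sqinter>\<^bsub>nat_order S\<^esub> b)) = \<gamma> (\<theta> a \<sqinter>\<^bsub>nat_order T\<^esub> \<theta> b)"
      using X.rep_meet [OF ab] Y.rep_meet [OF t [OF ab(1)] t [OF ab(2)]] ab by (auto simp: rep)
    then show ?thesis
      using X.rep_meet(1) [OF ab] Y.rep_meet(1) [OF t [OF ab(1)] t [OF ab(2)]]
      by (subst (asm) Y.rep_eq_iff) auto
  qed
  \<comment> \<open>A completely prime filter of T belongs to an arrow h, and an open bisection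
    around \<alpha> h pulls back to one around h.\<close>
  moreover have "F \<inter> \<theta> ` carrier S \<noteq> {}" if F: "F \<in> cp_filters T" for F
  proof -
    obtain h where h: "h \<in> carrier H" "F = Y.point h" using Y.points F by (auto simp: bij_betw_def)
    obtain s where "s \<in> carrier S" "\<alpha> h \<in> \<beta> s" using X_cover covering_closed [OF \<alpha> h(1)] by blast
    then have "\<theta> s \<in> F" using h rep by simp
    with \<open>s \<in> carrier S\<close> show ?thesis by blast
  qed
  ultimately show ?thesis by (simp add: callitic_def meet_morphism_def pseudogroup_morphism_def)
qed

text \<open>Continuity makes the preimage of \<beta> s open and the covering property makes it a
  bisection, so some element of T represents it.\<close>

lemma ex_dual_callitic:
  assumes \<alpha>: "covering_functor H G \<alpha>" "continuous_map (gtop H) (gtop G) \<alpha>"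
  obtains \<theta> where "\<theta> \<in> extensional (carrier S)" "callitic S T \<theta>" "dual_arrow S \<beta> H \<gamma> \<theta> \<alpha>"
proof -
  have "\<exists>t\<in>carrier T. \<gamma> t = {h \<in> carrier H. \<alpha> h \<in> \<beta> s}" if s: "s \<in> carrier S" for s
  proof -
    have "openin (gtop H) {h \<in> carrier H. \<alpha> h \<in> \<beta> s}"
      using openin_continuous_map_preimage [OF \<alpha>(2) X.rep_openin [OF s]] by (simp add: Y.topspace_gtop)
    then have "{h \<in> carrier H. \<alpha> h \<in> \<beta> s} \<in> open_bisections H"
      using covering_preimage_bisection [OF Y.groupoid_axioms X.groupoid_axioms \<alpha>(1) X.rep_bisection [OF s]]
      by (simp add: open_bisections_def)
    then show ?thesis by (metis Y.rep_surj)
  qed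
  then obtain \<theta> where \<theta>: "s \<in> carrier S \<Longrightarrow> \<theta> s \<in> carrier T"
    "s \<in> carrier S \<Longrightarrow> \<gamma> (\<theta> s) = {h \<in> carrier H. \<alpha> h \<in> \<beta> s}" for s
    by metis
  have "dual_arrow S \<beta> H \<gamma> (restrict \<theta> (carrier S)) \<alpha>"
    using \<theta> by (simp add: dual_arrow_def)
  moreover have "restrict \<theta> (carrier S) \<in> carrier S \<rightarrow> carrier T" using \<theta> by auto
  ultimately show thesis
    using that [of "restrict \<theta> (carrier S)"] callitic_if_dual_arrow [OF \<alpha>(1)] by simp
qed

lemma dual_covering_functor_unique:
  assumes "\<alpha> \<in> extensional (carrier H)" "\<alpha> \<in> carrier H \<rightarrow> carrier G" "dual_arrow S \<beta> H \<gamma> \<theta> \<alpha>"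
    and "\<alpha>' \<in> extensional (carrier H)" "\<alpha>' \<in> carrier H \<rightarrow> carrier G" "dual_arrow S \<beta> H \<gamma> \<theta> \<alpha>'"
  shows "\<alpha> = \<alpha>'"
proof (rule extensionalityI [OF assms(1,4)])
  fix h assume h: "h \<in> carrier H"
  show "\<alpha> h = \<alpha>' h"
  proof (rule X_point_eqI)
    fix s assume "s \<in> carrier S"
    then have "{h \<in> carrier H. \<alpha> h \<in> \<beta> s} = {h \<in> carrier H. \<alpha>' h \<in> \<beta> s}"
      using assms(3,6) by (simp add: dual_arrow_def)
    with h show "\<alpha> h \<in> \<beta> s \<longleftrightarrow> \<alpha>' h \<in> \<beta> s" by blast
  qed (use h assms in auto)
qed

lemma dual_callitic_unique:
  assumes "\<theta> \<in> extensional (carrier S)" "\<theta> \<in> carrier S \<rightarrow> carrier T" "dual_arrow S \<beta> H \<gamma> \<theta> \<alpha>"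
    and "\<theta>' \<in> extensional (carrier S)" "\<theta>' \<in> carrier S \<rightarrow> carrier T" "dual_arrow S \<beta> H \<gamma> \<theta>' \<alpha>"
  shows "\<theta> = \<theta>'"
proof (rule extensionalityI [OF assms(1,4)])
  fix s assume s: "s \<in> carrier S"
  then have "\<gamma> (\<theta> s) = \<gamma> (\<theta>' s)" using assms(3,6) by (simp add: dual_arrow_def)
  with s assms(2,5) show "\<theta> s = \<theta>' s" by (subst (asm) Y.rep_eq_iff) auto
qed

end

section \<open>Equivalences from correspondences\<close>

text \<open>An element \<open>r\<close> of \<open>R\<close> stands for a way of matching the object \<open>p r\<close> of \<open>C\<close> with the
  object \<open>q r\<close> of \<open>D\<close>, and \<open>M r r' f g\<close> says that \<open>f\<close> and \<open>g\<close> match along \<open>r\<close>, \<open>r'\<close>.\<close>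

locale correspondence = C: category C + D: category D
  for C :: "('o, 'm) cat" and D :: "('p, 'n) cat" +
  fixes p :: "'r \<Rightarrow> 'o" and q :: "'r \<Rightarrow> 'p" and R :: "'r set"
    and M :: "'r \<Rightarrow> 'r \<Rightarrow> 'm \<Rightarrow> 'n \<Rightarrow> bool"
  assumes p: "p ` R = Obj C" and q: "q ` R = Obj D"
    and lift: "\<lbrakk>r \<in> R; r' \<in> R; f \<in> Hom C (p r) (p r')\<rbrakk> \<Longrightarrow> \<exists>g\<in>Hom D (q r) (q r'). M r r' f g"
    and lower: "\<lbrakk>r \<in> R; r' \<in> R; g \<in> Hom D (q r) (q r')\<rbrakk> \<Longrightarrow> \<exists>f\<in>Hom C (p r) (p r'). M r r' f g"
    and unique_lift: "\<lbrakk>r \<in> R; r' \<in> R; g \<in> Hom D (q r) (q r'); g' \<in> Hom D (q r) (q r');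
        M r r' f g; M r r' f g'\<rbrakk> \<Longrightarrow> g = g'"
    and unique_lower: "\<lbrakk>r \<in> R; r' \<in> R; f \<in> Hom C (p r) (p r'); f' \<in> Hom C (p r) (p r');
        M r r' f g; M r r' f' g\<rbrakk> \<Longrightarrow> f = f'"
    and M_id: "r \<in> R \<Longrightarrow> M r r (Ident C (p r)) (Ident D (q r))"
    and M_comp: "\<lbrakk>r \<in> R; r' \<in> R; r'' \<in> R; f \<in> Hom C (p r) (p r');
        g \<in> Hom D (q r) (q r'); f' \<in> Hom C (p r') (p r''); g' \<in> Hom D (q r') (q r'');
        M r r' f g; M r' r'' f' g'\<rbrakk>
      \<Longrightarrow> M r r'' (Comp C (p r) (p r') (p r'') f' f) (Comp D (q r) (q r') (q r'') g' g)"
begin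

text \<open>The hypotheses are symmetric, so every statement about lifting to D has a mirror image
  about lowering to C.\<close>

lemma swap: "correspondence D C q p R (\<lambda>r r' g f. M r r' f g)"
  by unfold_locales (fact p q, fact p q, (blast intro: lift lower unique_lift unique_lower M_id M_comp)+)

lemma obj: "r \<in> R \<Longrightarrow> p r \<in> Obj C" "r \<in> R \<Longrightarrow> q r \<in> Obj D"
  using p q by auto

definition up :: "'r \<Rightarrow> 'r \<Rightarrow> 'm \<Rightarrow> 'n" where
  "up r r' f = (SOME g. g \<in> Hom D (q r) (q r') \<and> M r r' f g)"

lemma up:
  assumes "r \<in> R" "r' \<in> R" "f \<in> Hom C (p r) (p r')"
  shows "up r r' f \<in> Hom D (q r) (q r')" "M r r' f (up r r' f)"
  using someI_ex [OF lift [OF assms, unfolded Bex_def]] unfolding up_def by auto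

lemma up_eqI:
  assumes "r \<in> R" "r' \<in> R" "f \<in> Hom C (p r) (p r')" "g \<in> Hom D (q r) (q r')" "M r r' f g"
  shows "up r r' f = g"
  using unique_lift up assms by metis

lemma up_id: "r \<in> R \<Longrightarrow> up r r (Ident C (p r)) = Ident D (q r)"
  by (intro up_eqI M_id C.Ident_in D.Ident_in obj)

lemma up_comp:
  assumes r: "r \<in> R" "r' \<in> R" "r'' \<in> R" and f: "f \<in> Hom C (p r) (p r')" "f' \<in> Hom C (p r') (p r'')"
  shows "up r r'' (Comp C (p r) (p r') (p r'') f' f) =
    Comp D (q r) (q r') (q r'') (up r' r'' f') (up r r' f)"
  by (intro up_eqI M_comp C.Comp_in D.Comp_in obj up r f)

lemma ident_hom:
  assumes "r \<in> R" "p r = p r'"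
  shows "Ident C (p r) \<in> Hom C (p r) (p r')"
  using C.Ident_in [OF obj(1) [OF assms(1)]] assms(2) by simp

text \<open>Both composites are the lift of f along r and t', because the identities cancel in C and
  lifting respects composition.\<close>

lemma up_natural:
  assumes r: "r \<in> R" "r' \<in> R" "p r = p r'" and t: "t \<in> R" "t' \<in> R" "p t = p t'"
    and f: "f \<in> Hom C (p r) (p t)"
  shows "Comp D (q r) (q t) (q t') (up t t' (Ident C (p t))) (up r t f) =
    Comp D (q r) (q r') (q t') (up r' t' f) (up r r' (Ident C (p r)))"
proof -
  have "f \<in> Hom C (p r') (p t')" using f r t by simp
  then have "Comp D (q r) (q t) (q t') (up t t' (Ident C (p t))) (up r t f) =
      up r t' (Comp C (p r) (p t) (p t') (Ident C (p t)) f)"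
    "Comp D (q r) (q r') (q t') (up r' t' f) (up r r' (Ident C (p r))) =
      up r t' (Comp C (p r) (p r') (p t') f (Ident C (p r)))"
    using up_comp [OF r(1) t(1,2) f ident_hom [OF t(1,3)]]
      up_comp [OF r(1,2) t(2) ident_hom [OF r(1,3)]] by simp_all
  moreover have "Comp C (p r) (p t) (p t') (Ident C (p t)) f = f"
    "Comp C (p r) (p r') (p t') f (Ident C (p r)) = f"
    using C.Comp_Ident_left [OF obj(1) obj(1) f] C.Comp_Ident_right [OF obj(1) obj(1) f] r t
    by simp_all
  ultimately show ?thesis by simp
qed

text \<open>The lifts of one identity in the two directions are mutually inverse. This compares two
  partners chosen for the same object of C.\<close>

lemma up_iso:
  assumes r: "r \<in> R" "r' \<in> R" "p r = p r'"
  shows "is_iso D (q r) (q r') (up r r' (Ident C (p r)))"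
proof -
  let ?i = "Ident C (p r)"
  have i: "?i \<in> Hom C (p r) (p r')" "?i \<in> Hom C (p r') (p r)"
    using ident_hom [of r r'] ident_hom [of r' r] r by simp_all
  have "Comp C (p r) (p r) (p r) ?i ?i = ?i"
    using C.Comp_Ident_left [OF obj(1) obj(1)] i r by simp
  then have "Comp D (q r) (q r') (q r) (up r' r ?i) (up r r' ?i) = Ident D (q r)"
    "Comp D (q r') (q r) (q r') (up r r' ?i) (up r' r ?i) = Ident D (q r')"
    using up_comp [OF r(1,2,1) i] up_comp [OF r(2,1,2) i(2,1)] up_id [OF r(1)] up_id [OF r(2)] r(3)
    by simp_all
  then show ?thesis using up(1) r i unfolding is_iso_def by blast
qed

text \<open>The choice a is arbitrary: lifting respects identities and composition between any
  members of R, so every section of p yields a functor.\<close>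

lemma up_functor:
  assumes a: "\<And>X. X \<in> Obj C \<Longrightarrow> a X \<in> R \<and> p (a X) = X"
  shows "is_functor C D (\<lambda>X. q (a X)) (\<lambda>X Y. up (a X) (a Y))"
  unfolding is_functor_def
proof (intro conjI ballI)
  fix X assume X: "X \<in> Obj C"
  then show "q (a X) \<in> Obj D" using a obj by blast
  show "up (a X) (a X) (Ident C X) = Ident D (q (a X))" using up_id [of "a X"] a X by simp
  fix Y f assume Y: "Y \<in> Obj C" and f: "f \<in> Hom C X Y"
  then show "up (a X) (a Y) f \<in> Hom D (q (a X)) (q (a Y))" using a X by (intro up) simp_all
  fix Z g assume "Z \<in> Obj C" "g \<in> Hom C Y Z"
  then show "up (a X) (a Z) (Comp C X Y Z g f) =
      Comp D (q (a X)) (q (a Y)) (q (a Z)) (up (a Y) (a Z) g) (up (a X) (a Y) f)"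
    using up_comp [of "a X" "a Y" "a Z" f g] a X Y f by simp
qed

end

section \<open>The quasi-inverse and the two natural isomorphisms\<close>

context correspondence
begin

interpretation opp: correspondence D C q p R "\<lambda>r r' g f. M r r' f g"
  by (rule swap)

lemma up_down: "\<lbrakk>r \<in> R; r' \<in> R; g \<in> Hom D (q r) (q r')\<rbrakk> \<Longrightarrow> up r r' (opp.up r r' g) = g"
  by (intro up_eqI opp.up)

lemma down_up: "\<lbrakk>r \<in> R; r' \<in> R; f \<in> Hom C (p r) (p r')\<rbrakk> \<Longrightarrow> opp.up r r' (up r r' f) = f"
  by (intro opp.up_eqI up)

lemma equivalent: "equivalent_categories C D"
proof -
  have "\<forall>X\<in>Obj C. \<exists>r\<in>R. p r = X" unfolding p [symmetric] by blast
  moreover have "\<forall>Y\<in>Obj D. \<exists>r\<in>R. q r = Y" unfolding q [symmetric] by blast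
  ultimately obtain a b where a: "\<And>X. X \<in> Obj C \<Longrightarrow> a X \<in> R \<and> p (a X) = X"
    and b: "\<And>Y. Y \<in> Obj D \<Longrightarrow> b Y \<in> R \<and> q (b Y) = Y"
    by metis
  \<comment> \<open>The matchings a X and b (F X) share the object F X of D, so lowering its
    identity gives the isomorphism from X to G (F X). Dually, b Y and a (G Y) share the object G Y
    of C.\<close>
  define F where "F X = q (a X)" for X
  define G where "G Y = p (b Y)" for Y
  have a': "a X \<in> R" "p (a X) = X" "b (F X) \<in> R" "q (a X) = F X" "q (b (F X)) = F X" "p (b (F X)) = G (F X)"
    if "X \<in> Obj C" for X
    using a [OF that] b [of "F X"] obj(2) [of "a X"] by (simp_all add: F_def G_def)
  have b': "b Y \<in> R" "q (b Y) = Y" "a (G Y) \<in> R" "p (b Y) = G Y" "p (a (G Y)) = G Y" "q (a (G Y)) = F (G Y)"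
    if "Y \<in> Obj D" for Y
    using b [OF that] a [of "G Y"] obj(1) [of "b Y"] by (simp_all add: F_def G_def)
  have "is_functor C D F (\<lambda>X Y. up (a X) (a Y))"
    unfolding F_def by (rule up_functor [OF a])
  moreover have "is_functor D C G (\<lambda>X Y. opp.up (b X) (b Y))"
    unfolding G_def by (rule opp.up_functor [OF b])
  moreover have "natural_iso C C (\<lambda>X. X) (\<lambda>X Y f. f) (\<lambda>X. G (F X))
      (\<lambda>X Y f. opp.up (b (F X)) (b (F Y)) (up (a X) (a Y) f))
      (\<lambda>X. opp.up (a X) (b (F X)) (Ident D (F X)))"
    unfolding natural_iso_def
  proof (intro conjI ballI)
    fix X assume X: "X \<in> Obj C"
    show "is_iso C X (G (F X)) (opp.up (a X) (b (F X)) (Ident D (F X)))"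
      using opp.up_iso [of "a X" "b (F X)"] a' [OF X] by simp
    fix Y f assume Y: "Y \<in> Obj C" and f: "f \<in> Hom C X Y"
    show "Comp C X Y (G (F Y)) (opp.up (a Y) (b (F Y)) (Ident D (F Y))) f =
        Comp C X (G (F X)) (G (F Y)) (opp.up (b (F X)) (b (F Y)) (up (a X) (a Y) f))
          (opp.up (a X) (b (F X)) (Ident D (F X)))"
      using opp.up_natural [of "a X" "b (F X)" "a Y" "b (F Y)" "up (a X) (a Y) f"]
        up(1) [of "a X" "a Y" f] down_up [of "a X" "a Y" f] a' [OF X] a' [OF Y] f by simp
  qed
  moreover have "natural_iso D D (\<lambda>Y. F (G Y)) (\<lambda>X Y g. up (a (G X)) (a (G Y)) (opp.up (b X) (b Y) g))
      (\<lambda>Y. Y) (\<lambda>X Y g. g) (\<lambda>Y. up (a (G Y)) (b Y) (Ident C (G Y)))"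
    unfolding natural_iso_def
  proof (intro conjI ballI)
    fix X assume X: "X \<in> Obj D"
    show "is_iso D (F (G X)) X (up (a (G X)) (b X) (Ident C (G X)))"
      using up_iso [of "a (G X)" "b X"] b' [OF X] by simp
    fix Y g assume Y: "Y \<in> Obj D" and g: "g \<in> Hom D X Y"
    show "Comp D (F (G X)) (F (G Y)) Y (up (a (G Y)) (b Y) (Ident C (G Y)))
          (up (a (G X)) (a (G Y)) (opp.up (b X) (b Y) g)) =
        Comp D (F (G X)) X Y g (up (a (G X)) (b X) (Ident C (G X)))"
      using up_natural [of "a (G X)" "b X" "a (G Y)" "b Y" "opp.up (b X) (b Y) g"]
        opp.up(1) [of "b X" "b Y" g] up_down [of "b X" "b Y" g] b' [OF X] b' [OF Y] g by simp
  qed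
  ultimately show ?thesis
    unfolding equivalent_categories_def using C.category_axioms D.category_axioms by blast
qed

end

section \<open>The two concrete categories\<close>

lemma category_op_cat: "category C \<Longrightarrow> category (op_cat C)"
  by (simp add: category_def op_cat_def)

text \<open>Both categories consist of restricted functions between carriers. \<open>cong\<close>
  absorbs the restriction, so the arrow property has to be checked only for plain identity functions
  and plain composites.\<close>

lemma category_extensionalI:
  assumes C: "C = \<lparr>Obj = Ob, Hom = (\<lambda>X Y. {f \<in> extensional (A X). H X Y f}),
      Ident = (\<lambda>X. \<lambda>x\<in>A X. x), Comp = (\<lambda>X Y Z g f. compose (A X) g f)\<rparr>"
    and closed: "\<And>X Y f x. H X Y f \<Longrightarrow> x \<in> A X \<Longrightarrow> f x \<in> A Y"
    and ident: "\<And>X. X \<in> Ob \<Longrightarrow> H X X (\<lambda>x. x)"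
    and comp: "\<And>X Y Z f g. \<lbrakk>X \<in> Ob; Y \<in> Ob; Z \<in> Ob; H X Y f; H Y Z g\<rbrakk> \<Longrightarrow> H X Z (g \<circ> f)"
    and cong: "\<And>X Y f g. \<lbrakk>X \<in> Ob; H X Y f; \<And>x. x \<in> A X \<Longrightarrow> g x = f x\<rbrakk> \<Longrightarrow> H X Y g"
  shows "category C"
proof
  fix X assume "X \<in> Obj C"
  then show "Ident C X \<in> Hom C X X" by (auto simp: C intro: cong [OF _ ident])
next
  fix X Y Z f g
  assume "X \<in> Obj C" "Y \<in> Obj C" "Z \<in> Obj C" "f \<in> Hom C X Y" "g \<in> Hom C Y Z"
  then have "X \<in> Ob" "H X Z (g \<circ> f)" using comp by (auto simp: C)
  then have "H X Z (compose (A X) g f)" by (rule cong) (simp add: compose_eq)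
  then show "Comp C X Y Z g f \<in> Hom C X Z" by (simp add: C)
next
  fix X Y f assume "f \<in> Hom C X Y"
  then have f: "f \<in> extensional (A X)" "f \<in> A X \<rightarrow> A Y" using closed by (auto simp: C)
  then show "Comp C X X Y f (Ident C X) = f" "Comp C X Y Y (Ident C Y) f = f"
    using compose_Id [OF f(2,1)] Id_compose [OF f(2,1)] by (simp_all add: C)
next
  fix W X Y Z f g h assume "f \<in> Hom C W X"
  then have "f \<in> A W \<rightarrow> A X" using closed by (auto simp: C)
  then show "Comp C W Y Z h (Comp C W X Y g f) = Comp C W X Z (Comp C X Y Z h g) f"
    by (simp add: C compose_assoc)
qed

lemma category_Inv_sp: "category (Inv_sp P)"
proof (rule category_extensionalI [OF Inv_sp_def])
  let ?O = "{S. spatial_pseudogroup S \<and> P S}"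
  have ps: "pseudogroup X" if "X \<in> ?O" for X
    using that by (auto intro: spatial_pseudogroup.axioms)
  show "callitic X X (\<lambda>x. x)" if "X \<in> ?O" for X
    using callitic_id [OF ps [OF that]] .
  show "callitic X Z (g \<circ> f)"
    if "X \<in> ?O" "Y \<in> ?O" "Z \<in> ?O" "callitic X Y f" "callitic Y Z g" for X Y Z f g
    by (rule callitic_comp [OF ps [OF that(1)] ps [OF that(2)] ps [OF that(3)] that(4,5)])
  show "callitic X Y g" if "X \<in> ?O" "callitic X Y f"
    "\<And>x. x \<in> carrier X \<Longrightarrow> g x = f x" for X Y f g
    by (rule callitic_cong [OF ps [OF that(1)] that(2,3)])
qed (rule callitic_closed)

lemma category_Etale_so: "category (Etale_so P)"
proof (rule category_extensionalI [OF Etale_so_def])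
  let ?O = "{G. sober_etale_groupoid G \<and> P G}"
  have tg: "topological_groupoid X" if "X \<in> ?O" for X
    using that by (auto intro: sober_etale_groupoid.axioms etale_groupoid.axioms)
  then have gp: "groupoid X" if "X \<in> ?O" for X
    using that by (auto intro: topological_groupoid.axioms)
  show "covering_functor X X (\<lambda>x. x) \<and> continuous_map (gtop X) (gtop X) (\<lambda>x. x)"
    if "X \<in> ?O" for X
    using covering_functor_id [OF gp [OF that]] continuous_map_id [unfolded id_def] by blast
  show "covering_functor X Z (g \<circ> f) \<and> continuous_map (gtop X) (gtop Z) (g \<circ> f)"
    if "X \<in> ?O"
      "covering_functor X Y f \<and> continuous_map (gtop X) (gtop Y) f"
      "covering_functor Y Z g \<and> continuous_map (gtop Y) (gtop Z) g" for X Y Z f g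
    using that(2,3) covering_functor_comp [OF gp [OF that(1)]] continuous_map_compose by blast
  show "covering_functor X Y g \<and> continuous_map (gtop X) (gtop Y) g"
    if X: "X \<in> ?O"
      and f: "covering_functor X Y f \<and> continuous_map (gtop X) (gtop Y) f"
      and eq: "\<And>x. x \<in> carrier X \<Longrightarrow> g x = f x" for X Y f g
  proof
    show "covering_functor X Y g" by (rule covering_functor_cong [OF gp [OF X] conjunct1 [OF f] eq])
    show "continuous_map (gtop X) (gtop Y) g"
      by (rule continuous_map_eq [OF conjunct2 [OF f]])
        (simp add: eq topological_groupoid.topspace_gtop [OF tg [OF X]])
  qed
qed (blast intro: covering_closed)

text \<open>Size enters only through P and Q: every admissible object must have an admissible dual
  partner in the prescribed type.\<close>

lemma equivalent_Inv_sp_Etale_so: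
  fixes P :: "'a monoid \<Rightarrow> bool" and Q :: "'b top_groupoid \<Rightarrow> bool"
  assumes P: "\<And>S. \<lbrakk>spatial_pseudogroup S; P S\<rbrakk> \<Longrightarrow> \<exists>G \<beta>. duality G S \<beta> \<and> Q G"
    and Q: "\<And>G. \<lbrakk>sober_etale_groupoid G; Q G\<rbrakk> \<Longrightarrow> \<exists>S \<beta>. duality G S \<beta> \<and> P S"
  shows "equivalent_categories (op_cat (Inv_sp P)) (Etale_so Q)"
proof -
  \<comment> \<open>The representation \<beta> is part of a matching because arrows are compared
    relative to it. An object may occur in many matchings.\<close>
  define R where "R = {(S, G, \<beta>). duality G S \<beta> \<and> P S \<and> Q G}"
  define p :: "'a monoid \<times> 'b top_groupoid \<times> ('a \<Rightarrow> 'b set) \<Rightarrow> 'a monoid" where "p = fst"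
  define q :: "'a monoid \<times> 'b top_groupoid \<times> ('a \<Rightarrow> 'b set) \<Rightarrow> 'b top_groupoid" where "q = fst \<circ> snd"
  \<comment> \<open>An arrow from p r to p r' in the opposite category is a morphism from p r' to p
    r; hence r' supplies the source of \<theta> and r the source of \<alpha>.\<close>
  define M where "M r r' \<theta> \<alpha> \<longleftrightarrow> dual_arrow (p r') (snd (snd r')) (q r) (snd (snd r)) \<theta> \<alpha>"
    for r r' \<theta> \<alpha>
  have dual: "duality (q r) (p r) (snd (snd r))" "P (p r)" "Q (q r)" if "r \<in> R" for r
    using that by (auto simp: R_def p_def q_def)
  have obj: "spatial_pseudogroup (p r)" "sober_etale_groupoid (q r)" if "r \<in> R" for r
  proof -
    interpret duality "q r" "p r" "snd (snd r)" by (rule dual(1) [OF that])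
    show "spatial_pseudogroup (p r)" "sober_etale_groupoid (q r)" by unfold_locales
  qed
  have homC: "\<theta> \<in> Hom (op_cat (Inv_sp P)) S S' \<longleftrightarrow> \<theta> \<in> extensional (carrier S') \<and> callitic S' S \<theta>" for \<theta> S S'
    by (simp add: op_cat_def Inv_sp_def)
  have homD: "\<alpha> \<in> Hom (Etale_so Q) G G' \<longleftrightarrow> \<alpha> \<in> extensional (carrier G) \<and> covering_functor G G' \<alpha> \<and>
      continuous_map (gtop G) (gtop G') \<alpha>" for \<alpha> G G'
    by (simp add: Etale_so_def)
  show ?thesis
  proof (rule correspondence.equivalent, intro correspondence.intro correspondence_axioms.intro)
    show "category (op_cat (Inv_sp P))" by (intro category_op_cat category_Inv_sp)
    show "category (Etale_so Q)" by (rule category_Etale_so)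
    show "p ` R = Obj (op_cat (Inv_sp P))"
    proof (intro equalityI subsetI)
      fix S assume "S \<in> Obj (op_cat (Inv_sp P))"
      then have S: "spatial_pseudogroup S" "P S" by (simp_all add: op_cat_def Inv_sp_def)
      then obtain G \<beta> where "duality G S \<beta>" "Q G" using P by blast
      with S have "(S, G, \<beta>) \<in> R" by (simp add: R_def)
      then show "S \<in> p ` R" by (force simp: p_def)
    qed (use obj dual in \<open>auto simp: op_cat_def Inv_sp_def\<close>)
    show "q ` R = Obj (Etale_so Q)"
    proof (intro equalityI subsetI)
      fix G assume "G \<in> Obj (Etale_so Q)"
      then have G: "sober_etale_groupoid G" "Q G" by (simp_all add: Etale_so_def)
      then obtain S \<beta> where "duality G S \<beta>" "P S" using Q by blast
      with G have "(S, G, \<beta>) \<in> R" by (simp add: R_def)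
      then show "G \<in> q ` R" by (force simp: q_def)
    qed (use obj dual in \<open>auto simp: Etale_so_def\<close>)
  next
    fix r r' \<theta> assume r: "r \<in> R" "r' \<in> R" and "\<theta> \<in> Hom (op_cat (Inv_sp P)) (p r) (p r')"
    then have "callitic (p r') (p r) \<theta>" by (simp add: homC)
    from ex_dual_covering_functor [OF dual(1) [OF r(2)] dual(1) [OF r(1)] this]
    show "\<exists>\<alpha>\<in>Hom (Etale_so Q) (q r) (q r'). M r r' \<theta> \<alpha>" by (metis homD M_def)
  next
    fix r r' \<alpha> assume r: "r \<in> R" "r' \<in> R" and "\<alpha> \<in> Hom (Etale_so Q) (q r) (q r')"
    then have "covering_functor (q r) (q r') \<alpha>" "continuous_map (gtop (q r)) (gtop (q r')) \<alpha>"
      by (simp_all add: homD)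
    from ex_dual_callitic [OF dual(1) [OF r(2)] dual(1) [OF r(1)] this]
    show "\<exists>\<theta>\<in>Hom (op_cat (Inv_sp P)) (p r) (p r'). M r r' \<theta> \<alpha>" by (metis homC M_def)
  next
    fix r r' \<theta> \<alpha> \<alpha>' assume r: "r \<in> R" "r' \<in> R"
      and \<alpha>: "\<alpha> \<in> Hom (Etale_so Q) (q r) (q r')" "\<alpha>' \<in> Hom (Etale_so Q) (q r) (q r')"
        "M r r' \<theta> \<alpha>" "M r r' \<theta> \<alpha>'"
    then show "\<alpha> = \<alpha>'"
      using covering_closed
      by (intro dual_covering_functor_unique [OF dual(1) [OF r(2)] dual(1) [OF r(1)]])
        (auto simp: homD M_def)
  next
    fix r r' \<theta> \<theta>' \<alpha> assume r: "r \<in> R" "r' \<in> R"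
      and \<theta>: "\<theta> \<in> Hom (op_cat (Inv_sp P)) (p r) (p r')" "\<theta>' \<in> Hom (op_cat (Inv_sp P)) (p r) (p r')"
        "M r r' \<theta> \<alpha>" "M r r' \<theta>' \<alpha>"
    then show "\<theta> = \<theta>'"
      using callitic_closed
      by (intro dual_callitic_unique [OF dual(1) [OF r(2)] dual(1) [OF r(1)]])
        (auto simp: homC M_def)
  next
    fix r assume r: "r \<in> R"
    interpret duality "q r" "p r" "snd (snd r)" by (rule dual(1) [OF r])
    show "M r r (Ident (op_cat (Inv_sp P)) (p r)) (Ident (Etale_so Q) (q r))"
      using rep_subset by (auto simp: M_def dual_arrow_def op_cat_def Inv_sp_def Etale_so_def)
  next
    fix r r' r'' \<theta> \<alpha> \<theta>' \<alpha>'
    assume r: "r \<in> R" "r' \<in> R" "r'' \<in> R"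
      and h: "\<theta> \<in> Hom (op_cat (Inv_sp P)) (p r) (p r')" "\<alpha> \<in> Hom (Etale_so Q) (q r) (q r')"
        "\<theta>' \<in> Hom (op_cat (Inv_sp P)) (p r') (p r'')" "\<alpha>' \<in> Hom (Etale_so Q) (q r') (q r'')"
        "M r r' \<theta> \<alpha>" "M r' r'' \<theta>' \<alpha>'"
    have "\<theta>' s \<in> carrier (p r')" if "s \<in> carrier (p r'')" for s
      using h(3) that callitic_closed by (auto simp: homC)
    moreover have "\<alpha> x \<in> carrier (q r')" if "x \<in> carrier (q r)" for x
      using h(2) that covering_closed by (auto simp: homD)
    ultimately show "M r r'' (Comp (op_cat (Inv_sp P)) (p r) (p r') (p r'') \<theta>' \<theta>)
        (Comp (Etale_so Q) (q r) (q r') (q r'') \<alpha>' \<alpha>)"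
      using h(5,6)
      by (auto simp: M_def dual_arrow_def op_cat_def Inv_sp_def Etale_so_def compose_eq)
  qed
qed

section \<open>Size conditions\<close>

lemma universe_relabel:
  fixes \<U> :: "'u set set" and \<A> :: "'u set set"
  assumes "universe \<U>" "A \<in> \<U>" "\<A> \<subseteq> Pow A"
  obtains f :: "'u set \<Rightarrow> 'u" where "inj_on f \<A>" "f ` \<A> \<in> \<U>"
proof -
  obtain B where B: "B \<in> \<U>" "Pow A \<approx> B" using assms by (auto simp: universe_def)
  then obtain f where f: "bij_betw f (Pow A) B" by (auto simp: eqpoll_def)
  then have "inj_on f \<A>" "f ` \<A> \<subseteq> B"
    using assms(3) by (auto simp: bij_betw_def intro: inj_on_subset)
  moreover from this have "f ` \<A> \<in> \<U>" using assms(1) B(1) by (auto simp: universe_def)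
  ultimately show thesis using that by blast
qed

theorem theorem2p23:
  fixes \<U> :: "'u set set"
  shows "(universe \<U> \<longrightarrow>
      equivalent_categories (op_cat (Inv_sp (\<lambda>S. carrier S \<in> \<U>)))
        (Etale_so (\<lambda>G. carrier G \<in> \<U>))) \<and>
    equivalent_categories
      (op_cat (Inv_sp (\<lambda>S :: 'a monoid. cp_filters S \<lesssim> (UNIV :: 'b set))))
      (Etale_so (\<lambda>G :: 'b top_groupoid. open_bisections G \<lesssim> (UNIV :: 'a set)))"
proof (intro conjI impI)
  assume \<U>: "universe \<U>"
  show "equivalent_categories (op_cat (Inv_sp (\<lambda>S. carrier S \<in> \<U>))) (Etale_so (\<lambda>G. carrier G \<in> \<U>))"
  proof (rule equivalent_Inv_sp_Etale_so)
    fix S :: "'u monoid" assume S: "spatial_pseudogroup S" "carrier S \<in> \<U>"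
    have "cp_filters S \<subseteq> Pow (carrier S)" using cp_filter_subset by blast
    with \<U> S(2) obtain f where f: "inj_on f (cp_filters S)" "f ` cp_filters S \<in> \<U>"
      by (rule universe_relabel)
    from spatial_pseudogroup.ex_dual_groupoid [OF S(1) f(1)] f(2)
    show "\<exists>(G :: 'u top_groupoid) \<beta>. duality G S \<beta> \<and> carrier G \<in> \<U>" by metis
  next
    fix G :: "'u top_groupoid" assume G: "sober_etale_groupoid G" "carrier G \<in> \<U>"
    have "open_bisections G \<subseteq> Pow (carrier G)" by (auto simp: open_bisections_def bisection_def)
    with \<U> G(2) obtain h where h: "inj_on h (open_bisections G)" "h ` open_bisections G \<in> \<U>"
      by (rule universe_relabel)
    from sober_etale_groupoid.ex_dual_monoid [OF G(1) h(1)] h(2)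
    show "\<exists>(S :: 'u monoid) \<beta>. duality G S \<beta> \<and> carrier S \<in> \<U>" by metis
  qed
next
  show "equivalent_categories
      (op_cat (Inv_sp (\<lambda>S :: 'a monoid. cp_filters S \<lesssim> (UNIV :: 'b set))))
      (Etale_so (\<lambda>G :: 'b top_groupoid. open_bisections G \<lesssim> (UNIV :: 'a set)))"
  proof (rule equivalent_Inv_sp_Etale_so)
    fix S :: "'a monoid" assume S: "spatial_pseudogroup S" "cp_filters S \<lesssim> (UNIV :: 'b set)"
    then obtain f :: "'a set \<Rightarrow> 'b" where "inj_on f (cp_filters S)" by (auto simp: lepoll_def)
    then obtain G :: "'b top_groupoid" and \<beta> where dual: "duality G S \<beta>"
      by (rule spatial_pseudogroup.ex_dual_groupoid [OF S(1)])
    interpret duality G S \<beta> by (rule dual)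
    \<comment> \<open>The open bisections of a dual groupoid are in bijection with the elements of
      S, which are taken from \<open>'a\<close>; this is the size condition on G.\<close>
    have "carrier S \<approx> open_bisections G" using bij by (auto simp: eqpoll_def)
    then have "open_bisections G \<lesssim> (UNIV :: 'a set)"
      by (metis eqpoll_imp_lepoll eqpoll_sym lepoll_trans subset_UNIV subset_imp_lepoll)
    with dual show "\<exists>(G :: 'b top_groupoid) \<beta>. duality G S \<beta> \<and> open_bisections G \<lesssim> (UNIV :: 'a set)"
      by blast
  next
    fix G :: "'b top_groupoid"
    assume G: "sober_etale_groupoid G" "open_bisections G \<lesssim> (UNIV :: 'a set)"
    then obtain h :: "'b set \<Rightarrow> 'a" where "inj_on h (open_bisections G)" by (auto simp: lepoll_def)
    then obtain S :: "'a monoid" and \<beta> where dual: "duality G S \<beta>"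
      by (rule sober_etale_groupoid.ex_dual_monoid [OF G(1)])
    interpret duality G S \<beta> by (rule dual)
    \<comment> \<open>The completely prime filters of a dual monoid are in bijection with the arrows
      of G, which are taken from \<open>'b\<close>; this is the size condition on S.\<close>
    have "carrier G \<approx> cp_filters S" using points by (auto simp: eqpoll_def)
    then have "cp_filters S \<lesssim> (UNIV :: 'b set)"
      by (metis eqpoll_imp_lepoll eqpoll_sym lepoll_trans subset_UNIV subset_imp_lepoll)
    with dual show "\<exists>(S :: 'a monoid) \<beta>. duality G S \<beta> \<and> cp_filters S \<lesssim> (UNIV :: 'b set)"
      by blast
  qed
qed

end
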